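(* Let $\Delta$ be a $d$-dimensional convex compact set and let $M$ be a $d$-dimensional compact oriented manifold with boundary. Let $g:M\to\Delta$ be a continuous function, and let $f:M\to\Delta$ be a smooth function that satisfies the following conditions: \begin{itemize} \item $\partial M\subseteq f^{-1}(\partial\Delta)$; \item the degree of $f$ is not zero: $\deg(f)\neq 0$. \end{itemize} Then there is $x\in M$ such that $f(x)=g(x)$.
   Context: All manifolds are smooth and oriented. The $d$-dimensional convex compact set $\Delta$ is a subset of a Euclidean space, with $\partial\Delta$ its boundary relative to its ($d$-dimensional) affine hull and the orientation of that affine hull. Since $f(\partial M)\subseteq\partial\Delta$, the degree $\deg(f)$ is the usual oriented degree: the signed number of preimages under $f$ of a regular value in the (relative) interior of $\Delta$. *)

theory Defs
  imports "HOL-Analysis.Analysis"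
begin

text \<open>
  The dimension \<open>d\<close> is a number and may be \<open>0\<close>, whereas the dimension of a type \<open>real ^ 'n\<close> is
  fixed and positive. So \<open>\<real>\<^sup>d\<close> is rendered as the coordinate space \<open>\<real>\<^sup>K\<close> inside \<open>real ^ 'n\<close>, for
  a set \<open>K\<close> of \<open>d\<close> indices. The sign of the determinant of a matrix with rows and columns indexed
  by \<open>K\<close> does not depend on how \<open>K\<close> is ordered.
\<close>

definition coord_space :: "'n set \<Rightarrow> (real ^ 'n::finite) set" where
  "coord_space K = {v. \<forall>i. i \<notin> K \<longrightarrow> v $ i = 0}"

definition half_space :: "'n set \<Rightarrow> 'n \<Rightarrow> (real ^ 'n::finite) set" where
  "half_space K k = {v \<in> coord_space K. 0 \<le> v $ k}"

primrec Ck_on :: "nat \<Rightarrow> 'v set \<Rightarrow> ('v::real_normed_vector \<Rightarrow> 'w::real_normed_vector) \<Rightarrow> bool" where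
  "Ck_on 0 U f \<longleftrightarrow> continuous_on U f"
| "Ck_on (Suc k) U f \<longleftrightarrow> (\<forall>x\<in>U. f differentiable (at x)) \<and>
     (\<forall>v. Ck_on k U (\<lambda>x. frechet_derivative f (at x) v))"

text \<open>
  Smoothness on an arbitrary subset of a normed space: local smooth extendability. This is what is
  needed for relatively open subsets of \<open>\<real>\<^sup>K\<close> and of its closed half-spaces.
\<close>

definition smooth_on :: "'v set \<Rightarrow> ('v::real_normed_vector \<Rightarrow> 'w::real_normed_vector) \<Rightarrow> bool" where
  "smooth_on S f \<longleftrightarrow> (\<forall>x\<in>S. \<exists>U F. open U \<and> x \<in> U \<and> (\<forall>k. Ck_on k U F) \<and> (\<forall>y\<in>S \<inter> U. F y = f y))"

text \<open>A chart is a pair of its domain and its coordinate map.\<close>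

type_synonym ('a, 'n) chart = "'a set \<times> ('a \<Rightarrow> real ^ 'n)"

definition is_chart :: "'n::finite set \<Rightarrow> 'a topology \<Rightarrow> ('a, 'n) chart \<Rightarrow> bool" where
  "is_chart K X c \<longleftrightarrow>
     openin X (fst c) \<and>
     homeomorphic_map (subtopology X (fst c)) (top_of_set (snd c ` fst c)) (snd c) \<and>
     (openin (top_of_set (coord_space K)) (snd c ` fst c) \<or>
      (\<exists>k\<in>K. openin (top_of_set (half_space K k)) (snd c ` fst c)))"

definition in_chart :: "('a, 'n::finite) chart \<Rightarrow> ('a \<Rightarrow> 'b) \<Rightarrow> real ^ 'n \<Rightarrow> 'b" where
  "in_chart c f = f \<circ> inv_into (fst c) (snd c)"

definition smooth_manifold :: "'n::finite set \<Rightarrow> 'a topology \<Rightarrow> ('a, 'n) chart set \<Rightarrow> bool" where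
  "smooth_manifold K X A \<longleftrightarrow>
     Hausdorff_space X \<and> second_countable X \<and>
     (\<forall>c\<in>A. is_chart K X c) \<and> (\<Union>c\<in>A. fst c) = topspace X \<and>
     (\<forall>c\<in>A. \<forall>c'\<in>A. smooth_on (snd c ` (fst c \<inter> fst c')) (in_chart c (snd c')))"

definition manifold_boundary :: "'n::finite set \<Rightarrow> 'a topology \<Rightarrow> ('a, 'n) chart set \<Rightarrow> 'a set" where
  "manifold_boundary K X A =
     {x. \<exists>c\<in>A. \<exists>k\<in>K. x \<in> fst c \<and>
           openin (top_of_set (half_space K k)) (snd c ` fst c) \<and> snd c x $ k = 0}"

definition smooth_map ::
    "('a, 'n::finite) chart set \<Rightarrow> ('a \<Rightarrow> 'b::real_normed_vector) \<Rightarrow> bool" where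
  "smooth_map A f \<longleftrightarrow> (\<forall>c\<in>A. smooth_on (snd c ` fst c) (in_chart c f))"

text \<open>
  The determinant of a linear map from \<open>\<real>\<^sup>K\<close> to the span of a basis \<open>b\<close> indexed by \<open>K\<close>; the
  matrix is completed by the identity outside \<open>K\<close> (so the determinant is \<open>1\<close> for empty \<open>K\<close>).
\<close>

definition det_wrt ::
    "'n::finite set \<Rightarrow> ('n \<Rightarrow> 'b::real_vector) \<Rightarrow> (real ^ 'n \<Rightarrow> 'b) \<Rightarrow> real" where
  "det_wrt K b D =
     det ((\<chi> i j. if i \<in> K \<and> j \<in> K then representation (b ` K) (D (axis j 1)) (b i)
                  else if i = j then 1 else 0) :: real ^ 'n ^ 'n)"

definition det_sign ::
    "'n::finite set \<Rightarrow> ('n \<Rightarrow> 'b::real_vector) \<Rightarrow> (real ^ 'n \<Rightarrow> 'b) \<Rightarrow> int" where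
  "det_sign K b D = (if det_wrt K b D > 0 then 1 else if det_wrt K b D < 0 then -1 else 0)"

text \<open>
  An orientation of the manifold is a continuous choice of orientations of the tangent spaces:
  \<open>ori c x\<close> is \<open>1\<close> if the coordinate frame of the chart \<open>c\<close> is positively oriented at \<open>x\<close>,
  and \<open>-1\<close> otherwise. Unlike an atlas with positive transition determinants, this is also correct
  in dimension \<open>0\<close> (a sign for each point) and for half-space charts in dimension \<open>1\<close>.
  Derivatives are taken within the chart image; \<open>frechet_derivative\<close> is uniquely determined
  on \<open>\<real>\<^sup>K\<close>, and only its values there are used.
\<close>

definition orientation ::
    "'n::finite set \<Rightarrow> 'a topology \<Rightarrow> ('a, 'n) chart set \<Rightarrow> (('a, 'n) chart \<Rightarrow> 'a \<Rightarrow> int) \<Rightarrow> bool" where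
  "orientation K X A ori \<longleftrightarrow>
     (\<forall>c\<in>A. continuous_map (subtopology X (fst c)) (discrete_topology {-1, 1}) (ori c)) \<and>
     (\<forall>c\<in>A. \<forall>c'\<in>A. \<forall>x\<in>fst c \<inter> fst c'.
        ori c x = ori c' x * det_sign K (\<lambda>i. axis i 1)
          (frechet_derivative (in_chart c (snd c')) (at (snd c x) within snd c ` (fst c \<inter> fst c'))))"

definition direction_space :: "'b::real_vector set \<Rightarrow> 'b set" where
  "direction_space S = {x - y | x y. x \<in> affine hull S \<and> y \<in> affine hull S}"

text \<open>
  \<open>b\<close> restricted to \<open>K\<close> is a basis of the direction space of the affine hull of \<open>S\<close>. Such a basis
  represents the orientation of the affine hull for which it is positively oriented.
\<close>

definition affine_frame :: "'n set \<Rightarrow> 'b::real_vector set \<Rightarrow> ('n \<Rightarrow> 'b) \<Rightarrow> bool" where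
  "affine_frame K S b \<longleftrightarrow> inj_on b K \<and> independent (b ` K) \<and> span (b ` K) = direction_space S"

definition chart_derivative ::
    "('a, 'n::finite) chart \<Rightarrow> ('a \<Rightarrow> 'b::real_normed_vector) \<Rightarrow> 'a \<Rightarrow> real ^ 'n \<Rightarrow> 'b" where
  "chart_derivative c f x = frechet_derivative (in_chart c f) (at (snd c x) within snd c ` fst c)"

text \<open>Regular values of a map into the affine hull of \<open>S\<close>.\<close>

definition regular_value ::
    "'n::finite set \<Rightarrow> ('a, 'n) chart set \<Rightarrow> 'b::real_normed_vector set \<Rightarrow> ('a \<Rightarrow> 'b) \<Rightarrow> 'b \<Rightarrow> bool" where
  "regular_value K A S f y \<longleftrightarrow>
     (\<forall>c\<in>A. \<forall>x\<in>fst c. f x = y \<longrightarrow> chart_derivative c f x ` coord_space K = direction_space S)"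

text \<open>
  Whether the derivative of \<open>f\<close> at \<open>x\<close> preserves orientations (\<open>1\<close>) or reverses them (\<open>-1\<close>); this
  does not depend on the chart that is used.
\<close>

definition local_sign ::
    "'n::finite set \<Rightarrow> ('a, 'n) chart set \<Rightarrow> (('a, 'n) chart \<Rightarrow> 'a \<Rightarrow> int) \<Rightarrow>
     ('n \<Rightarrow> 'b::real_normed_vector) \<Rightarrow> ('a \<Rightarrow> 'b) \<Rightarrow> 'a \<Rightarrow> int" where
  "local_sign K A ori b f x =
     (let c = (SOME c. c \<in> A \<and> x \<in> fst c) in ori c x * det_sign K b (chart_derivative c f x))"

text \<open>
  The degree of a smooth map \<open>f\<close> from a compact oriented manifold to \<open>S\<close> that maps the boundary to
  the relative boundary of \<open>S\<close>. A regular value in the relative interior exists by Sard's theorem, it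
  has finitely many preimages, and their signed number does not depend on the value chosen.
\<close>

definition map_degree ::
    "'n::finite set \<Rightarrow> 'a topology \<Rightarrow> ('a, 'n) chart set \<Rightarrow> (('a, 'n) chart \<Rightarrow> 'a \<Rightarrow> int) \<Rightarrow>
     'b::euclidean_space set \<Rightarrow> ('n \<Rightarrow> 'b) \<Rightarrow> ('a \<Rightarrow> 'b) \<Rightarrow> int" where
  "map_degree K X A ori S b f =
     (let y = (SOME y. y \<in> rel_interior S \<and> regular_value K A S f y)
      in \<Sum>x\<in>{x \<in> topspace X. f x = y}. local_sign K A ori b f x)"

end

theory Submission
  imports Defs
begin

text \<open>
  If \<open>f\<close> and \<open>g\<close> never agree, the straight-line homotopy from \<open>f - y\<close> to \<open>f - g\<close>, for a regular value
  \<open>y\<close> in the relative interior, has no zero on the boundary: by convexity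
  \<open>(1 - t) y + t g(x)\<close> reaches the relative frontier at most for \<open>t = 1\<close>. So the signed number of zeros
  of \<open>f - y\<close>, which is the degree, equals that of the nowhere vanishing map \<open>f - g\<close>, which is \<open>0\<close>.

  Homotopy invariance on the manifold is reduced to charts. The homotopy is run in finitely many
  stages, each of which changes the map only inside one chart, and after every stage the map is
  perturbed there, by polynomial approximation and Sard's theorem, to one with nondegenerate zeros.
  In \<open>\<real>\<^sup>n\<close>, the signed number of zeros of a polynomial map \<open>p\<close> is the integral of
  \<open>det Dp \<cdot> \<Prod>\<^sub>l \<psi>(p\<^sub>l)\<close> up to a constant, for a bump function \<open>\<psi>\<close>. With an antiderivative \<open>\<Psi>\<close> of \<open>\<psi>\<close>
  this is the Jacobian determinant of \<open>\<Psi> \<circ> p\<close> (componentwise), a null Lagrangian, so that its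
  integral depends on the boundary behaviour only.
\<close>

section \<open>Square matrices over an index type without an order\<close>

text \<open>The intermediate maps are merely continuous, and differentiable at their zeros. This
  class (\<open>good\<close>) admits gluing a polynomial into a chart with a continuous cutoff, and
  it is why zeros are counted through polynomial approximations.

  The progress of the homotopy is a function \<tau> from the manifold to [0, 1]. A stage replaces
  \<tau> by max(\<tau>, u) for a bump u supported in one chart. At a boundary point, every stage
  therefore follows a piece of one and the same segment from f - y to f - g, up to a small error, so
  that a single lower bound along these segments serves all stages. Since perturbed maps only
  approximate the intended ones, each stage must be available with arbitrary precision.

  The obstacle is the boundary, which without its invariance is neither known to be closed nor to
  look alike in all charts. So the lower bound is obtained by compactness in the target, over
  \<open>rel_frontier \<Delta>\<close>, and charts are compared only at points off the
  boundary.\<close>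

text \<open>
  The library proves Sard's theorem and the linear change of variables for \<open>real ^ 'n\<close> only if \<open>'n\<close> is
  well-ordered. They are transferred to a finite \<open>'n\<close> along a copy of \<open>'n\<close> with an arbitrary order.
\<close>

typedef 'n wo = "UNIV :: 'n set" by simp

lemma range_Abs_wo: "range Abs_wo = UNIV"
  using type_definition.Abs_image[OF type_definition_wo] .

instance wo :: (finite) finite
proof
  have "finite (range (Abs_wo :: 'a \<Rightarrow> 'a wo))" by (rule finite_imageI) (rule finite)
  then show "finite (UNIV :: 'a wo set)" unfolding range_Abs_wo .
qed

definition wo_index :: "'n::finite wo \<Rightarrow> nat"
  where "wo_index = (SOME f. inj f)"

lemma inj_wo_index: "inj wo_index"
proof -
  have "\<exists>f :: 'n::finite wo \<Rightarrow> nat. inj f"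
    using finite_imp_inj_to_nat_seg[OF finite[of "UNIV :: 'n wo set"]] by blast
  then show ?thesis unfolding wo_index_def by (rule someI_ex)
qed

instantiation wo :: (finite) wellorder
begin

definition less_eq_wo :: "'a wo \<Rightarrow> 'a wo \<Rightarrow> bool"
  where "less_eq_wo x y \<longleftrightarrow> wo_index x \<le> wo_index y"

definition less_wo :: "'a wo \<Rightarrow> 'a wo \<Rightarrow> bool"
  where "less_wo x y \<longleftrightarrow> wo_index x < wo_index y"

instance
proof
  fix P :: "'a wo \<Rightarrow> bool" and a
  assume step: "\<And>x. (\<And>y. y < x \<Longrightarrow> P y) \<Longrightarrow> P x"
  show "P a"
  proof (induction "wo_index a" arbitrary: a rule: less_induct)
    case less
    show ?case by (rule step, rule less) (simp add: less_wo_def)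
  qed
next
  fix x y z :: "'a wo"
  show "x < y \<longleftrightarrow> x \<le> y \<and> \<not> y \<le> x" by (auto simp: less_eq_wo_def less_wo_def)
  show "x \<le> x" by (simp add: less_eq_wo_def)
  show "x \<le> z" if "x \<le> y" "y \<le> z" using that by (simp add: less_eq_wo_def)
  show "x = y" if "x \<le> y" "y \<le> x"
    using that unfolding less_eq_wo_def by (intro injD[OF inj_wo_index] antisym)
  show "x \<le> y \<or> y \<le> x" by (auto simp: less_eq_wo_def)
qed

end

definition rewo :: "real ^ 'n::finite \<Rightarrow> real ^ 'n wo"
  where "rewo v = (\<chi> i. v $ Rep_wo i)"

definition unwo :: "real ^ 'n::finite wo \<Rightarrow> real ^ 'n"
  where "unwo v = (\<chi> i. v $ Abs_wo i)"

lemma rewo_unwo [simp]: "rewo (unwo v) = v" "unwo (rewo w) = w"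
  by (simp_all add: rewo_def unwo_def vec_eq_iff Rep_wo_inverse Abs_wo_inverse)

lemma linear_rewo: "linear rewo" and linear_unwo: "linear unwo"
  by (auto intro!: linearI simp: rewo_def unwo_def vec_eq_iff)

lemma card_wo: "CARD('n::finite wo) = CARD('n)"
  by (rule type_definition.card[OF type_definition_wo])

lemma Sard_square:
  fixes f :: "real^'n::finite \<Rightarrow> real^'n"
  assumes der: "\<And>x. x \<in> S \<Longrightarrow> (f has_derivative f' x) (at x within S)"
    and sing: "\<And>x. x \<in> S \<Longrightarrow> det (matrix (f' x)) = 0"
  shows "negligible (f ` S)"
proof -
  let ?g = "rewo \<circ> f \<circ> unwo"
  let ?g' = "\<lambda>y. rewo \<circ> f' (unwo y) \<circ> unwo"
  have lin: "linear (f' x)" if "x \<in> S" for x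
    using der[OF that] has_derivative_linear by blast
  have "negligible (?g ` (rewo ` S))"
  proof (rule baby_Sard[where f' = ?g'])
    fix y assume y: "y \<in> rewo ` S"
    then have x: "unwo y \<in> S" by auto
    have 1: "(unwo has_derivative unwo) (at y within rewo ` S)"
      by (rule linear_imp_has_derivative[OF linear_unwo])
    have img: "unwo ` rewo ` S = S" by (auto simp: image_image)
    have 2: "(f has_derivative f' (unwo y)) (at (unwo y) within unwo ` rewo ` S)"
      unfolding img by (rule der[OF x])
    have 3: "(rewo has_derivative rewo) (at (f (unwo y)) within f ` unwo ` rewo ` S)"
      by (rule linear_imp_has_derivative[OF linear_rewo])
    show "(?g has_derivative ?g' y) (at y within rewo ` S)"
      using diff_chain_within[OF 1 diff_chain_within[OF 2 3, unfolded o_def], unfolded o_def] 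
      by (simp add: o_def)
    \<comment> \<open>Singularity is carried over as non-injectivity, which relabelling the
      coordinates does not affect.\<close>
    have "\<not> inj (f' (unwo y))"
      using sing[OF x] det_nz_iff_inj lin[OF x] by blast
    then obtain u v where uv: "u \<noteq> v" "f' (unwo y) u = f' (unwo y) v" by (auto simp: inj_def)
    then have "\<not> inj (?g' y)"
      unfolding inj_def o_def by (metis rewo_unwo(2))
    moreover have "(*v) (matrix (?g' y)) = ?g' y"
      by (simp add: lin[OF x] linear_rewo linear_unwo linear_compose matrix_works fun_eq_iff del: o_apply)
    ultimately show "rank (matrix (?g' y)) < CARD('n wo)"
      by (simp add: less_rank_noninjective)
  qed simp
  then have "negligible (unwo ` ?g ` (rewo ` S))"
    by (rule negligible_differentiable_image_negligible[rotated])
       (auto simp: card_wo linear_unwo linear_imp_differentiable_on)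
  then show ?thesis by (simp add: image_image)
qed

text \<open>Conjugation by a bijection preserves the sign of a permutation, so the two Leibniz sums
  agree term by term.\<close>

lemma det_rewo:
  fixes f :: "real^'n::finite \<Rightarrow> real^'n"
  assumes "linear f"
  shows "det (matrix (rewo \<circ> f \<circ> unwo)) = det (matrix f)"
proof -
  let ?P = "\<lambda>p :: 'n \<Rightarrow> 'n. map_permutation UNIV Abs_wo p"
  have inj: "inj (Abs_wo :: 'n \<Rightarrow> 'n wo)" by (metis Abs_wo_inverse UNIV_I injI)
  have bij: "bij (Abs_wo :: 'n \<Rightarrow> 'n wo)"
    using inj range_Abs_wo by (rule bijI)
  have bijP: "bij_betw ?P {p. p permutes UNIV} {p. p permutes UNIV}"
  proof -
    have "?P = (\<lambda>\<pi> x. Abs_wo (\<pi> (inv Abs_wo x)))"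
      using bij by (simp add: fun_eq_iff map_permutation_def restrict_id_def bij_is_surj)
    then show ?thesis using bij_betw_permutations[OF bij] by simp
  qed
  have ax: "unwo (axis (Abs_wo j) 1) = axis j (1::real)" for j :: 'n
    by (auto simp: unwo_def axis_def vec_eq_iff inj_eq[OF inj])
  have ent: "matrix (rewo \<circ> f \<circ> unwo) $ Abs_wo i $ Abs_wo j = matrix f $ i $ j" for i j
    by (simp add: matrix_def ax) (simp add: rewo_def Abs_wo_inverse)
  have P: "?P p (Abs_wo i) = Abs_wo (p i)" for p i
    using inj by (simp add: map_permutation_def restrict_id_def inv_f_f)
  have "det (matrix (rewo \<circ> f \<circ> unwo)) =
     (\<Sum>p\<in>{p. p permutes UNIV}. of_int (sign (?P p)) * (\<Prod>i\<in>UNIV. matrix (rewo \<circ> f \<circ> unwo) $ i $ ?P p i))"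
    unfolding det_def by (rule sum.reindex_bij_betw[OF bijP, symmetric])
  also have "\<dots> = (\<Sum>p\<in>{p. p permutes UNIV}. of_int (sign p) * (\<Prod>i\<in>UNIV. matrix f $ i $ p i))"
  proof (rule sum.cong[OF refl])
    fix p :: "'n \<Rightarrow> 'n" assume "p \<in> {p. p permutes UNIV}"
    then have "sign (?P p) = sign p" by (simp add: sign_map_permutation inj)
    moreover have "(\<Prod>i\<in>UNIV. matrix (rewo \<circ> f \<circ> unwo) $ i $ ?P p i) = (\<Prod>i\<in>UNIV. matrix f $ i $ p i)"
      by (subst prod.reindex_bij_betw[OF bij, symmetric]) (simp add: P ent)
    ultimately show "of_int (sign (?P p)) * (\<Prod>i\<in>UNIV. matrix (rewo \<circ> f \<circ> unwo) $ i $ ?P p i) =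
      of_int (sign p) * (\<Prod>i\<in>UNIV. matrix f $ i $ p i)" by simp
  qed
  finally show ?thesis by (simp add: det_def)
qed

text \<open>Lebesgue measure is determined by its values on boxes, and relabelling coordinates takes
  boxes to boxes with the same side lengths.\<close>

lemma lborel_distr_unwo: "distr lborel borel unwo = (lborel :: (real ^ 'n::finite) measure)"
proof (rule lborel_eqI[symmetric])
  have [measurable]: "unwo \<in> borel_measurable borel"
    by (intro borel_measurable_continuous_onI linear_continuous_on)
       (rule linear_conv_bounded_linear[THEN iffD1, OF linear_unwo])
  have bij: "bij (Abs_wo :: 'n \<Rightarrow> 'n wo)"
    by (metis range_Abs_wo Abs_wo_inverse UNIV_I bijI injI)
  have prodB: "(\<Prod>b\<in>Basis. v \<bullet> b) = (\<Prod>i\<in>UNIV. v $ i)" for v :: "real ^ 'm::finite"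
  proof -
    have *: "(Basis :: (real^'m) set) = (\<lambda>i. axis i 1) ` UNIV"
      by (auto simp: Basis_vec_def)
    show ?thesis unfolding *
      by (subst prod.reindex) (auto simp: inj_on_def axis_eq_axis inner_axis)
  qed
  fix l u :: "real^'n" assume lu: "\<And>b. b \<in> Basis \<Longrightarrow> l \<bullet> b \<le> u \<bullet> b"
  have "unwo -` box l u = box (rewo l) (rewo u)"
    by (auto simp: mem_box_cart rewo_def unwo_def) (metis Abs_wo_inverse Rep_wo_inverse UNIV_I)+
  moreover have "l $ i \<le> u $ i" for i
    using lu[of "axis i 1"] by (simp add: inner_axis)
  then have "\<forall>b\<in>Basis. rewo l \<bullet> b \<le> rewo u \<bullet> b"
    by (auto simp: Basis_vec_def inner_axis rewo_def)
  moreover have "(\<Prod>i\<in>UNIV. (rewo u - rewo l) $ i) = (\<Prod>i\<in>UNIV. (u - l) $ i)"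
    by (subst prod.reindex_bij_betw[OF bij, symmetric]) (simp add: rewo_def Abs_wo_inverse)
  ultimately show "emeasure (distr lborel borel unwo) (box l u) = (\<Prod>b\<in>Basis. (u - l) \<bullet> b)"
    by (simp add: emeasure_distr emeasure_lborel_box_eq prodB)
qed simp

lemma integral_linear_substitution:
  fixes A :: "real^'n::finite \<Rightarrow> real^'n" and F :: "real^'n \<Rightarrow> real"
  assumes A: "linear A" and F: "integrable lborel F" and nz: "det (matrix A) \<noteq> 0"
  shows "(\<integral>x. \<bar>det (matrix A)\<bar> * F (A x) \<partial>lborel) = (\<integral>x. F x \<partial>lborel)"
proof -
  let ?B = "rewo \<circ> A \<circ> unwo"
  have [measurable]: "unwo \<in> borel_measurable borel"
    by (intro borel_measurable_continuous_onI linear_continuous_on)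
       (rule linear_conv_bounded_linear[THEN iffD1, OF linear_unwo])
  have [measurable]: "F \<in> borel_measurable borel" using F by simp
  have [measurable]: "A \<in> borel_measurable borel"
    by (intro borel_measurable_continuous_onI linear_continuous_on)
       (rule linear_conv_bounded_linear[THEN iffD1, OF A])
  have B: "linear ?B" by (intro linear_compose linear_rewo linear_unwo A)
  have det: "det (matrix ?B) = det (matrix A)" by (rule det_rewo[OF A])
  have tr: "(\<integral>x. G x \<partial>lborel) = (\<integral>x. G (unwo x) \<partial>lborel)" if [measurable]: "G \<in> borel_measurable borel"
    for G :: "real^'n \<Rightarrow> real"
    by (subst lborel_distr_unwo[symmetric], subst integral_distr) auto
  have Fi: "integrable lborel (\<lambda>x. F (unwo x))"
    using F unfolding lborel_distr_unwo[symmetric, where 'n='n] by (subst (asm) integrable_distr_eq) auto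
  \<comment> \<open>The change of variables rule speaks of functions with values in a type
    \<open>real ^ 'm\<close>, so the scalar integrand is wrapped into one component.\<close>
  let ?G = "\<lambda>x. vec (F (unwo x)) :: real^1"
  have surj: "range ?B = UNIV"
    using nz det B by (metis det_nz_iff_inj linear_injective_imp_surjective)
  have basis: "(Basis :: (real^1) set) = {axis 1 1}"
    by (auto simp: Basis_vec_def)
  have vec1: "(\<lambda>x. vec (H x) :: real^1) absolutely_integrable_on UNIV \<longleftrightarrow> H absolutely_integrable_on UNIV"
    for H :: "real^'n wo \<Rightarrow> real"
    by (subst absolutely_integrable_componentwise_iff) (simp add: basis inner_axis)
  have absi: "(\<lambda>x. F (unwo x)) absolutely_integrable_on UNIV"
    using Fi by (simp add: set_integrable_def integrable_completion)
  then have G: "?G absolutely_integrable_on UNIV" by (simp add: vec1)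
  have eq: "(\<lambda>x. \<bar>det (matrix ?B)\<bar> *\<^sub>R ?G (?B x)) =
      (\<lambda>x. vec (\<bar>det (matrix A)\<bar> * F (A (unwo x))))"
    by (simp add: det fun_eq_iff vec_eq_iff)
  have "(\<lambda>x. \<bar>det (matrix ?B)\<bar> *\<^sub>R ?G (?B x)) absolutely_integrable_on UNIV \<and>
        integral UNIV (\<lambda>x. \<bar>det (matrix ?B)\<bar> *\<^sub>R ?G (?B x)) = integral UNIV ?G"
    using has_absolute_integral_change_of_variables_linear[OF B, where S = UNIV and f = ?G] G
    unfolding surj by blast
  then have 2: "integral UNIV (\<lambda>x. vec (\<bar>det (matrix A)\<bar> * F (A (unwo x))) :: real^1) = integral UNIV ?G"
    and 3: "(\<lambda>x. vec (\<bar>det (matrix A)\<bar> * F (A (unwo x))) :: real^1) absolutely_integrable_on UNIV"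
    unfolding eq by blast+
  have 1: "(\<lambda>x. \<bar>det (matrix A)\<bar> * F (A (unwo x))) absolutely_integrable_on UNIV"
    by (rule vec1[THEN iffD1, OF 3])
  have int: "integral UNIV (\<lambda>x. vec (H x) :: real^1) $ 1 = (\<integral>x. H x \<partial>lborel)"
    if "H absolutely_integrable_on UNIV" and [measurable]: "H \<in> borel_measurable borel" for H :: "real^'n wo \<Rightarrow> real"
  proof -
    have "(\<lambda>x. vec (H x) :: real^1) integrable_on UNIV"
      by (rule set_lebesgue_integral_eq_integral(1)[OF vec1[THEN iffD2, OF that(1)]])
    then have "integral UNIV (\<lambda>x. vec (H x) :: real^1) $ 1 = integral UNIV H"
      by (subst integral_component_eq_cart[symmetric]) auto
    moreover have "integrable lborel H"
      using that(1) by (simp add: set_integrable_def integrable_completion)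
    then have "integral UNIV H = (\<integral>x. H x \<partial>lborel)"
      using has_integral_integral_lborel integral_unique by blast
    ultimately show ?thesis by simp
  qed
  have "(\<integral>x. \<bar>det (matrix A)\<bar> * F (A (unwo x)) \<partial>lborel) = (\<integral>x. F (unwo x) \<partial>lborel)"
    using int[OF 1] int[OF absi] 2 by simp
  then show ?thesis
    by (subst (1 2) tr) simp_all
qed

section \<open>Bump functions and integrals of derivatives\<close>

lemma has_real_derivative_max_0_square:
  "((\<lambda>y::real. (max 0 y)\<^sup>2) has_real_derivative 2 * max 0 y) (at y)"
proof -
  consider "y > 0" | "y < 0" | "y = 0" by linarith
  then show ?thesis
  proof cases
    case 1
    have "((\<lambda>y::real. y\<^sup>2) has_real_derivative 2 * y) (at y)"
      by (auto intro!: derivative_eq_intros)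
    then have "((\<lambda>y::real. (max 0 y)\<^sup>2) has_real_derivative 2 * y) (at y)"
      by (rule has_field_derivative_transform_within_open[where S = "{0<..}"]) (use 1 in auto)
    then show ?thesis using 1 by simp
  next
    case 2
    have "((\<lambda>y::real. 0) has_real_derivative 0) (at y)" by simp
    then have "((\<lambda>y::real. (max 0 y)\<^sup>2) has_real_derivative 0) (at y)"
      by (rule has_field_derivative_transform_within_open[where S = "{..<0}"]) (use 2 in auto)
    then show ?thesis using 2 by simp
  next
    case 3
    have "((\<lambda>h::real. (max 0 h)\<^sup>2 / h) \<longlongrightarrow> 0) (at 0)"
    proof (rule Lim_null_comparison)
      show "((\<lambda>h::real. \<bar>h\<bar>) \<longlongrightarrow> 0) (at 0)" by (auto intro!: tendsto_eq_intros)
      have "norm ((max 0 h)\<^sup>2 / h) \<le> \<bar>h\<bar>" for h :: real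
        by (cases "h > 0") (auto simp: power2_eq_square max_def)
      then show "\<forall>\<^sub>F h in at 0. norm ((max 0 h)\<^sup>2 / h :: real) \<le> \<bar>h\<bar>" by simp
    qed
    then show ?thesis unfolding 3 by (simp add: has_field_derivative_iff)
  qed
qed

text \<open>Supported in [-a, a]. The outer square makes it continuously differentiable, which
  matches its use: the entries of the Jacobian matrix, which contain it as a factor, are
  differentiated once.\<close>

definition bump :: "real \<Rightarrow> real \<Rightarrow> real"
  where "bump a s = (max 0 (a\<^sup>2 - s\<^sup>2))\<^sup>2"

lemma has_real_derivative_bump:
  "(bump a has_real_derivative - 4 * s * max 0 (a\<^sup>2 - s\<^sup>2)) (at s)"
proof -
  have "((\<lambda>s. a\<^sup>2 - s\<^sup>2) has_real_derivative - 2 * s) (at s)"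
    by (auto intro!: derivative_eq_intros)
  from DERIV_chain2[OF has_real_derivative_max_0_square this]
  show ?thesis unfolding bump_def by (simp add: algebra_simps)
qed

lemma continuous_on_bump [continuous_intros]:
  "continuous_on S f \<Longrightarrow> continuous_on S (\<lambda>x. bump a (f x))"
  unfolding bump_def by (intro continuous_intros)

lemma bump_eq_0: "0 < a \<Longrightarrow> a \<le> \<bar>s\<bar> \<Longrightarrow> bump a s = 0"
  using power_mono[of a "\<bar>s\<bar>" 2] by (simp add: bump_def)

lemma bump_nonneg: "0 \<le> bump a s"
  by (simp add: bump_def)

text \<open>The two constants beyond \<open>a\<close> and below \<open>-a\<close> differ, because
  the bump has positive mass. Values of \<Psi> are therefore only compared on the same side of
  [-a, a].\<close>

lemma bump_antiderivative:
  assumes "0 < a"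
  obtains \<Psi> where "\<And>s. (\<Psi> has_real_derivative bump a s) (at s)"
    and "\<And>s t. a \<le> s \<Longrightarrow> a \<le> t \<Longrightarrow> \<Psi> s = \<Psi> t" and "\<And>s t. s \<le> -a \<Longrightarrow> t \<le> -a \<Longrightarrow> \<Psi> s = \<Psi> t"
proof -
  have "isCont (bump a) x" for x using has_real_derivative_bump DERIV_isCont by blast
  then obtain \<Psi> where "\<forall>x::real. -\<infinity> < ereal x \<longrightarrow> ereal x < \<infinity> \<longrightarrow> (\<Psi> has_vector_derivative bump a x) (at x)"
    using einterval_antiderivative[of "-\<infinity>" "\<infinity>" "bump a"] by auto
  then have d: "(\<Psi> has_real_derivative bump a s) (at s)" for s
    by (simp add: has_real_derivative_iff_has_vector_derivative)
  have const: "\<Psi> s = \<Psi> t" if "convex X" "s \<in> X" "t \<in> X" "\<And>u. u \<in> X \<Longrightarrow> bump a u = 0" for X s t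
  proof -
    have "(\<Psi> has_field_derivative 0) (at u within X)" if "u \<in> X" for u
      using d[of u] that \<open>\<And>u. u \<in> X \<Longrightarrow> bump a u = 0\<close>[OF that] has_field_derivative_at_within by metis
    then show ?thesis
      using has_field_derivative_zero_constant[OF \<open>convex X\<close>, of \<Psi>] that by metis
  qed
  show ?thesis
  proof (rule that[OF d])
    show "\<Psi> s = \<Psi> t" if "a \<le> s" "a \<le> t" for s t
      by (rule const[of "{a..}"]) (use that assms in \<open>auto intro!: bump_eq_0\<close>)
    show "\<Psi> s = \<Psi> t" if "s \<le> -a" "t \<le> -a" for s t
      by (rule const[of "{..-a}"]) (use that assms in \<open>auto intro!: bump_eq_0\<close>)
  qed
qed

lemma lborel_shift:
  fixes F :: "'a::euclidean_space \<Rightarrow> real"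
  assumes [measurable]: "F \<in> borel_measurable borel"
  shows "(\<integral>x. F (x - c) \<partial>lborel) = (\<integral>x. F x \<partial>lborel)"
    and "integrable lborel F \<Longrightarrow> integrable lborel (\<lambda>x. F (x - c))"
proof -
  have "(\<integral>x. F x \<partial>distr lborel borel ((+) (- c))) = (\<integral>x. F (- c + x) \<partial>lborel)"
    by (subst integral_distr) auto
  then show "(\<integral>x. F (x - c) \<partial>lborel) = (\<integral>x. F x \<partial>lborel)"
    by (simp add: lborel_distr_plus)
  assume "integrable lborel F"
  then have "integrable (distr lborel borel ((+) (- c))) F" by (simp add: lborel_distr_plus)
  then show "integrable lborel (\<lambda>x. F (x - c))"
    by (subst (asm) integrable_distr_eq) auto
qed

text \<open>By translation invariance, every difference quotient of the extension by zero has
  integral 0; dominated convergence passes this on to the derivative. The argument treats all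
  directions \<open>v\<close> alike and avoids iterated integrals.\<close>

lemma integral_derivative_compact_support:
  fixes w :: "'a::euclidean_space \<Rightarrow> real"
  assumes D: "open D" and Q: "compact Q" "Q \<subseteq> D"
    and der: "\<And>x. x \<in> D \<Longrightarrow> (w has_derivative w' x) (at x)"
    and cont: "continuous_on D (\<lambda>x. w' x v)"
    and supp: "\<And>x. x \<in> D - Q \<Longrightarrow> w x = 0"
  shows "integrable lborel (\<lambda>x. indicator D x * w' x v)"
    and "(\<integral>x. indicator D x * w' x v \<partial>lborel) = 0"
proof -
  \<comment> \<open>Extensions by zero. As \<open>w\<close> vanishes on \<open>D - Q\<close>, the
    sets \<open>D\<close> and \<open>- Q\<close> form an open cover on each of which
    \<open>W\<close> is evidently differentiable.\<close>
  define W where "W x = (if x \<in> D then w x else 0)" for x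
  define W' where "W' x = (if x \<in> D then w' x v else 0)" for x
  have W'_eq: "indicator D x * w' x v = W' x" for x by (simp add: W'_def)
  have W0: "W x = 0" if "x \<notin> Q" for x using that supp by (auto simp: W_def)
  have openQ: "open (- Q)" using Q(1) by (simp add: compact_imp_closed open_Compl)
  have derW0: "(W has_derivative (\<lambda>_. 0)) (at x)" if "x \<notin> Q" for x
    by (rule has_derivative_transform_within_open[OF has_derivative_const openQ]) (use that W0 in auto)
  have derWD: "(W has_derivative w' x) (at x)" if "x \<in> D" for x
    by (rule has_derivative_transform_within_open[OF der[OF that] D that]) (simp add: W_def)
  have W'0: "W' x = 0" if "x \<notin> Q" for x
  proof (cases "x \<in> D")
    case True
    then have "w' x = (\<lambda>_. 0)" using derWD derW0[OF that] has_derivative_unique by blast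
    then show ?thesis by (simp add: W'_def)
  qed (simp add: W'_def)
  have derW: "((\<lambda>t. W (x + t *\<^sub>R v)) has_real_derivative W' (x + t *\<^sub>R v)) (at t)" for x t
  proof -
    obtain G where G: "(W has_derivative G) (at (x + t *\<^sub>R v))" "G v = W' (x + t *\<^sub>R v)"
    proof (cases "x + t *\<^sub>R v \<in> D")
      case True
      show ?thesis by (rule that[OF derWD[OF True]]) (simp add: W'_def True)
    next
      case False
      then have "x + t *\<^sub>R v \<notin> Q" using Q(2) by blast
      then show ?thesis by (intro that[OF derW0]) (simp_all add: W'_def False)
    qed
    have "((\<lambda>t. x + t *\<^sub>R v) has_derivative (\<lambda>s. s *\<^sub>R v)) (at t)"
      by (auto intro!: derivative_eq_intros)
    from diff_chain_at[OF this G(1)]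
    have "((\<lambda>t. W (x + t *\<^sub>R v)) has_derivative (\<lambda>s. G (s *\<^sub>R v))) (at t)"
      by (simp add: o_def)
    moreover have "(\<lambda>s. G (s *\<^sub>R v)) = (\<lambda>s. s * W' (x + t *\<^sub>R v))"
      using linear_scale[OF has_derivative_linear[OF G(1)]] G(2) by auto
    ultimately show ?thesis by (simp add: has_field_derivative_def mult.commute[of _ "W' _"])
  qed
  have contW': "continuous_on UNIV W'"
  proof -
    have "continuous_on D W'" using cont by (rule continuous_on_eq) (simp add: W'_def)
    moreover have "continuous_on (- Q) W'"
      by (rule continuous_on_eq[OF continuous_on_const[of _ 0]]) (simp add: W'0)
    ultimately have "continuous_on (D \<union> - Q) W'" using D openQ by (intro continuous_on_open_Un)
    moreover have "D \<union> - Q = UNIV" using Q(2) by blast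
    ultimately show ?thesis by simp
  qed
  have contW: "continuous_on UNIV W"
    unfolding continuous_on_eq_continuous_at[OF open_UNIV]
    using derWD derW0 Q(2) has_derivative_continuous by blast
  have int: "integrable lborel F" if "continuous_on UNIV F" "\<And>x. x \<notin> Q \<Longrightarrow> F x = 0" for F :: "'a \<Rightarrow> real"
  proof -
    have "integrable lborel (\<lambda>x. indicator Q x *\<^sub>R F x)"
      by (rule borel_integrable_compact[OF Q(1)]) (rule continuous_on_subset[OF that(1)], simp)
    moreover have "(\<lambda>x. indicator Q x *\<^sub>R F x) = F"
      using that(2) by (auto simp: fun_eq_iff indicator_def)
    ultimately show ?thesis by simp
  qed
  obtain B where B: "\<And>x. \<bar>W' x\<bar> \<le> B"
  proof -
    have "bounded (W' ` Q)"
      using Q(1) contW' by (meson compact_continuous_image compact_imp_bounded continuous_on_subset subset_UNIV)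
    then obtain B where "\<forall>x\<in>Q. \<bar>W' x\<bar> \<le> B" by (auto simp: bounded_iff)
    then have "\<bar>W' x\<bar> \<le> max B 0" for x by (cases "x \<in> Q") (auto simp: W'0 le_max_iff_disj)
    then show ?thesis by (rule that)
  qed
  \<comment> \<open>A compact set outside of which all difference quotients with steps in [0, 1]
    vanish, so that a multiple of its indicator dominates them.\<close>
  define Q' where "Q' = (\<lambda>(x, t). x - t *\<^sub>R v) ` (Q \<times> {0..1::real})"
  have Q': "compact Q'" unfolding Q'_def
    by (intro compact_continuous_image compact_Times Q(1) compact_Icc)
       (auto intro!: continuous_intros simp: case_prod_unfold)
  have inQ': "x \<in> Q'" if "x + t *\<^sub>R v \<in> Q" "0 \<le> t" "t \<le> 1" for x t
    unfolding Q'_def using that by (auto intro!: image_eqI[of _ _ "(x + t *\<^sub>R v, t)"])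
  define s where "s n x = (W (x + (1 / real (Suc n)) *\<^sub>R v) - W x) * real (Suc n)" for n x
  have intW: "integrable lborel W" by (rule int[OF contW W0])
  have shift: "integrable lborel (\<lambda>x. W (x + c))" "(\<integral>x. W (x + c) \<partial>lborel) = (\<integral>x. W x \<partial>lborel)" for c
    using lborel_shift[OF borel_measurable_continuous_onI[OF contW], of "- c"] intW by simp_all
  have s0: "(\<integral>x. s n x \<partial>lborel) = 0" for n
    unfolding s_def using shift intW by simp
  have bound: "\<bar>s n x\<bar> \<le> indicator Q' x * B" for n x
  proof -
    have pos: "0 < 1 / real (Suc n)" "1 / real (Suc n) \<le> 1" by (auto simp: divide_simps)
    obtain z where z: "0 < z" "z < 1 / real (Suc n)"
      "W (x + (1 / real (Suc n)) *\<^sub>R v) - W (x + 0 *\<^sub>R v) = (1 / real (Suc n) - 0) * W' (x + z *\<^sub>R v)"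
      using MVT2[OF pos(1), of "\<lambda>t. W (x + t *\<^sub>R v)" "\<lambda>t. W' (x + t *\<^sub>R v)"] derW by blast
    have sz: "s n x = W' (x + z *\<^sub>R v)" using z(3) by (simp add: s_def field_simps)
    show ?thesis
    proof (cases "x \<in> Q'")
      case True
      then show ?thesis using B sz by simp
    next
      case False
      have "x + z *\<^sub>R v \<notin> Q"
      proof
        assume "x + z *\<^sub>R v \<in> Q"
        then have "x \<in> Q'" by (rule inQ') (use z pos in linarith)+
        with False show False by simp
      qed
      then show ?thesis using False sz W'0 by simp
    qed
  qed
  have lim: "(\<lambda>n. s n x) \<longlonglongrightarrow> W' x" for x
  proof -
    have "((\<lambda>t. (W (x + t *\<^sub>R v) - W x) / t) \<longlongrightarrow> W' x) (at 0)"
      using derW[of x 0] by (simp add: has_field_derivative_iff)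
    moreover have "filterlim (\<lambda>n. 1 / real (Suc n)) (at 0) sequentially"
      using LIMSEQ_Suc[OF lim_1_over_n[where 'a = real]] by (auto simp: filterlim_at eventually_sequentially)
    ultimately have "(\<lambda>n. (W (x + (1 / real (Suc n)) *\<^sub>R v) - W x) / (1 / real (Suc n))) \<longlonglongrightarrow> W' x"
      by (rule filterlim_compose)
    then show ?thesis unfolding s_def by simp
  qed
  have "(\<lambda>n. \<integral>x. s n x \<partial>lborel) \<longlonglongrightarrow> (\<integral>x. W' x \<partial>lborel)"
  proof (rule integral_dominated_convergence)
    show "W' \<in> borel_measurable lborel" 
      using contW' by (simp add: borel_measurable_continuous_onI)
    show "s n \<in> borel_measurable lborel" for n
      unfolding s_def using shift(1) intW by simp
    have "emeasure lborel Q' < \<infinity>" using Q' emeasure_compact_finite by blast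
    then show "integrable lborel (\<lambda>x. indicator Q' x * B)"
      using Q' by (intro integrable_mult_left) (simp add: borel_compact)
    show "AE x in lborel. (\<lambda>n. s n x) \<longlonglongrightarrow> W' x" using lim by simp
    show "AE x in lborel. norm (s n x) \<le> indicator Q' x * B" for n using bound by simp
  qed
  then have "(\<integral>x. W' x \<partial>lborel) = 0"
    unfolding s0 by (simp add: LIMSEQ_const_iff)
  then show "(\<integral>x. indicator D x * w' x v \<partial>lborel) = 0" by (simp add: W'_eq)
  show "integrable lborel (\<lambda>x. indicator D x * w' x v)"
    unfolding W'_eq by (rule int[OF contW' W'0])
qed

section \<open>Polynomials and their second derivatives\<close>

definition partial_deriv :: "(real^'n \<Rightarrow> real) \<Rightarrow> 'n::finite \<Rightarrow> real^'n \<Rightarrow> real"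
  where "partial_deriv f i x = frechet_derivative f (at x) (axis i 1)"

text \<open>Gradient and Hessian are explicit arguments, and symmetry of the Hessian is part of the
  predicate. For polynomials it is then obtained by induction together with the derivatives
  themselves.\<close>

definition C2_fun :: "(real^'n::finite \<Rightarrow> real) \<Rightarrow> ('n \<Rightarrow> real^'n \<Rightarrow> real) \<Rightarrow> ('n \<Rightarrow> 'n \<Rightarrow> real^'n \<Rightarrow> real) \<Rightarrow> bool"
  where "C2_fun f g h \<longleftrightarrow>
     (\<forall>x. (f has_derivative (\<lambda>v. \<Sum>i\<in>UNIV. v $ i * g i x)) (at x)) \<and>
     (\<forall>i x. (g i has_derivative (\<lambda>v. \<Sum>m\<in>UNIV. v $ m * h i m x)) (at x)) \<and>
     (\<forall>i m x. h i m x = h m i x) \<and> (\<forall>i m. continuous_on UNIV (h i m))"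

lemma sum_axis_mult: "(\<Sum>i\<in>UNIV. axis k 1 $ i * c i) = (c (k::'n::finite) :: real)"
proof -
  have "(\<Sum>i\<in>UNIV. axis k 1 $ i * c i) = (\<Sum>i\<in>UNIV. if i = k then c i else 0)"
    by (rule sum.cong) (auto simp: axis_def)
  then show ?thesis by simp
qed

lemma continuous_on_of_has_derivative:
  assumes "\<And>x. (f has_derivative f' x) (at x)"
  shows "continuous_on S f"
  by (intro continuous_at_imp_continuous_on ballI has_derivative_continuous[OF assms])

lemma C2_funD:
  assumes "C2_fun f g h"
  shows "(f has_derivative (\<lambda>v. \<Sum>i\<in>UNIV. v $ i * g i x)) (at x)"
    and "(g i has_derivative (\<lambda>v. \<Sum>m\<in>UNIV. v $ m * h i m x)) (at x)"
    and "h i m x = h m i x" and "continuous_on UNIV (h i m)"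
    and "continuous_on S f" and "continuous_on S (g i)"
proof -
  show 1: "(f has_derivative (\<lambda>v. \<Sum>i\<in>UNIV. v $ i * g i x)) (at x)" for x
    using assms unfolding C2_fun_def by blast
  show 2: "(g i has_derivative (\<lambda>v. \<Sum>m\<in>UNIV. v $ m * h i m x)) (at x)" for i x
    using assms unfolding C2_fun_def by blast
  show "h i m x = h m i x" "continuous_on UNIV (h i m)"
    using assms unfolding C2_fun_def by blast+
  show "continuous_on S f" by (rule continuous_on_of_has_derivative[OF 1])
  show "continuous_on S (g i)" by (rule continuous_on_of_has_derivative[OF 2])
qed

lemma polynomial_C2_fun:
  fixes f :: "real^'n::finite \<Rightarrow> real"
  assumes "real_polynomial_function f"
  shows "\<exists>g h. C2_fun f g h"
  using assms
proof induction
  case (linear f)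
  have f: "(\<Sum>i\<in>UNIV. v $ i * f (axis i 1)) = f v" for v
  proof -
    have "f (\<Sum>i\<in>UNIV. v $ i *\<^sub>R axis i 1) = (\<Sum>i\<in>UNIV. v $ i * f (axis i 1))"
      using linear by (simp add: linear_sum linear_scale bounded_linear.linear)
    then show ?thesis using basis_expansion[of v] unfolding scalar_mult_eq_scaleR by simp
  qed
  have "C2_fun f (\<lambda>i x. f (axis i 1)) (\<lambda>i m x. 0)"
    unfolding C2_fun_def f using bounded_linear_imp_has_derivative[OF linear] by simp
  then show ?case by blast
next
  case (const c)
  have "C2_fun (\<lambda>x. c) (\<lambda>i x. 0) (\<lambda>i m x. 0)" by (simp add: C2_fun_def)
  then show ?case by blast
next
  case (add f1 f2)
  then obtain g1 h1 g2 h2 where *: "C2_fun f1 g1 h1" "C2_fun f2 g2 h2" by blast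
  have "C2_fun (\<lambda>x. f1 x + f2 x) (\<lambda>i x. g1 i x + g2 i x) (\<lambda>i m x. h1 i m x + h2 i m x)"
    unfolding C2_fun_def
    apply (intro conjI allI)
    subgoal by (rule has_derivative_eq_rhs[OF has_derivative_add[OF C2_funD(1)[OF *(1)] C2_funD(1)[OF *(2)]]])
        (simp add: distrib_left sum.distrib)
    subgoal by (rule has_derivative_eq_rhs[OF has_derivative_add[OF C2_funD(2)[OF *(1)] C2_funD(2)[OF *(2)]]])
        (simp add: distrib_left sum.distrib)
    subgoal for i m x using C2_funD(3)[OF *(1), of i m x] C2_funD(3)[OF *(2), of i m x] by simp
    subgoal by (intro continuous_intros C2_funD(4)[OF *(1)] C2_funD(4)[OF *(2)])
    done
  then show ?case by blast
next
  case (mult f1 f2)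
  then obtain g1 h1 g2 h2 where *: "C2_fun f1 g1 h1" "C2_fun f2 g2 h2" by blast
  note d1 = C2_funD[OF *(1)] and d2 = C2_funD[OF *(2)]
  have "C2_fun (\<lambda>x. f1 x * f2 x) (\<lambda>i x. f1 x * g2 i x + g1 i x * f2 x)
     (\<lambda>i m x. f1 x * h2 i m x + g1 m x * g2 i x + (g1 i x * g2 m x + h1 i m x * f2 x))"
    unfolding C2_fun_def
    apply (intro conjI allI)
    subgoal by (rule has_derivative_eq_rhs[OF has_derivative_mult[OF d1(1) d2(1)]])
        (rule ext, simp only: sum_distrib_left sum_distrib_right distrib_left sum.distrib ac_simps)
    subgoal by (rule has_derivative_eq_rhs[OF has_derivative_add[OF
          has_derivative_mult[OF d1(1) d2(2)] has_derivative_mult[OF d1(2) d2(1)]]])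
        (rule ext, simp only: sum_distrib_left sum_distrib_right distrib_left sum.distrib ac_simps)
    subgoal for i m x using d1(3)[of i m x] d2(3)[of i m x] by simp
    subgoal by (intro continuous_intros d1 d2)
    done
  then show ?case by blast
qed

lemma C2_fun_partial_deriv:
  assumes "C2_fun f g h"
  shows "g i x = partial_deriv f i x"
proof -
  have "(\<lambda>v. \<Sum>i\<in>UNIV. v $ i * g i x) = frechet_derivative f (at x)"
    using assms unfolding C2_fun_def by (intro frechet_derivative_at) blast
  from fun_cong[OF this, of "axis i 1"] show ?thesis
    unfolding partial_deriv_def sum_axis_mult .
qed

lemma polynomial_C2_fun_partial_deriv:
  fixes f :: "real^'n::finite \<Rightarrow> real"
  assumes "real_polynomial_function f"
  shows "\<exists>h. C2_fun f (partial_deriv f) h"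
proof -
  obtain g h where C: "C2_fun f g h" using polynomial_C2_fun[OF assms] by blast
  have g: "g = partial_deriv f" using C2_fun_partial_deriv[OF C] by (simp add: fun_eq_iff)
  show ?thesis using C unfolding g by blast
qed

lemma polynomial_continuous_on:
  fixes f :: "real^'n::finite \<Rightarrow> real"
  assumes "real_polynomial_function f"
  shows "continuous_on S f" and "continuous_on S (partial_deriv f i)"
proof -
  obtain h where C: "C2_fun f (partial_deriv f) h"
    using polynomial_C2_fun_partial_deriv[OF assms] by blast
  show "continuous_on S f" "continuous_on S (partial_deriv f i)"
    using C2_funD(5,6)[OF C] by blast+
qed

section \<open>The degree integral\<close>

definition degree_density :: "real \<Rightarrow> ('n::finite \<Rightarrow> real^'n \<Rightarrow> real) \<Rightarrow> real^'n \<Rightarrow> real"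
  where "degree_density a P x = (\<Prod>l\<in>UNIV. bump a (P l x)) * det (\<chi> l i. partial_deriv (P l) i x)"

definition degree_integral :: "real \<Rightarrow> (real^'n) set \<Rightarrow> ('n::finite \<Rightarrow> real^'n \<Rightarrow> real) \<Rightarrow> real"
  where "degree_integral a D P = (\<integral>x. indicator D x * degree_density a P x \<partial>lborel)"

lemma degree_density_eq:
  "degree_density a P x = (\<Sum>\<pi> | \<pi> permutes UNIV. of_int (sign \<pi>) *
      (\<Prod>l\<in>UNIV. bump a (P l x) * partial_deriv (P l) (\<pi> l) x))"
  by (simp add: degree_density_def det_def sum_distrib_left prod.distrib mult.left_commute)

lemma continuous_on_degree_density:
  assumes "\<And>l. real_polynomial_function (P l)"
  shows "continuous_on S (degree_density a P)"
  unfolding degree_density_eq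
  by (intro continuous_intros polynomial_continuous_on assms)

lemma integrable_indicator_continuous:
  fixes F :: "'a::euclidean_space \<Rightarrow> real"
  assumes "open D" "bounded D" "continuous_on UNIV F"
  shows "integrable lborel (\<lambda>x. indicator D x * F x)"
proof -
  have "integrable lborel (\<lambda>x. indicator (closure D) x *\<^sub>R F x)"
    by (rule borel_integrable_compact) (use assms in \<open>auto intro: continuous_on_subset\<close>)
  from integrable_mult_indicator[OF _ this, of D]
  have "integrable lborel (\<lambda>x. indicator D x *\<^sub>R (indicator (closure D) x *\<^sub>R F x))"
    using assms(1) by simp
  moreover have "(\<lambda>x. indicator D x *\<^sub>R (indicator (closure D) x *\<^sub>R F x)) = (\<lambda>x. indicator D x * F x)"
    using closure_subset[of D] by (auto simp: indicator_def fun_eq_iff)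
  ultimately show ?thesis by simp
qed

text \<open>Reindexing by composition with the transposition flips every sign and leaves
  \<open>F\<close> alone, so the sum equals its own negative.\<close>

lemma sum_sign_permutes_zero:
  fixes F :: "('n::finite \<Rightarrow> 'n) \<Rightarrow> real"
  assumes "j \<noteq> l" and "\<And>\<pi>. \<pi> permutes UNIV \<Longrightarrow> F (\<pi> \<circ> Transposition.transpose j l) = F \<pi>"
  shows "(\<Sum>\<pi> | \<pi> permutes UNIV. of_int (sign \<pi>) * F \<pi>) = 0"
proof -
  let ?t = "Transposition.transpose j l"
  let ?S = "\<Sum>\<pi> | \<pi> permutes UNIV. of_int (sign \<pi>) * F \<pi>"
  have t: "?t permutes UNIV" by (simp add: permutes_swap_id)
  have "?S = (\<Sum>\<pi> | \<pi> permutes UNIV. of_int (sign (\<pi> \<circ> ?t)) * F (\<pi> \<circ> ?t))"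
    by (rule sum_permutations_compose_right[OF t])
  also have "\<dots> = (\<Sum>\<pi> | \<pi> permutes UNIV. - (of_int (sign \<pi>) * F \<pi>))"
  proof (rule sum.cong[OF refl])
    fix \<pi> :: "'n \<Rightarrow> 'n" assume "\<pi> \<in> {\<pi>. \<pi> permutes UNIV}"
    then have p: "\<pi> permutes UNIV" by simp
    have "sign (\<pi> \<circ> ?t) = sign \<pi> * sign (?t)"
      by (rule sign_compose) (use p t finite[of "UNIV :: 'n set"] in \<open>unfold permutation_permutes, blast+\<close>)
    then have "sign (\<pi> \<circ> ?t) = - sign \<pi>"
      using assms(1) by (simp add: sign_swap_id)
    then show "of_int (sign (\<pi> \<circ> ?t)) * F (\<pi> \<circ> ?t) = - (of_int (sign \<pi>) * F \<pi>)"
      using assms(2)[OF p] by simp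
  qed
  also have "\<dots> = - ?S" by (rule sum_negf)
  finally show ?thesis by linarith
qed

text \<open>
  With \<open>U\<^sub>l\<close> the gradient of \<open>\<Psi> \<circ> P\<^sub>l\<close>, the difference of the densities is \<open>det\<close> of the rows \<open>U\<^sub>l\<close>
  with row \<open>j\<close> replaced by the gradient of \<open>\<Delta> = \<Psi> \<circ> P\<^sub>j - \<Psi> \<circ> Q\<^sub>j\<close>. It is the sum over \<open>\<pi>\<close> of
  \<open>sign \<pi>\<close> times the derivative in direction \<open>\<pi> j\<close> of \<open>T \<pi> = \<Delta> \<cdot> \<Prod>\<^sub>l U\<^sub>l (\<pi> l)\<close>, where the second derivatives
  cancel in pairs \<open>\<pi>\<close>, \<open>\<pi> \<circ> transpose j l\<close>. Each \<open>T \<pi>\<close> has compact support: if all \<open>P\<^sub>l\<close> with \<open>l \<noteq> j\<close> are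
  small near the frontier, then \<open>P\<^sub>j\<close> and \<open>Q\<^sub>j\<close> lie on the same side of \<open>[-a, a]\<close>.
\<close>

lemma degree_integral_change_row:
  fixes P Q :: "'n::finite \<Rightarrow> real^'n \<Rightarrow> real"
  assumes D: "open D" "bounded D" and a: "0 < a"
    and poly: "\<And>l. real_polynomial_function (P l)" "\<And>l. real_polynomial_function (Q l)"
    and eq: "\<And>l. l \<noteq> j \<Longrightarrow> Q l = P l"
    and front: "\<And>x. x \<in> frontier D \<Longrightarrow> \<exists>l. \<bar>P l x\<bar> > 2 * a"
    and close: "\<And>x. x \<in> closure D \<Longrightarrow> \<bar>P j x - Q j x\<bar> < a"
  shows "degree_integral a D P = degree_integral a D Q"
proof -
  obtain \<Psi> where \<Psi>: "\<And>s. (\<Psi> has_real_derivative bump a s) (at s)"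
    and \<Psi>_up: "\<And>s t. a \<le> s \<Longrightarrow> a \<le> t \<Longrightarrow> \<Psi> s = \<Psi> t"
    and \<Psi>_down: "\<And>s t. s \<le> -a \<Longrightarrow> t \<le> -a \<Longrightarrow> \<Psi> s = \<Psi> t"
    using bump_antiderivative[OF a] by blast
  have "\<forall>l. \<exists>h. C2_fun (P l) (partial_deriv (P l)) h"
    by (intro allI polynomial_C2_fun_partial_deriv poly)
  from choice[OF this] obtain h where h: "\<And>l. C2_fun (P l) (partial_deriv (P l)) (h l)" by blast
  obtain hQ where hQ: "C2_fun (Q j) (partial_deriv (Q j)) hQ"
    using polynomial_C2_fun_partial_deriv[OF poly(2)] by blast
  note P' = C2_funD(1)[OF h] and P'' = C2_funD(2)[OF h] and Q' = C2_funD(1)[OF hQ]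
  define U where "U l i x = bump a (P l x) * partial_deriv (P l) i x" for l i x
  define V where "V l i m x = bump a (P l x) * h l i m x
     + (- 4 * P l x * max 0 (a\<^sup>2 - (P l x)\<^sup>2)) * partial_deriv (P l) m x * partial_deriv (P l) i x" for l i m x
  define \<Delta> where "\<Delta> x = \<Psi> (P j x) - \<Psi> (Q j x)" for x
  define E where "E i x = U j i x - bump a (Q j x) * partial_deriv (Q j) i x" for i x
  have comp: "((\<lambda>x. F (f x)) has_derivative (\<lambda>v. \<Sum>i\<in>UNIV. v $ i * (c * g i))) (at x)"
    if "(F has_real_derivative c) (at (f x))" "(f has_derivative (\<lambda>v. \<Sum>i\<in>UNIV. v $ i * g i)) (at x)"
    for F f g c and x :: "real^'n"
    using has_derivative_compose[OF that(2) that(1)[unfolded has_field_derivative_def]]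
    by (simp add: sum_distrib_left mult.left_commute)
  have U': "(U l i has_derivative (\<lambda>v. \<Sum>m\<in>UNIV. v $ m * V l i m x)) (at x)" for l i x
    unfolding U_def V_def
    by (rule has_derivative_eq_rhs[OF has_derivative_mult[OF comp[OF has_real_derivative_bump P'] P'']])
       (rule ext, simp only: sum_distrib_left sum_distrib_right distrib_left sum.distrib ac_simps)
  have Vsym: "V l i m x = V l m i x" for l i m x
    unfolding V_def C2_funD(3)[OF h, of l i m] by (simp only: mult.assoc mult.commute mult.left_commute)
  have \<Delta>': "(\<Delta> has_derivative (\<lambda>v. \<Sum>i\<in>UNIV. v $ i * E i x)) (at x)" for x
    unfolding \<Delta>_def E_def U_def
    by (rule has_derivative_eq_rhs[OF has_derivative_diff[OF comp[OF \<Psi> P'] comp[OF \<Psi> Q']]])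
       (rule ext, simp only: right_diff_distrib sum_subtractf)
  let ?J = "UNIV - {j}"
  define T where "T \<pi> x = \<Delta> x * (\<Prod>l\<in>?J. U l (\<pi> l) x)" for \<pi> x
  define T' where "T' \<pi> x v = \<Delta> x * (\<Sum>l\<in>?J. (\<Sum>m\<in>UNIV. v $ m * V l (\<pi> l) m x) * (\<Prod>k\<in>?J - {l}. U k (\<pi> k) x))
      + (\<Sum>i\<in>UNIV. v $ i * E i x) * (\<Prod>l\<in>?J. U l (\<pi> l) x)" for \<pi> x v
  have T': "(T \<pi> has_derivative T' \<pi> x) (at x)" for \<pi> x
    unfolding T_def T'_def by (intro has_derivative_mult has_derivative_prod U' \<Delta>')
  define dT where "dT \<pi> x = \<Delta> x * (\<Sum>l\<in>?J. V l (\<pi> l) (\<pi> j) x * (\<Prod>k\<in>?J - {l}. U k (\<pi> k) x))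
      + E (\<pi> j) x * (\<Prod>l\<in>?J. U l (\<pi> l) x)" for \<pi> x
  have dT: "T' \<pi> x (axis (\<pi> j) 1) = dT \<pi> x" for \<pi> x
    by (simp add: T'_def dT_def sum_axis_mult)
  have contV: "continuous_on S (V l i m)" for S l i m
    unfolding V_def
    by (intro continuous_intros C2_funD(5)[OF h] C2_funD(6)[OF h] continuous_on_subset[OF C2_funD(4)[OF h] subset_UNIV])
  have contdT: "continuous_on S (dT \<pi>)" for S \<pi>
    unfolding dT_def E_def
    by (intro continuous_intros contV continuous_on_of_has_derivative[OF U'] continuous_on_of_has_derivative[OF \<Delta>']
        polynomial_continuous_on poly)
  \<comment> \<open>The bounds differ: beyond \<open>a\<close>, a row \<open>l \<noteq> j\<close>
    kills the factor \<open>U l\<close>, whereas row \<open>j\<close> has to exceed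
    \<open>2 * a\<close> in order that \<open>Q j\<close>, which is closer than \<open>a\<close> to
    \<open>P j\<close>, is still beyond \<open>a\<close> on the same side.\<close>
  define R where "R = {x \<in> closure D. (\<forall>l\<in>?J. \<bar>P l x\<bar> \<le> a) \<and> \<bar>P j x\<bar> \<le> 2 * a}"
  have "R = closure D \<inter> ((\<Inter>l\<in>?J. {x. \<bar>P l x\<bar> \<le> a}) \<inter> {x. \<bar>P j x\<bar> \<le> 2 * a})"
    by (auto simp: R_def)
  moreover have "closed {x. \<bar>P l x\<bar> \<le> c}" for l c
    by (intro closed_Collect_le continuous_intros polynomial_continuous_on poly)
  ultimately have R: "compact R"
    using D by (simp add: compact_Int_closed closed_Int closed_INT)
  have RD: "R \<subseteq> D"
  proof
    fix x assume x: "x \<in> R"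
    have "x \<notin> frontier D"
    proof
      assume "x \<in> frontier D"
      then obtain l where "\<bar>P l x\<bar> > 2 * a" using front by blast
      moreover have "\<bar>P l x\<bar> \<le> 2 * a"
      proof (cases "l = j")
        case False
        then have "\<bar>P l x\<bar> \<le> a" using x by (simp add: R_def)
        then show ?thesis using a by linarith
      qed (use x in \<open>simp add: R_def\<close>)
      ultimately show False by linarith
    qed
    then show "x \<in> D" using x D(1) by (simp add: R_def frontier_def interior_open)
  qed
  have T0: "T \<pi> x = 0" if xDR: "x \<in> D - R" for \<pi> x
  proof -
    have x: "x \<in> closure D" using xDR closure_subset by blast
    consider l where "l \<noteq> j" "a < \<bar>P l x\<bar>" | "2 * a < \<bar>P j x\<bar>"
      using xDR x unfolding R_def mem_Collect_eq Diff_iff not_le[symmetric] by blast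
    then show ?thesis
    proof cases
      case 1
      then have "U l (\<pi> l) x = 0" using bump_eq_0[OF a, of "P l x"] by (simp add: U_def)
      then show ?thesis unfolding T_def using 1 by (auto intro!: disjI2 bexI[of _ l])
    next
      case 2
      have "\<bar>P j x - Q j x\<bar> < a" using close[OF x] .
      then have "\<Psi> (P j x) = \<Psi> (Q j x)"
      proof (cases "P j x \<ge> 0")
        case True
        show ?thesis by (rule \<Psi>_up) (use \<open>\<bar>P j x - Q j x\<bar> < a\<close> 2 a True in linarith)+
      next
        case False
        show ?thesis by (rule \<Psi>_down) (use \<open>\<bar>P j x - Q j x\<bar> < a\<close> 2 a False in linarith)+
      qed
      then show ?thesis by (simp add: T_def \<Delta>_def)
    qed
  qed
  have int0: "integrable lborel (\<lambda>x. indicator D x * dT \<pi> x)" "(\<integral>x. indicator D x * dT \<pi> x \<partial>lborel) = 0" for \<pi>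
    using integral_derivative_compact_support[where w = "T \<pi>" and w' = "T' \<pi>" and v = "axis (\<pi> j) 1",
        OF D(1) R RD T' _ T0] contdT
    by (simp_all add: dT)
  have "degree_density a P x - degree_density a Q x = (\<Sum>\<pi> | \<pi> permutes UNIV. of_int (sign \<pi>) * dT \<pi> x)" for x
  proof -
    have split: "(\<Prod>l\<in>UNIV. f l) = f j * (\<Prod>l\<in>?J. f l)" for f :: "'n \<Rightarrow> real"
      by (rule prod.remove) auto
    have QJ: "(\<Prod>l\<in>?J. bump a (Q l x) * partial_deriv (Q l) (\<pi> l) x) = (\<Prod>l\<in>?J. U l (\<pi> l) x)" for \<pi>
      by (rule prod.cong) (auto simp: U_def eq)
    have "degree_density a P x - degree_density a Q x =
       (\<Sum>\<pi> | \<pi> permutes UNIV. of_int (sign \<pi>) * (E (\<pi> j) x * (\<Prod>l\<in>?J. U l (\<pi> l) x)))"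
      unfolding degree_density_eq split QJ sum_subtractf[symmetric]
      by (rule sum.cong) (auto simp: E_def U_def algebra_simps)
    moreover have "(\<Sum>\<pi> | \<pi> permutes UNIV. of_int (sign \<pi>) *
        (\<Delta> x * (\<Sum>l\<in>?J. V l (\<pi> l) (\<pi> j) x * (\<Prod>k\<in>?J - {l}. U k (\<pi> k) x)))) = 0"
    proof -
      have "(\<Sum>\<pi> | \<pi> permutes UNIV. of_int (sign \<pi>) *
        (V l (\<pi> l) (\<pi> j) x * (\<Prod>k\<in>?J - {l}. U k (\<pi> k) x))) = 0" if "l \<in> ?J" for l
      proof (rule sum_sign_permutes_zero)
        show "j \<noteq> l" using that by blast
        let ?t = "Transposition.transpose j l"
        fix \<pi> :: "'n \<Rightarrow> 'n"
        have "(\<Prod>k\<in>?J - {l}. U k ((\<pi> \<circ> ?t) k) x) = (\<Prod>k\<in>?J - {l}. U k (\<pi> k) x)"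
          by (rule prod.cong) (auto simp: Transposition.transpose_def)
        then show "V l ((\<pi> \<circ> ?t) l) ((\<pi> \<circ> ?t) j) x * (\<Prod>k\<in>?J - {l}. U k ((\<pi> \<circ> ?t) k) x)
          = V l (\<pi> l) (\<pi> j) x * (\<Prod>k\<in>?J - {l}. U k (\<pi> k) x)"
          using Vsym by simp
      qed
      then have "(\<Sum>l\<in>?J. \<Sum>\<pi> | \<pi> permutes UNIV. \<Delta> x * (of_int (sign \<pi>) *
        (V l (\<pi> l) (\<pi> j) x * (\<Prod>k\<in>?J - {l}. U k (\<pi> k) x)))) = 0"
        by (simp add: sum_distrib_left[symmetric])
      then show ?thesis
        by (subst (asm) sum.swap) (simp add: sum_distrib_left mult.left_commute)
    qed
    ultimately show ?thesis
      by (simp add: dT_def distrib_left sum.distrib)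
  qed
  then have *: "indicator D x * degree_density a P x - indicator D x * degree_density a Q x =
     (\<Sum>\<pi> | \<pi> permutes UNIV. of_int (sign \<pi>) * (indicator D x * dT \<pi> x))" for x
    by (simp add: right_diff_distrib[symmetric] sum_distrib_left mult.left_commute)
  have "degree_integral a D P - degree_integral a D Q =
     (\<integral>x. indicator D x * degree_density a P x - indicator D x * degree_density a Q x \<partial>lborel)"
    unfolding degree_integral_def
    by (intro Bochner_Integration.integral_diff[symmetric] integrable_indicator_continuous D
        continuous_on_degree_density poly)
  also have "\<dots> = 0" unfolding * using int0 by simp
  finally show ?thesis by simp
qed

text \<open>Rows are exchanged one at a time. A frontier value above \<open>3 * a\<close> stays
  above \<open>2 * a\<close> whichever rows have already been exchanged, as each moves by less than
  \<open>a\<close>.\<close>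

lemma degree_integral_close:
  fixes P Q :: "'n::finite \<Rightarrow> real^'n \<Rightarrow> real"
  assumes D: "open D" "bounded D" and a: "0 < a"
    and poly: "\<And>l. real_polynomial_function (P l)" "\<And>l. real_polynomial_function (Q l)"
    and front: "\<And>x. x \<in> frontier D \<Longrightarrow> \<exists>l. \<bar>P l x\<bar> > 3 * a"
    and close: "\<And>x l. x \<in> closure D \<Longrightarrow> \<bar>P l x - Q l x\<bar> < a"
  shows "degree_integral a D P = degree_integral a D Q"
proof -
  let ?mix = "\<lambda>S l. if l \<in> S then Q l else P l"
  have "degree_integral a D P = degree_integral a D (?mix S)" for S :: "'n set"
    using finite[of S]
  proof (induction S)
    case empty
    then show ?case by simp
  next
    case (insert j S)
    have "degree_integral a D (?mix S) = degree_integral a D (?mix (insert j S))"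
    proof (rule degree_integral_change_row[OF D a, where j = j])
      show "real_polynomial_function (?mix S l)" "real_polynomial_function (?mix (insert j S) l)" for l
        using poly by auto
      show "?mix (insert j S) l = ?mix S l" if "l \<noteq> j" for l using that by simp
      show "\<bar>?mix S j x - ?mix (insert j S) j x\<bar> < a" if "x \<in> closure D" for x
        using close[OF that, of j] insert.hyps by simp
      show "\<exists>l. \<bar>?mix S l x\<bar> > 2 * a" if "x \<in> frontier D" for x
      proof -
        obtain l where l: "\<bar>P l x\<bar> > 3 * a" using front \<open>x \<in> frontier D\<close> by blast
        have "\<bar>P l x - Q l x\<bar> < a" using that close by (simp add: frontier_def)
        then have "\<bar>?mix S l x\<bar> > 2 * a" using l a by auto
        then show ?thesis by blast
      qed
    qed
    then show ?case using insert.IH by simp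
  qed
  from this[of UNIV] show ?thesis by simp
qed

lemma degree_integral_homotopy:
  fixes P Q :: "'n::finite \<Rightarrow> real^'n \<Rightarrow> real"
  assumes D: "open D" "bounded D" and a: "0 < a"
    and poly: "\<And>l. real_polynomial_function (P l)" "\<And>l. real_polynomial_function (Q l)"
    and front: "\<And>x t. x \<in> frontier D \<Longrightarrow> 0 \<le> t \<Longrightarrow> t \<le> 1 \<Longrightarrow> \<exists>l. \<bar>(1 - t) * P l x + t * Q l x\<bar> > 3 * a"
  shows "degree_integral a D P = degree_integral a D Q"
proof -
  have "\<exists>M. \<forall>x\<in>closure D. \<bar>P l x - Q l x\<bar> \<le> M" for l
  proof -
    have "compact ((\<lambda>x. P l x - Q l x) ` closure D)"
      using D by (intro compact_continuous_image continuous_intros polynomial_continuous_on poly) simp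
    then have "bounded ((\<lambda>x. P l x - Q l x) ` closure D)" by (rule compact_imp_bounded)
    then show ?thesis by (simp add: bounded_iff)
  qed
  then have "\<forall>l. \<exists>M. \<forall>x\<in>closure D. \<bar>P l x - Q l x\<bar> \<le> M" by blast
  from choice[OF this] obtain M where M: "\<And>l x. x \<in> closure D \<Longrightarrow> \<bar>P l x - Q l x\<bar> \<le> M l" by blast
  \<comment> \<open>With \<open>N\<close> equal steps along the segment, every component moves by
    less than \<open>a\<close> per step. The sum of the bounds stands in for their maximum.\<close>
  obtain N :: nat where N: "real N > (\<Sum>l\<in>UNIV. \<bar>M l\<bar>) / a" using reals_Archimedean2 by blast
  have N0: "real N > 0" using N a by (smt (verit) divide_nonneg_pos sum_nonneg abs_ge_zero)
  have Mle: "M l / real N < a" for l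
  proof -
    have "M l \<le> \<bar>M l\<bar>" by simp
    also have "\<dots> \<le> (\<Sum>l\<in>UNIV. \<bar>M l\<bar>)" by (rule member_le_sum) auto
    also have "\<dots> < real N * a" using N a by (simp add: divide_less_eq)
    finally show ?thesis using N0 by (simp add: divide_less_eq mult.commute)
  qed
  define R where "R i l x = (1 - real i / real N) * P l x + real i / real N * Q l x" for i l x
  have "degree_integral a D (R 0) = degree_integral a D (R i)" if "i \<le> N" for i
    using that
  proof (induction i)
    case (Suc i)
    have "degree_integral a D (R i) = degree_integral a D (R (Suc i))"
    proof (rule degree_integral_close[OF D a])
      show "real_polynomial_function (R i l)" "real_polynomial_function (R (Suc i) l)" for l
        unfolding R_def by (intro real_polynomial_function.intros poly)+
      show "\<exists>l. \<bar>R i l x\<bar> > 3 * a" if "x \<in> frontier D" for x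
        unfolding R_def by (rule front[OF that]) (use Suc.prems N0 in auto)
      show "\<bar>R i l x - R (Suc i) l x\<bar> < a" if "x \<in> closure D" for x l
      proof -
        have "R i l x - R (Suc i) l x = (P l x - Q l x) / real N"
          using N0 by (simp add: R_def field_simps)
        then have "\<bar>R i l x - R (Suc i) l x\<bar> \<le> M l / real N"
          using M[OF that, of l] N0 by (simp add: divide_right_mono)
        then show ?thesis using Mle[of l] by simp
      qed
    qed
    then show ?case using Suc by simp
  qed simp
  moreover have "R 0 = P" "R N = Q" using N0 by (simp_all add: R_def fun_eq_iff)
  ultimately show ?thesis by force
qed

text \<open>The normalising constant: what a single zero contributes to the degree integral, up to
  sign.\<close>

definition bump_mass :: "'n::finite itself \<Rightarrow> real \<Rightarrow> real"
  where "bump_mass _ a = (\<integral>y. (\<Prod>l\<in>UNIV. bump a ((y :: real^'n) $ l)) \<partial>lborel)"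

lemma bump_product:
  fixes a :: real
  assumes a: "0 < a"
  shows "continuous_on S (\<lambda>y::real^'n::finite. \<Prod>l\<in>UNIV. bump a (y $ l))"
    and "integrable lborel (\<lambda>y::real^'n. \<Prod>l\<in>UNIV. bump a (y $ l))"
    and "bump_mass TYPE('n) a > 0"
proof -
  let ?F = "\<lambda>y::real^'n. \<Prod>l\<in>UNIV. bump a (y $ l)"
  show cont: "continuous_on S ?F" for S by (intro continuous_intros)
  let ?C = "cbox (\<chi> i. -a) (\<chi> i. a) :: (real^'n) set"
  have "integrable lborel (\<lambda>y. indicator ?C y *\<^sub>R ?F y)"
    by (rule borel_integrable_compact[OF compact_cbox cont])
  moreover have C: "indicator ?C y *\<^sub>R ?F y = ?F y" for y
  proof (cases "y \<in> ?C")
    case False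
    then obtain l where "\<not> (-a \<le> y $ l \<and> y $ l \<le> a)" by (auto simp: mem_box_cart)
    then have "a \<le> \<bar>y $ l\<bar>" by linarith
    then have "bump a (y $ l) = 0" by (rule bump_eq_0[OF a])
    then have "?F y = 0" by auto
    then show ?thesis by simp
  qed simp
  ultimately show int: "integrable lborel ?F" unfolding C by blast
  have nonneg: "?F y \<ge> 0" for y by (simp add: prod_nonneg bump_nonneg)
  have "integral\<^sup>L lborel ?F \<noteq> 0"
  proof
    assume "integral\<^sup>L lborel ?F = 0"
    then have "AE y in lborel. ?F y = 0"
      using integral_nonneg_eq_0_iff_AE[OF int] nonneg by simp
    moreover have U: "open {y. ?F y \<noteq> 0}" by (intro open_Collect_neq cont continuous_on_const)
    ultimately have "{y. ?F y \<noteq> 0} \<in> null_sets lborel"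
      using AE_iff_null[of lborel "\<lambda>y. ?F y = 0"] by simp
    then have "negligible {y. ?F y \<noteq> 0}"
      by (simp add: negligible_iff_null_sets null_sets_completionI)
    moreover have "0 \<in> {y. ?F y \<noteq> 0}" using a by (simp add: bump_def)
    ultimately show False using open_not_negligible[OF U] by blast
  qed
  moreover have "integral\<^sup>L lborel ?F \<ge> 0" using nonneg by (simp add: integral_nonneg_AE)
  ultimately show "bump_mass TYPE('n) a > 0" by (simp add: bump_mass_def)
qed

text \<open>Substitution absorbs the absolute value of the determinant and leaves its sign. The
  hypothesis \<open>out\<close> puts the support of the density inside \<open>B\<close>, so that the
  integral extends over the whole space.\<close>

lemma degree_integral_linear:
  fixes A :: "real^'n::finite \<Rightarrow> real^'n"
  assumes A: "linear A" and nz: "det (matrix A) \<noteq> 0" and a: "0 < a"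
    and out: "\<And>x. x \<notin> B \<Longrightarrow> \<exists>l. a \<le> \<bar>A (x - z) $ l\<bar>"
  shows "degree_integral a B (\<lambda>l x. A (x - z) $ l) = sgn (det (matrix A)) * bump_mass TYPE('n) a"
proof -
  let ?F = "\<lambda>y::real^'n. \<Prod>l\<in>UNIV. bump a (y $ l)"
  have pd: "partial_deriv (\<lambda>x. A (x - z) $ l) i x = matrix A $ l $ i" for l i x
  proof -
    have "((\<lambda>x. A (x - z) $ l) has_derivative (\<lambda>v. A v $ l)) (at x)"
      unfolding linear_diff[OF A] vector_minus_component
      by (rule has_derivative_eq_rhs[OF has_derivative_diff[OF bounded_linear.has_derivative[OF bounded_linear_vec_nth
           linear_imp_has_derivative[OF A]] has_derivative_const]]) simp
    from fun_cong[OF frechet_derivative_at[OF this], of "axis i 1", symmetric] show ?thesis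
      by (simp only: partial_deriv_def matrix_def vec_lambda_beta)
  qed
  have "(\<chi> l i. matrix A $ l $ i) = matrix A" by (simp add: vec_eq_iff)
  then have dens: "degree_density a (\<lambda>l x. A (x - z) $ l) x = ?F (A (x - z)) * det (matrix A)" for x
    by (simp add: degree_density_def pd)
  have ind: "indicator B x * degree_density a (\<lambda>l x. A (x - z) $ l) x = ?F (A (x - z)) * det (matrix A)" for x
  proof (cases "x \<in> B")
    case False
    then obtain l where "a \<le> \<bar>A (x - z) $ l\<bar>" using out by blast
    then have "bump a (A (x - z) $ l) = 0" by (rule bump_eq_0[OF a])
    then have "?F (A (x - z)) = 0" by auto
    then show ?thesis using False by simp
  qed (simp add: dens)
  have contA: "continuous_on UNIV A"
    by (rule linear_continuous_on[OF linear_conv_bounded_linear[THEN iffD1, OF A]])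
  have meas: "(\<lambda>x. ?F (A x) * det (matrix A)) \<in> borel_measurable borel"
    by (intro borel_measurable_continuous_onI continuous_intros contA)
  have "degree_integral a B (\<lambda>l x. A (x - z) $ l) = (\<integral>x. ?F (A (x - z)) * det (matrix A) \<partial>lborel)"
    unfolding degree_integral_def ind ..
  also have "\<dots> = (\<integral>x. ?F (A x) * det (matrix A) \<partial>lborel)"
    using lborel_shift(1)[OF meas, of z] .
  also have "\<dots> = (\<integral>x. sgn (det (matrix A)) * (\<bar>det (matrix A)\<bar> * ?F (A x)) \<partial>lborel)"
    by (rule Bochner_Integration.integral_cong[OF refl]) (simp add: sgn_mult_abs mult.assoc[symmetric])
  also have "\<dots> = sgn (det (matrix A)) * bump_mass TYPE('n) a"
    using integral_linear_substitution[OF A bump_product(2)[OF a] nz] by (simp add: bump_mass_def)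
  finally show ?thesis .
qed

lemma degree_integral_excision:
  assumes a: "0 < a" and Z: "finite Z" and sub: "\<And>z. z \<in> Z \<Longrightarrow> B z \<subseteq> D" and disj: "disjoint_family_on B Z"
    and opn: "\<And>z. z \<in> Z \<Longrightarrow> open (B z)" and bdd: "bounded D"
    and poly: "\<And>l. real_polynomial_function (P l)"
    and out: "\<And>x. x \<in> D - (\<Union>z\<in>Z. B z) \<Longrightarrow> \<exists>l. a \<le> \<bar>P l x\<bar>"
  shows "degree_integral a D P = (\<Sum>z\<in>Z. degree_integral a (B z) P)"
proof -
  have "indicator D x * degree_density a P x = (\<Sum>z\<in>Z. indicator (B z) x * degree_density a P x)" for x
  proof -
    consider "x \<notin> D" | "x \<in> D - (\<Union>z\<in>Z. B z)" | "x \<in> D" "x \<in> (\<Union>z\<in>Z. B z)" by blast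
    then show ?thesis
    proof cases
      case 1
      then have "x \<notin> B z" if "z \<in> Z" for z using sub that by blast
      then have "(\<Sum>z\<in>Z. indicator (B z) x * degree_density a P x) = 0"
        by (intro sum.neutral) simp
      then show ?thesis using 1 by simp
    next
      case 2
      then obtain l where "a \<le> \<bar>P l x\<bar>" using out by blast
      then have "bump a (P l x) = 0" by (rule bump_eq_0[OF a])
      then have "degree_density a P x = 0" by (auto simp: degree_density_def)
      then show ?thesis by simp
    next
      case 3
      have "(\<Sum>z\<in>Z. indicator (B z) x :: real) = indicator (\<Union>z\<in>Z. B z) x"
        using disj Z by (simp add: indicator_UN_disjoint)
      then show ?thesis using 3 by (simp add: sum_distrib_right[symmetric])
    qed
  qed
  then have "degree_integral a D P = (\<integral>x. (\<Sum>z\<in>Z. indicator (B z) x * degree_density a P x) \<partial>lborel)"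
    by (simp add: degree_integral_def)
  also have "\<dots> = (\<Sum>z\<in>Z. degree_integral a (B z) P)"
    unfolding degree_integral_def
    by (intro Bochner_Integration.integral_sum integrable_indicator_continuous opn
        continuous_on_degree_density poly bounded_subset[OF bdd sub])
  finally show ?thesis .
qed

section \<open>Signed counts of nondegenerate zeros\<close>

lemma norm_large_component:
  fixes v :: "real^'n::finite"
  assumes "norm v > real CARD('n) * c"
  shows "\<exists>l. c < \<bar>v $ l\<bar>"
proof (rule ccontr)
  assume "\<nexists>l. c < \<bar>v $ l\<bar>"
  then have "(\<Sum>l\<in>UNIV. \<bar>v $ l\<bar>) \<le> (\<Sum>l\<in>(UNIV :: 'n set). c)"
    by (intro sum_mono) (simp add: not_less)
  then show False using norm_le_l1_cart[of v] assms by simp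
qed

lemma eventually_at_right_0_less:
  "0 < c \<Longrightarrow> \<forall>\<^sub>F r in at_right (0::real). r < c"
  using eventually_at_right_less[of "0::real"] by (auto simp: eventually_at_right_field)

lemma real_polynomial_vec_component:
  assumes "polynomial_function (p :: 'a::real_normed_vector \<Rightarrow> real^'n::finite)"
  shows "real_polynomial_function (\<lambda>x. p x $ l)"
  using assms[unfolded polynomial_function_def, rule_format, OF bounded_linear_vec_nth, of l] by (simp add: o_def)

lemma polynomial_affine_component:
  assumes "linear (A :: real^'n::finite \<Rightarrow> real^'n)"
  shows "real_polynomial_function (\<lambda>x. A (x - z) $ l)"
proof -
  have A: "bounded_linear (\<lambda>x. A x $ l)"
    by (intro bounded_linear_compose[OF bounded_linear_vec_nth] linear_conv_bounded_linear[THEN iffD1, OF assms])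
  have "real_polynomial_function (\<lambda>x. A x $ l + (- A z $ l))"
    by (intro real_polynomial_function.intros(2,3) real_polynomial_function.intros(1)[OF A])
  then show ?thesis by (simp add: linear_diff[OF assms])
qed

text \<open>Injectivity bounds \<open>A\<close> below by \<beta>, and \<delta> is chosen such that
  the linearization error is at most half of that. The segment from \<open>A\<close> to
  \<open>h\<close> then vanishes at \<open>z\<close> only; its end \<open>t = 1\<close> shows that
  the zero is isolated.\<close>

lemma nondegenerate_zero_linearization:
  fixes h A :: "real^'n::finite \<Rightarrow> real^'n"
  assumes der: "(h has_derivative A) (at z)" and nz: "det (matrix A) \<noteq> 0" and hz: "h z = 0"
  obtains \<beta> \<delta> where "0 < \<beta>" "0 < \<delta>" "\<And>v. \<beta> * norm v \<le> norm (A v)"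
    "\<And>x t. norm (x - z) < \<delta> \<Longrightarrow> 0 \<le> t \<Longrightarrow> t \<le> 1 \<Longrightarrow>
        \<beta> / 2 * norm (x - z) \<le> norm ((1 - t) *\<^sub>R A (x - z) + t *\<^sub>R h x)"
proof -
  have lin: "linear A" using der has_derivative_linear by blast
  then have "inj A" using nz det_nz_iff_inj by blast
  then obtain \<beta> where \<beta>: "0 < \<beta>" "\<And>v. \<beta> * norm v \<le> norm (A v)"
    using linear_inj_bounded_below_pos[OF lin] by blast
  have "0 < \<beta> / 2" using \<beta> by simp
  with der obtain \<delta> where \<delta>: "0 < \<delta>" "\<And>x. norm (x - z) < \<delta> \<Longrightarrow> norm (h x - h z - A (x - z)) \<le> \<beta> / 2 * norm (x - z)"
    unfolding has_derivative_at_alt by blast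
  show ?thesis
  proof (rule that[OF \<beta>(1) \<delta>(1) \<beta>(2)])
    fix x t assume x: "norm (x - z) < \<delta>" and t: "0 \<le> t" "t \<le> (1::real)"
    have "(1 - t) *\<^sub>R A (x - z) + t *\<^sub>R h x = A (x - z) + t *\<^sub>R (h x - A (x - z))"
      by (simp add: algebra_simps)
    moreover have "norm (t *\<^sub>R (h x - A (x - z))) \<le> 1 * norm (h x - A (x - z))"
      unfolding norm_scaleR using t by (intro mult_right_mono) auto
    moreover have "norm (h x - A (x - z)) \<le> \<beta> / 2 * norm (x - z)" using \<delta>(2)[OF x] hz by simp
    ultimately show "\<beta> / 2 * norm (x - z) \<le> norm ((1 - t) *\<^sub>R A (x - z) + t *\<^sub>R h x)"
      using \<beta>(2)[of "x - z"] norm_diff_ineq[of "A (x - z)" "t *\<^sub>R (h x - A (x - z))"] by simp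
  qed
qed

text \<open>Nothing is assumed about the zeros of \<open>P\<close>: near each zero of
  \<open>h\<close>, it is deformed to the linearization of \<open>h\<close> there, whose integral is
  known. How small \<open>a\<close> must be depends on \<open>h\<close> and not on \<open>P\<close>,
  and the eventual form lets two maps share one \<open>a\<close>.\<close>

lemma degree_integral_count:
  fixes h :: "real^'n::finite \<Rightarrow> real^'n"
  assumes D: "open D" "bounded D" and cont: "continuous_on (closure D) h"
    and front: "\<And>x. x \<in> frontier D \<Longrightarrow> h x \<noteq> 0"
    and Z_def: "Z = {x \<in> D. h x = 0}" and Z: "finite Z"
    and der: "\<And>z. z \<in> Z \<Longrightarrow> (h has_derivative A z) (at z)"
    and nz: "\<And>z. z \<in> Z \<Longrightarrow> det (matrix (A z)) \<noteq> 0"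
  shows "\<forall>\<^sub>F a in at_right 0. \<forall>P. (\<forall>l. real_polynomial_function (P l)) \<longrightarrow>
      (\<forall>x\<in>closure D. \<forall>l. \<bar>P l x - h x $ l\<bar> < a) \<longrightarrow>
      degree_integral a D P = bump_mass TYPE('n) a * (\<Sum>z\<in>Z. sgn (det (matrix (A z))))"
proof -
  let ?n = "real CARD('n)"
  have lin: "linear (A z)" if "z \<in> Z" for z using der[OF that] has_derivative_linear by blast
  let ?R = "\<lambda>z p. 0 < fst p \<and> 0 < snd p \<and> (\<forall>v. fst p * norm v \<le> norm (A z v)) \<and>
     (\<forall>x t. norm (x - z) < snd p \<longrightarrow> 0 \<le> t \<longrightarrow> t \<le> 1 \<longrightarrow>
        fst p / 2 * norm (x - z) \<le> norm ((1 - t) *\<^sub>R A z (x - z) + t *\<^sub>R h x))"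
  have "\<forall>z\<in>Z. \<exists>p. ?R z p"
  proof
    fix z assume z: "z \<in> Z"
    then have "h z = 0" by (simp add: Z_def)
    from nondegenerate_zero_linearization[OF der[OF z] nz[OF z] this]
    obtain \<beta> \<delta> where "0 < \<beta>" "0 < \<delta>" "\<And>v. \<beta> * norm v \<le> norm (A z v)"
      "\<And>x t. norm (x - z) < \<delta> \<Longrightarrow> 0 \<le> t \<Longrightarrow> t \<le> 1 \<Longrightarrow>
        \<beta> / 2 * norm (x - z) \<le> norm ((1 - t) *\<^sub>R A z (x - z) + t *\<^sub>R h x)" by blast
    then show "\<exists>p. ?R z p"
      by (intro exI[of _ "(\<beta>, \<delta>)"]) simp
  qed
  from bchoice[OF this] obtain q where q: "\<And>z. z \<in> Z \<Longrightarrow> 0 < fst (q z)" "\<And>z. z \<in> Z \<Longrightarrow> 0 < snd (q z)"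
    "\<And>z v. z \<in> Z \<Longrightarrow> fst (q z) * norm v \<le> norm (A z v)"
    "\<And>z x t. z \<in> Z \<Longrightarrow> norm (x - z) < snd (q z) \<Longrightarrow> 0 \<le> t \<Longrightarrow> t \<le> 1 \<Longrightarrow>
        fst (q z) / 2 * norm (x - z) \<le> norm ((1 - t) *\<^sub>R A z (x - z) + t *\<^sub>R h x)" by blast
  define \<beta> where "\<beta> z = fst (q z)" for z
  note q = q[folded \<beta>_def]
  have "\<forall>\<^sub>F r in at_right 0. \<forall>z\<in>Z. r < snd (q z) \<and> cball z r \<subseteq> D \<and> (\<forall>w\<in>Z. w \<noteq> z \<longrightarrow> r < dist w z / 2)"
    using Z
  proof (rule eventually_ball_finite, intro ballI eventually_conj)
    fix z assume z: "z \<in> Z"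
    show "\<forall>\<^sub>F r in at_right 0. r < snd (q z)" using q(2)[OF z] by (rule eventually_at_right_0_less)
    show "\<forall>\<^sub>F r in at_right 0. cball z r \<subseteq> D"
    proof -
      have "z \<in> D" using z by (simp add: Z_def)
      then obtain e where "0 < e" "cball z e \<subseteq> D" using D(1) open_contains_cball by blast
      then show ?thesis using eventually_at_right_0_less[of e] subset_cball[of _ e z]
        by (auto elim!: eventually_mono)
    qed
    show "\<forall>\<^sub>F r in at_right 0. \<forall>w\<in>Z. w \<noteq> z \<longrightarrow> r < dist w z / 2"
      using Z
    proof (rule eventually_ball_finite, intro ballI)
      fix w
      show "\<forall>\<^sub>F r in at_right 0. w \<noteq> z \<longrightarrow> r < dist w z / 2"
        using eventually_at_right_0_less[of "dist w z / 2"] by (cases "w = z") auto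
    qed
  qed
  from eventually_happens'[OF trivial_limit_at_right_real eventually_conj[OF eventually_at_right_less[of "0::real"] this]]
  obtain r where r: "0 < r" "\<And>z. z \<in> Z \<Longrightarrow> r < snd (q z)" "\<And>z. z \<in> Z \<Longrightarrow> cball z r \<subseteq> D"
    "\<And>z w. z \<in> Z \<Longrightarrow> w \<in> Z \<Longrightarrow> w \<noteq> z \<Longrightarrow> r < dist w z / 2" by blast
  let ?K = "closure D - (\<Union>z\<in>Z. ball z r)"
  have "compact ?K" using D by (intro compact_diff) auto
  moreover have "continuous_on ?K h" by (rule continuous_on_subset[OF cont]) blast
  moreover have "\<not> (\<exists>x\<in>?K. h x = 0)"
  proof
    assume "\<exists>x\<in>?K. h x = 0"
    then obtain x where x: "x \<in> ?K" "h x = 0" by blast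
    then have "x \<notin> frontier D" using front by blast
    then have "x \<in> D" using x D(1) by (simp add: frontier_def interior_open)
    then have "x \<in> Z" using x by (simp add: Z_def)
    then show False using x r(1) by auto
  qed
  ultimately obtain \<mu> where \<mu>: "0 < \<mu>" "\<And>x. x \<in> ?K \<Longrightarrow> \<mu> \<le> norm (h x)"
    by (rule brouwer_compactness_lemma) blast
  \<comment> \<open>Passing from a norm to one component costs the factor \<open>?n\<close>. Away
    from the zeros some component of \<open>h\<close> then exceeds \<open>2 * a\<close>, hence that
    of \<open>P\<close> exceeds \<open>a\<close> and the density vanishes. On the spheres of radius
    \<open>r\<close> the segment to the linearization has a component above \<open>4 * a\<close>;
    replacing \<open>h\<close> by \<open>P\<close> leaves the \<open>3 * a\<close> required for the
    homotopy of degree integrals.\<close>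
  have "\<forall>\<^sub>F a in at_right 0. a < \<mu> / (2 * ?n)"
    by (rule eventually_at_right_0_less) (use \<mu> in simp)
  moreover have "\<forall>\<^sub>F a in at_right 0. \<forall>z\<in>Z. a < \<beta> z / 2 * r / (4 * ?n)"
    using Z by (rule eventually_ball_finite) (use q(1) r(1) in \<open>auto intro!: eventually_at_right_0_less divide_pos_pos\<close>)
  ultimately show ?thesis
    using eventually_at_right_less[of 0]
  proof eventually_elim
    case (elim a)
    then have a: "0 < a" and a\<mu>: "?n * (2 * a) < \<mu>" and a\<beta>: "\<And>z. z \<in> Z \<Longrightarrow> ?n * (4 * a) < \<beta> z / 2 * r"
      by (auto simp: field_simps)
    show ?case
    proof (intro allI impI)
      fix P :: "'n \<Rightarrow> real^'n \<Rightarrow> real"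
      assume poly: "\<forall>l. real_polynomial_function (P l)"
        and close: "\<forall>x\<in>closure D. \<forall>l. \<bar>P l x - h x $ l\<bar> < a"
      have sub: "ball z r \<subseteq> D" if "z \<in> Z" for z using r(3)[OF that] ball_subset_cball by blast
      have "degree_integral a D P = (\<Sum>z\<in>Z. degree_integral a (ball z r) P)"
      proof (rule degree_integral_excision[OF a Z sub])
        show "disjoint_family_on (\<lambda>z. ball z r) Z"
          unfolding disjoint_family_on_def
        proof (intro ballI impI)
          fix z w assume "z \<in> Z" "w \<in> Z" "z \<noteq> w"
          then have "r + r \<le> dist z w" using r(4)[of w z] by simp
          then show "ball z r \<inter> ball w r = {}" by (rule disjoint_ballI)
        qed
        show "\<exists>l. a \<le> \<bar>P l x\<bar>" if x: "x \<in> D - (\<Union>z\<in>Z. ball z r)" for x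
        proof -
          have xD: "x \<in> closure D" using x closure_subset by blast
          then have "?n * (2 * a) < norm (h x)" using \<mu>(2)[of x] x a\<mu> by force
          then obtain l where "2 * a < \<bar>h x $ l\<bar>" using norm_large_component by blast
          moreover have "\<bar>P l x - h x $ l\<bar> < a" using close xD by blast
          ultimately show ?thesis by (intro exI[of _ l]) linarith
        qed
      qed (use D poly in auto)
      also have "\<dots> = (\<Sum>z\<in>Z. bump_mass TYPE('n) a * sgn (det (matrix (A z))))"
      proof (rule sum.cong[OF refl])
        fix z assume z: "z \<in> Z"
        have 1: "degree_integral a (ball z r) (\<lambda>l x. A z (x - z) $ l) = degree_integral a (ball z r) P"
        proof (rule degree_integral_homotopy[OF open_ball bounded_ball a])
          show "real_polynomial_function (\<lambda>x. A z (x - z) $ l)" for l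
            by (rule polynomial_affine_component[OF lin[OF z]])
          show "real_polynomial_function (P l)" for l using poly by blast
          show "\<exists>l. 3 * a < \<bar>(1 - t) * A z (x - z) $ l + t * P l x\<bar>"
            if x: "x \<in> frontier (ball z r)" and t: "0 \<le> t" "t \<le> 1" for x t
          proof -
            have xs: "norm (x - z) = r" using x r(1) by (simp add: dist_norm norm_minus_commute)
            then have xD: "x \<in> closure D"
              using r(3)[OF z] closure_subset[of D] by (auto simp: dist_norm norm_minus_commute subset_iff)
            let ?v = "(1 - t) *\<^sub>R A z (x - z) + t *\<^sub>R h x"
            have "?n * (4 * a) < norm ?v"
              using q(4)[OF z, of x t] t xs r(2)[OF z] a\<beta>[OF z] by simp
            then obtain l where l: "4 * a < \<bar>?v $ l\<bar>" using norm_large_component by blast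
            have "\<bar>t * (P l x - h x $ l)\<bar> \<le> 1 * \<bar>P l x - h x $ l\<bar>"
              unfolding abs_mult using t by (intro mult_right_mono) auto
            also have "\<dots> < a" using close xD by simp
            finally have "\<bar>t * P l x - t * h x $ l\<bar> < a" by (simp add: right_diff_distrib)
            then show ?thesis using l by (intro exI[of _ l]) simp
          qed
        qed
        have 2: "degree_integral a (ball z r) (\<lambda>l x. A z (x - z) $ l) = sgn (det (matrix (A z))) * bump_mass TYPE('n) a"
        proof (rule degree_integral_linear[OF lin[OF z] nz[OF z] a])
          fix x assume "x \<notin> ball z r"
          then have "r \<le> norm (x - z)" by (simp add: dist_norm norm_minus_commute)
          then have "\<beta> z * r \<le> \<beta> z * norm (x - z)" using q(1)[OF z] by simp
          moreover have "0 < \<beta> z * r" using q(1)[OF z] r(1) by simp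
          ultimately have "?n * (4 * a) < norm (A z (x - z))"
            using q(3)[OF z, of "x - z"] a\<beta>[OF z] by simp
          then obtain l where "4 * a < \<bar>A z (x - z) $ l\<bar>" using norm_large_component by blast
          then show "\<exists>l. a \<le> \<bar>A z (x - z) $ l\<bar>" using a by (intro exI[of _ l]) simp
        qed
        show "degree_integral a (ball z r) P = bump_mass TYPE('n) a * sgn (det (matrix (A z)))"
          by (rule trans[OF 1[symmetric] trans[OF 2 mult.commute]])
      qed
      finally show "degree_integral a D P = bump_mass TYPE('n) a * (\<Sum>z\<in>Z. sgn (det (matrix (A z))))"
        by (simp add: sum_distrib_left)
    qed
  qed
qed

text \<open>Polynomials closer than \<open>a\<close> to the two maps have equal degree integrals,
  since on the frontier the segment between them keeps a component above \<open>4 * a - a\<close>.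
  Each integral is the count of the corresponding map times the same positive mass, which
  cancels.\<close>

lemma zero_count_homotopy:
  fixes h0 h1 :: "real^'n::finite \<Rightarrow> real^'n"
  assumes D: "open D" "bounded D"
    and cont: "continuous_on (closure D) h0" "continuous_on (closure D) h1"
    and front: "\<And>x t. x \<in> frontier D \<Longrightarrow> 0 \<le> t \<Longrightarrow> t \<le> 1 \<Longrightarrow> (1 - t) *\<^sub>R h0 x + t *\<^sub>R h1 x \<noteq> 0"
    and Z0: "finite {x \<in> D. h0 x = 0}" and Z1: "finite {x \<in> D. h1 x = 0}"
    and der0: "\<And>z. z \<in> D \<Longrightarrow> h0 z = 0 \<Longrightarrow> (h0 has_derivative A0 z) (at z)"
    and der1: "\<And>z. z \<in> D \<Longrightarrow> h1 z = 0 \<Longrightarrow> (h1 has_derivative A1 z) (at z)"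
    and nz0: "\<And>z. z \<in> D \<Longrightarrow> h0 z = 0 \<Longrightarrow> det (matrix (A0 z)) \<noteq> 0"
    and nz1: "\<And>z. z \<in> D \<Longrightarrow> h1 z = 0 \<Longrightarrow> det (matrix (A1 z)) \<noteq> 0"
  shows "(\<Sum>z | z \<in> D \<and> h0 z = 0. sgn (det (matrix (A0 z)))) = (\<Sum>z | z \<in> D \<and> h1 z = 0. sgn (det (matrix (A1 z))))"
proof -
  let ?n = "real CARD('n)"
  let ?H = "\<lambda>p. (1 - snd p) *\<^sub>R h0 (fst p) + snd p *\<^sub>R h1 (fst p)"
  let ?F = "frontier D \<times> {0..1::real}"
  have "compact ?F" using D by (intro compact_Times compact_frontier_bounded) auto
  moreover have "continuous_on ?F ?H"
    by (intro continuous_intros continuous_on_compose2[OF cont(1)] continuous_on_compose2[OF cont(2)])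
       (auto simp: frontier_def)
  moreover have "\<not> (\<exists>p\<in>?F. ?H p = 0)" using front by auto
  ultimately obtain \<mu> where \<mu>: "0 < \<mu>" "\<And>p. p \<in> ?F \<Longrightarrow> \<mu> \<le> norm (?H p)"
    by (rule brouwer_compactness_lemma) blast
  have f0: "h0 x \<noteq> 0" and f1: "h1 x \<noteq> 0" if "x \<in> frontier D" for x
    using front[OF that, of 0] front[OF that, of 1] by auto
  \<comment> \<open>Names the property that holds for all small \<open>a\<close>, so that both maps
    can be served by one value of \<open>a\<close>.\<close>
  define E where "E h A a \<longleftrightarrow> (\<forall>P. (\<forall>l. real_polynomial_function (P l)) \<longrightarrow>
      (\<forall>x\<in>closure D. \<forall>l. \<bar>P l x - h x $ l\<bar> < a) \<longrightarrow>
      degree_integral a D P = bump_mass TYPE('n) a * (\<Sum>z | z \<in> D \<and> h z = 0. sgn (det (matrix (A z)))))"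
    for h :: "real^'n \<Rightarrow> real^'n" and A :: "real^'n \<Rightarrow> real^'n \<Rightarrow> real^'n" and a
  have E_D: "degree_integral a D (\<lambda>l x. p x $ l) = bump_mass TYPE('n) a * (\<Sum>z | z \<in> D \<and> h z = 0. sgn (det (matrix (A z))))"
    if "E h A a" "polynomial_function p" "\<And>x. x \<in> closure D \<Longrightarrow> norm (h x - p x) < a" for h A a p
  proof -
    have "\<bar>p x $ l - h x $ l\<bar> < a" if "x \<in> closure D" for x l
      using component_le_norm_cart[of "h x - p x" l] \<open>\<And>x. x \<in> closure D \<Longrightarrow> norm (h x - p x) < a\<close>[OF that]
      by (simp add: abs_minus_commute)
    then show ?thesis
      by (intro that(1)[unfolded E_def, rule_format] real_polynomial_vec_component that(2)) auto
  qed
  have "\<forall>\<^sub>F a in at_right 0. a < \<mu> / (4 * ?n)"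
    by (rule eventually_at_right_0_less) (use \<mu> in simp)
  moreover have "\<forall>\<^sub>F a in at_right 0. E h0 A0 a"
    unfolding E_def by (rule degree_integral_count[OF D cont(1) f0 refl Z0]) (use der0 nz0 in simp_all)
  moreover have "\<forall>\<^sub>F a in at_right 0. E h1 A1 a"
    unfolding E_def by (rule degree_integral_count[OF D cont(2) f1 refl Z1]) (use der1 nz1 in simp_all)
  ultimately have "\<forall>\<^sub>F a in at_right 0. 0 < a \<and> a < \<mu> / (4 * ?n) \<and> E h0 A0 a \<and> E h1 A1 a"
    by (intro eventually_conj eventually_at_right_less)
  from eventually_happens'[OF trivial_limit_at_right_real this] obtain a where
    a: "0 < a" and a_less: "a < \<mu> / (4 * ?n)" and E0: "E h0 A0 a" and E1: "E h1 A1 a" by blast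
  have a\<mu>: "?n * (4 * a) < \<mu>" using a_less by (simp add: field_simps)
  have "\<exists>p. polynomial_function p \<and> (\<forall>x\<in>closure D. norm (h x - p x) < a)"
    if "continuous_on (closure D) h" for h :: "real^'n \<Rightarrow> real^'n"
    by (rule Stone_Weierstrass_polynomial_function[OF _ that a]) (use D in simp)
  from this[OF cont(1)] this[OF cont(2)] obtain p0 p1 where p: "polynomial_function p0" "polynomial_function p1"
    and close: "\<And>x. x \<in> closure D \<Longrightarrow> norm (h0 x - p0 x) < a" "\<And>x. x \<in> closure D \<Longrightarrow> norm (h1 x - p1 x) < a"
    by blast
  have c0: "\<bar>p0 x $ l - h0 x $ l\<bar> < a" if "x \<in> closure D" for x l
    using component_le_norm_cart[of "h0 x - p0 x" l] close(1)[OF that] by (simp add: abs_minus_commute)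
  have c1: "\<bar>p1 x $ l - h1 x $ l\<bar> < a" if "x \<in> closure D" for x l
    using component_le_norm_cart[of "h1 x - p1 x" l] close(2)[OF that] by (simp add: abs_minus_commute)
  have 1: "degree_integral a D (\<lambda>l x. p0 x $ l) = degree_integral a D (\<lambda>l x. p1 x $ l)"
  proof (rule degree_integral_homotopy[OF D a])
    fix x and t :: real assume x: "x \<in> frontier D" and t: "0 \<le> t" "t \<le> 1"
    then have xD: "x \<in> closure D" by (simp add: frontier_def)
    have "?n * (4 * a) < norm (?H (x, t))" using \<mu>(2)[of "(x, t)"] x t a\<mu> by simp
    then obtain l where l: "4 * a < \<bar>?H (x, t) $ l\<bar>" using norm_large_component by blast
    have "\<bar>(1 - t) * (p0 x $ l - h0 x $ l) + t * (p1 x $ l - h1 x $ l)\<bar>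
        \<le> (1 - t) * \<bar>p0 x $ l - h0 x $ l\<bar> + t * \<bar>p1 x $ l - h1 x $ l\<bar>"
      using t by (intro order_trans[OF abs_triangle_ineq]) (simp add: abs_mult)
    also have "\<dots> \<le> (1 - t) * a + t * a"
      using t c0[OF xD, of l] c1[OF xD, of l] by (intro add_mono mult_left_mono) auto
    also have "\<dots> = a" by (simp add: algebra_simps)
    finally show "\<exists>l. 3 * a < \<bar>(1 - t) * p0 x $ l + t * p1 x $ l\<bar>"
      using l by (intro exI[of _ l]) (simp add: algebra_simps)
  qed (rule real_polynomial_vec_component[OF p(1)] real_polynomial_vec_component[OF p(2)])+
  have 2: "degree_integral a D (\<lambda>l x. p0 x $ l) =
      bump_mass TYPE('n) a * (\<Sum>z | z \<in> D \<and> h0 z = 0. sgn (det (matrix (A0 z))))"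
    by (rule E_D[OF E0 p(1) close(1)])
  have 3: "degree_integral a D (\<lambda>l x. p1 x $ l) =
      bump_mass TYPE('n) a * (\<Sum>z | z \<in> D \<and> h1 z = 0. sgn (det (matrix (A1 z))))"
    by (rule E_D[OF E1 p(2) close(2)])
  from trans[OF 2[symmetric] trans[OF 1 3]] show ?thesis
    using bump_product(3)[OF a, where 'n = 'n] unfolding mult_cancel_left by linarith
qed

section \<open>Coordinate subspaces\<close>

definition proj :: "'n set \<Rightarrow> real^'n::finite \<Rightarrow> real^'n"
  where "proj K v = (\<chi> i. if i \<in> K then v $ i else 0)"

lemma proj_component: "proj K v $ i = (if i \<in> K then v $ i else 0)"
  by (simp add: proj_def)

lemma linear_proj: "linear (proj K)"
  by (rule linearI) (auto simp: proj_def vec_eq_iff)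

lemma bounded_linear_proj: "bounded_linear (proj K)"
  by (rule linear_conv_bounded_linear[THEN iffD1, OF linear_proj])

lemma proj_in_coord_space [simp]: "proj K v \<in> coord_space K"
  by (simp add: coord_space_def proj_component)

lemma proj_eq_iff: "proj K v = v \<longleftrightarrow> v \<in> coord_space K"
  by (auto simp: coord_space_def proj_def vec_eq_iff)

lemma proj_id: "v \<in> coord_space K \<Longrightarrow> proj K v = v"
  by (simp add: proj_eq_iff)

lemma proj_diff_proj: "proj K (v - proj K v) = 0"
  by (auto simp: proj_def vec_eq_iff)

lemma subspace_coord_space: "subspace (coord_space K)"
  by (auto simp: subspace_def coord_space_def)

lemma norm_proj_le: "norm (proj K v) \<le> norm v"
  unfolding norm_vec_def by (rule L2_set_mono) (auto simp: proj_component)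

lemma proj_add_complement:
  assumes "w \<in> coord_space K"
  shows "proj K (w + (v - proj K v)) = w"
  by (simp only: linear_add[OF linear_proj] proj_diff_proj proj_id[OF assms] add_0_right)

lemma continuous_on_proj [continuous_intros]:
  "continuous_on S f \<Longrightarrow> continuous_on S (\<lambda>x. proj K (f x))"
  by (rule bounded_linear.continuous_on[OF bounded_linear_proj])

text \<open>
  Completing a map of \<open>\<real>\<^sup>K\<close> to itself by the identity in the remaining coordinates gives a map of
  the full space with the same zeros and the same determinants.
\<close>

definition stab :: "'n set \<Rightarrow> (real^'n::finite \<Rightarrow> real^'n) \<Rightarrow> real^'n \<Rightarrow> real^'n"
  where "stab K h v = h (proj K v) + (v - proj K v)"

lemma stab_on_coord_space: "v \<in> coord_space K \<Longrightarrow> stab K h v = h v"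
  by (simp add: stab_def proj_id)

lemma proj_stab: "h (proj K v) \<in> coord_space K \<Longrightarrow> proj K (stab K h v) = h (proj K v)"
  unfolding stab_def by (rule proj_add_complement)

lemma stab_eq_0D:
  assumes "stab K h v = 0" and "h (proj K v) \<in> coord_space K"
  shows "proj K v = v" and "h v = 0"
proof -
  have 0: "h (proj K v) = 0"
    using proj_stab[of h K v, OF assms(2)] assms(1) linear_0[OF linear_proj, of K] by simp
  then show "proj K v = v" using assms(1) by (simp add: stab_def)
  with 0 show "h v = 0" by simp
qed

lemma stab_convex_comb:
  "(1 - t) *\<^sub>R stab K a v + t *\<^sub>R stab K b v = stab K (\<lambda>w. (1 - t) *\<^sub>R a w + t *\<^sub>R b w) v"
  by (simp add: stab_def algebra_simps)

text \<open>Precomposition with \<open>proj K\<close> turns a derivative within a relative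
  neighbourhood into an unrestricted one, for which uniqueness and the chain rule hold without side
  conditions.\<close>

lemma has_derivative_compose_proj:
  assumes der: "(g has_derivative G) (at w within S)" and w: "w \<in> coord_space K"
    and e: "0 < e" "\<And>v. v \<in> coord_space K \<Longrightarrow> dist v w < e \<Longrightarrow> v \<in> S"
  shows "((\<lambda>v. g (proj K v)) has_derivative (\<lambda>u. G (proj K u))) (at w)"
proof -
  have sub: "proj K ` ball w e \<subseteq> S"
  proof
    fix y assume "y \<in> proj K ` ball w e"
    then obtain v where v: "y = proj K v" "dist w v < e" by auto
    have "proj K v - w = proj K (v - w)" by (simp add: linear_diff[OF linear_proj] proj_id[OF w])
    then have "dist y w \<le> dist v w" using norm_proj_le[of K "v - w"] by (simp add: v(1) dist_norm)
    then show "y \<in> S" using e(2)[of y] v by (simp add: dist_commute)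
  qed
  have "(proj K has_derivative proj K) (at w within ball w e)"
    by (rule linear_imp_has_derivative[OF linear_proj])
  moreover have "(g has_derivative G) (at (proj K w) within proj K ` ball w e)"
    unfolding proj_id[OF w] by (rule has_derivative_subset[OF der sub])
  ultimately have "((\<lambda>v. g (proj K v)) has_derivative (\<lambda>u. G (proj K u))) (at w within ball w e)"
    by (rule has_derivative_in_compose)
  then show ?thesis using e(1) by (simp add: at_within_open[OF centre_in_ball[THEN iffD2] open_ball])
qed

lemma has_derivative_stab:
  assumes "((\<lambda>v. g (proj K v)) has_derivative (\<lambda>u. G (proj K u))) (at w)"
  shows "(stab K g has_derivative stab K G) (at w)"
  unfolding stab_def
  by (intro has_derivative_add has_derivative_diff has_derivative_ident assms linear_imp_has_derivative linear_proj)

lemma matrix_stab: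
  assumes "linear G" and "\<And>j. j \<in> K \<Longrightarrow> G (axis j 1) \<in> coord_space K"
  shows "matrix (stab K G) $ i $ j = (if i \<in> K \<and> j \<in> K then G (axis j 1) $ i else if i = j then 1 else 0)"
proof (cases "j \<in> K")
  case True
  then have "axis j (1::real) \<in> coord_space K" by (auto simp: coord_space_def axis_def)
  then have "stab K G (axis j 1) = G (axis j 1)" by (rule stab_on_coord_space)
  then show ?thesis using assms(2)[OF True] True by (auto simp: matrix_def coord_space_def)
next
  case False
  then have "proj K (axis j (1::real)) = 0" by (auto simp: proj_def axis_def vec_eq_iff)
  then have "stab K G (axis j 1) = axis j 1" by (simp add: stab_def linear_0[OF assms(1)])
  then show ?thesis using False by (auto simp: matrix_def axis_def)
qed

text \<open>The map \<open>L\<close> reads off the coordinates with respect to \<open>b\<close>.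
  This turns the matrix of representation coefficients into that of an endomorphism of
  \<open>real ^ 'n\<close>, whose determinant is multiplicative.\<close>

lemma det_wrt_eq:
  fixes b :: "'n::finite \<Rightarrow> 'b::real_vector" and L :: "'b \<Rightarrow> real^'n"
  assumes inj: "inj_on b K" and ind: "independent (b ` K)"
    and L: "linear L" and Lb: "\<And>i. i \<in> K \<Longrightarrow> L (b i) = axis i 1"
    and G: "linear G" and span: "\<And>j. j \<in> K \<Longrightarrow> G (axis j 1) \<in> span (b ` K)"
  shows "det_wrt K b G = det (matrix (stab K (\<lambda>u. L (G u))))"
proof -
  have Lv: "L v = (\<Sum>k\<in>K. representation (b ` K) v (b k) *\<^sub>R axis k 1)" if "v \<in> span (b ` K)" for v
  proof -
    have "(\<Sum>w\<in>b ` K. representation (b ` K) v w *\<^sub>R w) = v"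
      using real_vector.sum_representation_eq[OF ind that] by simp
    then have "v = (\<Sum>k\<in>K. representation (b ` K) v (b k) *\<^sub>R b k)"
      by (simp add: sum.reindex[OF inj])
    then have "L v = L (\<Sum>k\<in>K. representation (b ` K) v (b k) *\<^sub>R b k)" by simp
    also have "\<dots> = (\<Sum>k\<in>K. representation (b ` K) v (b k) *\<^sub>R axis k 1)"
      unfolding linear_sum[OF L] linear_scale[OF L] by (rule sum.cong) (simp_all add: Lb)
    finally show ?thesis .
  qed
  have comp: "L v $ i = (if i \<in> K then representation (b ` K) v (b i) else 0)" if "v \<in> span (b ` K)" for v i
  proof -
    have "L v $ i = (\<Sum>k\<in>K. if k = i then representation (b ` K) v (b k) else 0)"
      unfolding Lv[OF that] sum_component by (rule sum.cong) (auto simp: axis_def)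
    then show ?thesis by simp
  qed
  have "matrix (stab K (\<lambda>u. L (G u))) = (\<chi> i j. if i \<in> K \<and> j \<in> K then representation (b ` K) (G (axis j 1)) (b i)
                  else if i = j then 1 else 0)"
  proof -
    have "matrix (stab K (\<lambda>u. L (G u))) $ i $ j = (if i \<in> K \<and> j \<in> K then L (G (axis j 1)) $ i else if i = j then 1 else 0)" for i j
    proof (rule matrix_stab)
      show "linear (\<lambda>u. L (G u))" using linear_compose[OF G L] by (simp add: o_def)
      show "L (G (axis j 1)) \<in> coord_space K" if "j \<in> K" for j
        using comp[OF span[OF that]] by (simp add: coord_space_def)
    qed
    then show ?thesis using comp[OF span] by (simp add: vec_eq_iff)
  qed
  then show ?thesis by (simp add: det_wrt_def)
qed

lemma det_sign_eq_sgn: "real_of_int (det_sign K b D) = sgn (det_wrt K b D)"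
  by (simp add: det_sign_def)

lemma det_wrt_axis:
  fixes G :: "real^'n::finite \<Rightarrow> real^'n"
  assumes "linear G" and "\<And>j. j \<in> K \<Longrightarrow> G (axis j 1) \<in> coord_space K"
  shows "det_wrt K (\<lambda>i. axis i 1) G = det (matrix (stab K G))"
proof -
  have span: "coord_space K \<subseteq> span ((\<lambda>i. axis i 1) ` K)"
  proof
    fix v :: "real^'n" assume v: "v \<in> coord_space K"
    have "v = (\<Sum>i\<in>UNIV. v $ i *\<^sub>R axis i 1)"
      using basis_expansion[of v] unfolding scalar_mult_eq_scaleR by (rule sym)
    also have "\<dots> = (\<Sum>i\<in>K. v $ i *\<^sub>R axis i 1)"
      by (rule sum.mono_neutral_right) (use v in \<open>auto simp: coord_space_def\<close>)
    also have "\<dots> \<in> span ((\<lambda>i. axis i 1) ` K)"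
      by (intro span_sum span_scale span_base) auto
    finally show "v \<in> span ((\<lambda>i. axis i 1) ` K)" .
  qed
  have "inj_on (\<lambda>i. axis i (1::real) :: real^'n) K" by (auto simp: inj_on_def axis_eq_axis)
  moreover have "independent ((\<lambda>i. axis i (1::real) :: real^'n) ` K)"
    by (rule independent_mono[OF independent_Basis]) (auto simp: Basis_vec_def)
  ultimately show ?thesis
    using det_wrt_eq[of "\<lambda>i. axis i 1" K "\<lambda>x. x" G] assms span linear_id[unfolded id_def] by blast
qed

lemma smooth_on_has_derivative:
  assumes "smooth_on S g" and "w \<in> S"
  shows "\<exists>G. (g has_derivative G) (at w within S)"
proof -
  obtain U F where UF: "open U" "w \<in> U" "Ck_on (Suc 0) U F" "\<forall>y\<in>S \<inter> U. F y = g y"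
    using assms unfolding smooth_on_def by blast
  then have "F differentiable (at w)" by simp
  then obtain G where "(F has_derivative G) (at w)" unfolding differentiable_def by blast
  then have F: "(F has_derivative G) (at w within S)" by (rule has_derivative_at_withinI)
  obtain e where "0 < e" "\<And>y. dist y w < e \<Longrightarrow> y \<in> U"
    using UF(1,2) unfolding open_dist by blast
  then have "(g has_derivative G) (at w within S)"
    by (intro has_derivative_transform_within[OF F _ assms(2), of e]) (use UF(4) in auto)
  then show ?thesis by blast
qed

section \<open>Charts\<close>

locale oriented_manifold =
  fixes K :: "'n::finite set" and M :: "'a topology" and A :: "('a, 'n) chart set"
    and ori :: "('a, 'n) chart \<Rightarrow> 'a \<Rightarrow> int"
  assumes compact_M: "compact_space M"
    and manifold: "smooth_manifold K M A"
    and orient: "orientation K M A ori"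
begin

abbreviation bdry :: "'a set" where "bdry \<equiv> manifold_boundary K M A"

lemma Hausdorff_M: "Hausdorff_space M"
  using manifold by (simp add: smooth_manifold_def)

lemma chart: "c \<in> A \<Longrightarrow> is_chart K M c"
  using manifold by (simp add: smooth_manifold_def)

lemma charts_cover: "x \<in> topspace M \<Longrightarrow> \<exists>c\<in>A. x \<in> fst c"
  using manifold by (auto simp: smooth_manifold_def)

lemma openin_dom: "c \<in> A \<Longrightarrow> openin M (fst c)"
  using chart by (simp add: is_chart_def)

lemma dom_subset: "c \<in> A \<Longrightarrow> fst c \<subseteq> topspace M"
  using openin_dom openin_subset by blast

lemma topspace_dom: "c \<in> A \<Longrightarrow> topspace (subtopology M (fst c)) = fst c"
  using dom_subset by (simp add: Int_absorb1)

lemma chart_homeo: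
  "c \<in> A \<Longrightarrow> homeomorphic_map (subtopology M (fst c)) (top_of_set (snd c ` fst c)) (snd c)"
  using chart by (simp add: is_chart_def)

lemma chart_inj: "c \<in> A \<Longrightarrow> inj_on (snd c) (fst c)"
  using homeomorphic_imp_injective_map[OF chart_homeo] topspace_dom by simp

lemma in_chart_apply: "c \<in> A \<Longrightarrow> x \<in> fst c \<Longrightarrow> in_chart c h (snd c x) = h x"
  by (simp add: in_chart_def chart_inj)

lemma continuous_map_chart: "c \<in> A \<Longrightarrow> continuous_map (subtopology M (fst c)) euclidean (snd c)"
  using homeomorphic_imp_continuous_map[OF chart_homeo] continuous_map_in_subtopology by blast

lemma continuous_map_chart_inverse:
  assumes c: "c \<in> A"
  shows "continuous_map (top_of_set (snd c ` fst c)) (subtopology M (fst c)) (inv_into (fst c) (snd c))"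
proof -
  obtain g where g: "homeomorphic_maps (subtopology M (fst c)) (top_of_set (snd c ` fst c)) (snd c) g"
    using chart_homeo[OF c] unfolding homeomorphic_map_maps by blast
  show ?thesis
  proof (rule continuous_map_eq)
    show "continuous_map (top_of_set (snd c ` fst c)) (subtopology M (fst c)) g"
      using g by (simp add: homeomorphic_maps_def)
    fix v assume "v \<in> topspace (top_of_set (snd c ` fst c))"
    then obtain x where "x \<in> fst c" "v = snd c x" by auto
    moreover from this have "g (snd c x) = x" using g topspace_dom[OF c] by (simp add: homeomorphic_maps_def)
    ultimately show "g v = inv_into (fst c) (snd c) v" using chart_inj[OF c] by simp
  qed
qed

lemma continuous_on_in_chart:
  assumes "c \<in> A" and "continuous_map M euclidean h"
  shows "continuous_on (snd c ` fst c) (in_chart c h)"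
proof -
  have "continuous_map (subtopology M (fst c)) euclidean h"
    using assms(2) by (rule continuous_map_from_subtopology)
  from continuous_map_compose[OF continuous_map_chart_inverse[OF assms(1)] this]
  show ?thesis by (simp add: in_chart_def)
qed

text \<open>Closedness comes from the Hausdorff property. It makes the complement open, so that a
  map modified inside the chart can be pasted to an unmodified one outside.\<close>

lemma compactin_chart_preimage:
  assumes c: "c \<in> A" and "compact \<Omega>" and sub: "\<Omega> \<subseteq> snd c ` fst c"
  shows "compactin M {x \<in> fst c. snd c x \<in> \<Omega>}" and "closedin M {x \<in> fst c. snd c x \<in> \<Omega>}"
proof -
  have "compactin (top_of_set (snd c ` fst c)) \<Omega>"
    using assms by (simp add: compactin_subtopology)
  from image_compactin[OF this continuous_map_chart_inverse[OF c]]
  have "compactin M (inv_into (fst c) (snd c) ` \<Omega>)"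
    by (simp add: compactin_subtopology)
  moreover have "inv_into (fst c) (snd c) ` \<Omega> = {x \<in> fst c. snd c x \<in> \<Omega>}"
  proof (intro equalityI subsetI)
    fix x assume "x \<in> inv_into (fst c) (snd c) ` \<Omega>"
    then obtain v where "v \<in> \<Omega>" "x = inv_into (fst c) (snd c) v" by blast
    then show "x \<in> {x \<in> fst c. snd c x \<in> \<Omega>}"
      using sub inv_into_into[of v "snd c" "fst c"] f_inv_into_f[of v "snd c" "fst c"] by auto
  next
    fix x assume "x \<in> {x \<in> fst c. snd c x \<in> \<Omega>}"
    then show "x \<in> inv_into (fst c) (snd c) ` \<Omega>"
      using inv_into_f_f[OF chart_inj[OF c], of x] by (intro image_eqI[of _ _ "snd c x"]) auto
  qed
  ultimately show "compactin M {x \<in> fst c. snd c x \<in> \<Omega>}" by simp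
  then show "closedin M {x \<in> fst c. snd c x \<in> \<Omega>}"
    by (rule compactin_imp_closedin[OF Hausdorff_M])
qed

lemma compact_chart_image:
  assumes "c \<in> A" and "compactin M C" and "C \<subseteq> fst c"
  shows "compact (snd c ` C)"
proof -
  have "compactin (subtopology M (fst c)) C" using assms by (simp add: compactin_subtopology)
  from image_compactin[OF this continuous_map_chart[OF assms(1)]] show ?thesis by simp
qed

lemma openin_chart_preimage:
  assumes c: "c \<in> A" and W: "openin M W" "W \<subseteq> fst c" and "open T"
  shows "openin M {x \<in> W. snd c x \<in> T}"
proof -
  have "openin (subtopology M (fst c)) {x \<in> topspace (subtopology M (fst c)). snd c x \<in> T}"
    using continuous_map_chart[OF c] \<open>open T\<close> by (auto simp: continuous_map_def)
  then have "openin M {x \<in> fst c. snd c x \<in> T}"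
    unfolding topspace_dom[OF c] by (rule openin_trans_full[OF _ openin_dom[OF c]])
  then have "openin M (W \<inter> {x \<in> fst c. snd c x \<in> T})" using W(1) by blast
  moreover have "W \<inter> {x \<in> fst c. snd c x \<in> T} = {x \<in> W. snd c x \<in> T}" using W(2) by blast
  ultimately show ?thesis by simp
qed

text \<open>
  A common description of interior and half-space charts. Only one direction is available for \<open>B\<close>:
  that a point of \<open>bdry\<close> has its coordinates in \<open>B\<close> in every chart is invariance of the boundary.
\<close>

lemma chart_model:
  assumes c: "c \<in> A" and W: "openin M W" "W \<subseteq> fst c"
  obtains P B T where "closed P" "P \<subseteq> coord_space K" "open {v. proj K v \<in> P - B}"
    "open T" "snd c ` W = P \<inter> T" "\<And>x. x \<in> W \<Longrightarrow> snd c x \<in> B \<Longrightarrow> x \<in> bdry"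
proof -
  have "openin (subtopology M (fst c)) W"
    using W by (simp add: openin_open_subtopology[OF openin_dom[OF c]])
  then have opW: "openin (top_of_set (snd c ` fst c)) (snd c ` W)"
    using homeomorphic_imp_open_map[OF chart_homeo[OF c]] by (simp add: open_map_def)
  have closed_coord: "closed (coord_space K)" by (rule closed_subspace[OF subspace_coord_space])
  consider "openin (top_of_set (coord_space K)) (snd c ` fst c)"
    | k where "k \<in> K" "openin (top_of_set (half_space K k)) (snd c ` fst c)"
    using chart[OF c] by (auto simp: is_chart_def)
  then show ?thesis
  proof cases
    case 1
    have "openin (top_of_set (coord_space K)) (snd c ` W)" by (rule openin_trans[OF opW 1])
    then obtain T where "open T" "snd c ` W = coord_space K \<inter> T" unfolding openin_open by blast
    then show ?thesis by (intro that[of "coord_space K" "{}" T]) (simp_all add: closed_coord)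
  next
    case 2
    have "openin (top_of_set (half_space K k)) (snd c ` W)" by (rule openin_trans[OF opW 2(2)])
    then obtain T where T: "open T" "snd c ` W = half_space K k \<inter> T" unfolding openin_open by blast
    show ?thesis
    proof (rule that[of "half_space K k" "{v. v $ k = 0}" T])
      have "half_space K k = coord_space K \<inter> {v. 0 \<le> v $ k}" by (auto simp: half_space_def)
      moreover have "closed {v :: real^'n. 0 \<le> v $ k}" by (intro closed_Collect_le continuous_intros)
      ultimately show "closed (half_space K k)" using closed_coord by (simp add: closed_Int)
      show "half_space K k \<subseteq> coord_space K" by (auto simp: half_space_def)
      have "{v. proj K v \<in> half_space K k - {v. v $ k = 0}} = {v. 0 < v $ k}"
        using 2(1) by (auto simp: half_space_def proj_component)
      moreover have "open {v :: real^'n. 0 < v $ k}" by (intro open_Collect_less continuous_intros)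
      ultimately show "open {v. proj K v \<in> half_space K k - {v. v $ k = 0}}" by simp
      show "x \<in> bdry" if "x \<in> W" "snd c x \<in> {v. v $ k = 0}" for x
        using that 2 c W(2) by (auto simp: manifold_boundary_def)
    qed (use T in auto)
  qed
qed

text \<open>The ball is one of the full space \<open>real ^ 'n\<close>, so that completed maps have
  unrestricted derivatives. This covers half-space charts too: a point off \<open>bdry\<close> has
  its coordinates off \<open>B\<close>.\<close>

lemma chart_interior:
  assumes c: "c \<in> A" and W: "openin M W" "W \<subseteq> fst c" and x: "x \<in> W" "x \<notin> bdry"
  obtains e where "0 < e" "\<And>v. dist v (snd c x) < e \<Longrightarrow> proj K v \<in> snd c ` W" "snd c x \<in> coord_space K"
proof -
  obtain P B T where m: "P \<subseteq> coord_space K" "open {v. proj K v \<in> P - B}"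
    "open T" "snd c ` W = P \<inter> T" "\<And>x. x \<in> W \<Longrightarrow> snd c x \<in> B \<Longrightarrow> x \<in> bdry"
    using chart_model[OF c W] by metis
  have xP: "snd c x \<in> P \<inter> T" using m(4) x by blast
  then have cs: "snd c x \<in> coord_space K" using m(1) by blast
  have "open (proj K -` T)"
    by (rule open_vimage[OF m(3) linear_continuous_on[OF bounded_linear_proj]])
  then have "open ({v. proj K v \<in> P - B} \<inter> proj K -` T)" using m(2) by blast
  moreover have "snd c x \<in> {v. proj K v \<in> P - B} \<inter> proj K -` T"
    using xP m(5)[OF x(1)] x(2) by (auto simp: proj_id[OF cs])
  ultimately obtain e where "0 < e" "\<And>v. dist v (snd c x) < e \<Longrightarrow> v \<in> {v. proj K v \<in> P - B} \<inter> proj K -` T"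
    unfolding open_dist by metis
  then show ?thesis using m(4) cs by (intro that[of e]) auto
qed

lemma chart_coord_space: "c \<in> A \<Longrightarrow> x \<in> fst c \<Longrightarrow> snd c x \<in> coord_space K"
  using chart_model[OF _ openin_dom] by blast

section \<open>Regular zeros on an oriented manifold\<close>

lemma ori_values: "c \<in> A \<Longrightarrow> x \<in> fst c \<Longrightarrow> ori c x = 1 \<or> ori c x = -1"
proof -
  assume c: "c \<in> A" and x: "x \<in> fst c"
  have "continuous_map (subtopology M (fst c)) (discrete_topology {-1, 1}) (ori c)"
    using orient c by (simp add: orientation_def)
  then have "ori c x \<in> {-1, 1}"
    using x topspace_dom[OF c] continuous_map_funspace by fastforce
  then show ?thesis by auto
qed

lemma openin_ori:
  assumes c: "c \<in> A"
  shows "openin M {x \<in> fst c. ori c x = \<epsilon>}"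
proof -
  have cont: "continuous_map (subtopology M (fst c)) (discrete_topology {-1, 1}) (ori c)"
    using orient c by (simp add: orientation_def)
  have "openin (subtopology M (fst c)) {x \<in> topspace (subtopology M (fst c)). ori c x \<in> {\<epsilon>} \<inter> {-1, 1}}"
    using cont by (rule openin_continuous_map_preimage) simp
  then have "openin M {x \<in> fst c. ori c x \<in> {\<epsilon>} \<inter> {-1, 1}}"
    unfolding topspace_dom[OF c] by (rule openin_trans_full[OF _ openin_dom[OF c]])
  moreover have "{x \<in> fst c. ori c x \<in> {\<epsilon>} \<inter> {-1, 1}} = {x \<in> fst c. ori c x = \<epsilon>}"
    using ori_values[OF c] by auto
  ultimately show ?thesis by simp
qed

text \<open>Differentiability is asked for at \<open>x\<close> alone, and for the completed map, so
  that the determinant is taken over all indices in every dimension. That \<open>h\<close> vanishes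
  at \<open>x\<close> is left to the context.\<close>

definition regular_zero :: "('a, 'n) chart \<Rightarrow> ('a \<Rightarrow> real^'n) \<Rightarrow> 'a \<Rightarrow> (real^'n \<Rightarrow> real^'n) \<Rightarrow> bool"
  where "regular_zero c h x D \<longleftrightarrow>
     (stab K (in_chart c h) has_derivative D) (at (snd c x)) \<and> det (matrix D) \<noteq> 0"

text \<open>The sign of the transition determinant enters twice, once through the orientation and
  once through the chain rule, and cancels.\<close>

lemma chart_change:
  assumes c: "c \<in> A" and c': "c' \<in> A" and x: "x \<in> fst c" "x \<in> fst c'" "x \<notin> bdry"
    and reg: "regular_zero c' h x D'"
  shows "\<exists>D. regular_zero c h x D \<and> ori c x * sgn (det (matrix D)) = ori c' x * sgn (det (matrix D'))"
proof -
  let ?W = "fst c \<inter> fst c'" and ?T = "in_chart c (snd c')" and ?w = "snd c x"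
  let ?S = "snd c ` ?W"
  have W: "openin M ?W" using openin_dom c c' by blast
  obtain e where e: "0 < e" "\<And>v. dist v ?w < e \<Longrightarrow> proj K v \<in> ?S" and w: "?w \<in> coord_space K"
    using chart_interior[OF c W _ _ x(3)] x by blast
  have T: "?T (snd c y) = snd c' y" if "y \<in> fst c" for y by (rule in_chart_apply[OF c that])
  have Tc: "?T v \<in> coord_space K" if "v \<in> ?S" for v
    using that T chart_coord_space[OF c'] by auto
  have "smooth_on ?S ?T" using manifold c c' by (simp add: smooth_manifold_def)
  then have "\<exists>G. (?T has_derivative G) (at ?w within ?S)"
    by (rule smooth_on_has_derivative) (use x in blast)
  then obtain G where G: "(?T has_derivative G) (at ?w within ?S)"
      and G_eq: "G = frechet_derivative ?T (at ?w within ?S)"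
    using frechet_derivative_works differentiableI by blast
  have Gp: "((\<lambda>v. ?T (proj K v)) has_derivative (\<lambda>u. G (proj K u))) (at ?w)"
    by (rule has_derivative_compose_proj[OF G w e(1)]) (metis e(2) proj_id)
  have linG: "linear G" using G has_derivative_linear by blast
  \<comment> \<open>The components of the transition map outside \<open>K\<close> vanish near
    \<open>?w\<close>, hence so do their derivatives.\<close>
  have Gc: "G u \<in> coord_space K" if "u \<in> coord_space K" for u
  proof -
    have "G u $ i = 0" if "i \<notin> K" for i
    proof -
      have "((\<lambda>v. ?T (proj K v) $ i) has_derivative (\<lambda>u. G (proj K u) $ i)) (at ?w)"
        by (rule bounded_linear.has_derivative[OF bounded_linear_vec_nth Gp])
      moreover have "((\<lambda>v. ?T (proj K v) $ i) has_derivative (\<lambda>u. 0)) (at ?w)"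
      proof (rule has_derivative_transform_within_open[OF has_derivative_const[of 0]])
        show "0 = ?T (proj K v) $ i" if "v \<in> ball ?w e" for v
          using Tc[OF e(2)[of v]] that \<open>i \<notin> K\<close> by (simp add: coord_space_def dist_commute)
      qed (use e in auto)
      ultimately have "(\<lambda>u. G (proj K u) $ i) = (\<lambda>u. 0)" by (rule has_derivative_unique)
      then show ?thesis using proj_id[OF \<open>u \<in> coord_space K\<close>] by metis
    qed
    then show ?thesis by (simp add: coord_space_def)
  qed
  have axis: "axis j 1 \<in> coord_space K" if "j \<in> K" for j using that by (auto simp: coord_space_def axis_def)
  let ?DT = "stab K G"
  have stabT: "(stab K ?T has_derivative ?DT) (at ?w)" by (rule has_derivative_stab[OF Gp])
  have "ori c x = ori c' x * det_sign K (\<lambda>i. axis i 1) G"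
    using orient c c' x unfolding orientation_def G_eq by blast
  then have ori: "of_int (ori c x) = of_int (ori c' x) * sgn (det (matrix ?DT))"
    using det_sign_eq_sgn[of K "\<lambda>i. axis i 1" G] det_wrt_axis[OF linG Gc[OF axis]] by simp
  \<comment> \<open>The values of an orientation are 1 and -1; the compatibility equation therefore
    forces the transition determinant to be nonzero, without recourse to the inverse transition
    map.\<close>
  then have nzT: "det (matrix ?DT) \<noteq> 0" using ori_values[OF c x(1)] by auto
  have "stab K ?T ?w = snd c' x" using stab_on_coord_space[OF w] T[OF x(1)] by simp
  then have "(stab K (in_chart c' h) has_derivative D') (at (stab K ?T ?w))"
    using reg by (simp add: regular_zero_def)
  from diff_chain_at[OF stabT this]
  have "(stab K (in_chart c' h) \<circ> stab K ?T has_derivative D' \<circ> ?DT) (at ?w)" .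
  then have D: "(stab K (in_chart c h) has_derivative D' \<circ> ?DT) (at ?w)"
  proof (rule has_derivative_transform_within_open)
    fix v assume "v \<in> ball ?w e"
    then have vS: "proj K v \<in> ?S" using e(2) by (simp add: dist_commute)
    then obtain y where y: "y \<in> fst c" "y \<in> fst c'" "proj K v = snd c y" by blast
    have "proj K (stab K ?T v) = ?T (proj K v)" by (rule proj_stab[of ?T K v, OF Tc[OF vS]])
    then show "(stab K (in_chart c' h) \<circ> stab K ?T) v = stab K (in_chart c h) v"
      unfolding o_def stab_def[of K "in_chart c' h"] stab_def[of K "in_chart c h"]
      by (simp add: y(3) T[OF y(1)] in_chart_apply[OF c' y(2)] in_chart_apply[OF c y(1)] stab_def)
  qed (use e in auto)
  have lin: "linear D'" "linear ?DT"
    using reg stabT has_derivative_linear unfolding regular_zero_def by blast+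
  have "det (matrix (D' \<circ> ?DT)) = det (matrix D') * det (matrix ?DT)"
    by (simp add: matrix_compose[OF lin(2,1)] det_mul)
  then have reg': "regular_zero c h x (D' \<circ> ?DT)"
    and sgn: "sgn (det (matrix (D' \<circ> ?DT))) = sgn (det (matrix D')) * sgn (det (matrix ?DT))"
    using D reg nzT by (simp_all add: regular_zero_def sgn_mult)
  have "sgn (det (matrix ?DT)) * sgn (det (matrix ?DT)) = 1"
    using nzT by (simp add: sgn_if)
  then have "a * sgn (det (matrix ?DT)) * (b * sgn (det (matrix ?DT))) = a * b" for a b
    by (simp add: mult.assoc mult.left_commute[of _ b])
  then have "of_int (ori c x) * sgn (det (matrix (D' \<circ> ?DT))) = of_int (ori c' x) * sgn (det (matrix D'))"
    unfolding ori sgn .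
  with reg' show ?thesis by blast
qed

text \<open>The signs \<open>s\<close> are a separate argument, so that a stage can alter them at
  some zeros and keep them at others. One witnessing chart per zero suffices, because
  \<open>chart_change\<close> transfers the sign to any other.\<close>

definition good :: "('a \<Rightarrow> real^'n) \<Rightarrow> ('a \<Rightarrow> real) \<Rightarrow> bool"
  where "good h s \<longleftrightarrow> continuous_map M euclidean h \<and> h ` topspace M \<subseteq> coord_space K \<and>
     (\<forall>x\<in>bdry. h x \<noteq> 0) \<and>
     (\<forall>x\<in>topspace M. h x = 0 \<longrightarrow> (\<exists>c\<in>A. x \<in> fst c \<and>
        (\<exists>D. regular_zero c h x D \<and> s x = ori c x * sgn (det (matrix D)))))"

definition zeros :: "('a \<Rightarrow> real^'n) \<Rightarrow> 'a set"
  where "zeros h = {x \<in> topspace M. h x = 0}"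

lemma good_regular:
  assumes "good h s" and "c \<in> A" and "x \<in> fst c" and "h x = 0"
  obtains D where "regular_zero c h x D" and "s x = ori c x * sgn (det (matrix D))"
proof -
  have xM: "x \<in> topspace M" using assms dom_subset by blast
  then obtain c' D' where c': "c' \<in> A" "x \<in> fst c'" "regular_zero c' h x D'" "s x = ori c' x * sgn (det (matrix D'))"
    using assms unfolding good_def by blast
  have "x \<notin> bdry" using assms unfolding good_def by blast
  then show ?thesis using chart_change[OF assms(2) c'(1) assms(3) c'(2) _ c'(3)] c'(4) that by metis
qed

text \<open>Nondegenerate zeros are isolated, and a compact set of isolated points is
  finite.\<close>

lemma finite_zeros:
  assumes g: "good h s"
  shows "finite (zeros h)"
proof -
  have cont: "continuous_map M euclidean h" using g by (simp add: good_def)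
  have "closedin M (zeros h)"
    using closedin_continuous_map_preimage[OF cont, of "{0}"] by (simp add: zeros_def)
  then have comp: "compactin M (zeros h)" using compact_M closedin_compact_space by blast
  let ?U = "{V. openin M V \<and> finite (V \<inter> zeros h)}"
  have "zeros h \<subseteq> \<Union> ?U"
  proof
    fix x assume "x \<in> zeros h"
    then have x: "x \<in> topspace M" "h x = 0" by (auto simp: zeros_def)
    obtain c where c: "c \<in> A" "x \<in> fst c" using charts_cover x by blast
    obtain D where D: "regular_zero c h x D" using good_regular[OF g c x(2)] by blast
    have w: "snd c x \<in> coord_space K" by (rule chart_coord_space[OF c])
    have "stab K (in_chart c h) (snd c x) = 0"
      by (simp add: stab_on_coord_space[OF w] in_chart_apply[OF c] x)
    then obtain \<beta> \<delta> where bd: "0 < \<beta>" "0 < \<delta>"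
      and lb: "\<And>v t. norm (v - snd c x) < \<delta> \<Longrightarrow> 0 \<le> t \<Longrightarrow> t \<le> 1 \<Longrightarrow>
        \<beta> / 2 * norm (v - snd c x) \<le> norm ((1 - t) *\<^sub>R D (v - snd c x) + t *\<^sub>R stab K (in_chart c h) v)"
      using nondegenerate_zero_linearization[of "stab K (in_chart c h)" D "snd c x"] D
      unfolding regular_zero_def by metis
    let ?V = "{y \<in> fst c. snd c y \<in> ball (snd c x) \<delta>}"
    have "openin M ?V" by (rule openin_chart_preimage[OF c(1) openin_dom[OF c(1)]]) auto
    moreover have "?V \<inter> zeros h \<subseteq> {x}"
    proof
      fix y assume y: "y \<in> ?V \<inter> zeros h"
      have "stab K (in_chart c h) (snd c y) = 0"
        using y c(1) by (simp add: stab_on_coord_space chart_coord_space in_chart_apply zeros_def)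
      then have "\<beta> / 2 * norm (snd c y - snd c x) \<le> 0"
        using lb[of "snd c y" 1] y by (simp add: dist_norm norm_minus_commute)
      then have "snd c y = snd c x" using bd(1) by (simp add: mult_le_0_iff)
      then show "y \<in> {x}" using chart_inj[OF c(1)] y c(2) by (auto dest: inj_onD)
    qed
    then have "finite (?V \<inter> zeros h)" by (rule finite_subset) simp
    moreover have "x \<in> ?V" using c bd by simp
    ultimately show "x \<in> \<Union> ?U" by blast
  qed
  then obtain F where F: "finite F" "F \<subseteq> ?U" "zeros h \<subseteq> \<Union> F"
    using compactinD[OF comp, of ?U] by blast
  then have "finite (\<Union>V\<in>F. V \<inter> zeros h)" by blast
  moreover have "zeros h \<subseteq> (\<Union>V\<in>F. V \<inter> zeros h)" using F(3) by blast
  ultimately show ?thesis by (rule rev_finite_subset)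
qed

end

section \<open>Sard's theorem on a coordinate subspace\<close>

lemma has_derivative_proj_shift:
  assumes "((\<lambda>v. q (proj K v)) has_derivative (\<lambda>u. Q (proj K u))) (at (proj K v0))"
  shows "(stab K q has_derivative stab K Q) (at v0)"
proof -
  \<comment> \<open>The map \<open>stab K q\<close> commutes with translations in the added
    coordinates, so its derivative at \<open>v0\<close> is the one at
    \<open>proj K v0\<close>.\<close>
  have "((\<lambda>v. v - (v0 - proj K v0)) has_derivative (\<lambda>u. u)) (at v0)"
    by (auto intro!: derivative_eq_intros)
  moreover have "((\<lambda>v. q (proj K v)) has_derivative (\<lambda>u. Q (proj K u))) (at (v0 - (v0 - proj K v0)))"
    using assms unfolding diff_diff_eq2 add_diff_cancel_left' .
  ultimately have "((\<lambda>v. q (proj K (v - (v0 - proj K v0)))) has_derivative (\<lambda>u. Q (proj K u))) (at v0)"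
    by (rule has_derivative_compose)
  moreover have "proj K (v - (v0 - proj K v0)) = proj K v" for v
    by (simp only: linear_diff[OF linear_proj, of K v] proj_diff_proj diff_zero)
  ultimately show ?thesis by (intro has_derivative_stab) simp
qed

text \<open>The critical set of the completed map is a cylinder over that of \<open>q\<close>; this
  makes Sard's theorem on the subspace an instance of the full-dimensional one.\<close>

lemma negligible_stab_critical:
  assumes "\<And>v. v \<in> S \<Longrightarrow> ((\<lambda>v. q (proj K v)) has_derivative (\<lambda>u. Q v (proj K u))) (at v)"
  shows "negligible (stab K q ` {v. proj K v \<in> S \<and> det (matrix (stab K (Q (proj K v)))) = 0})"
proof (rule Sard_square[where f' = "\<lambda>v. stab K (Q (proj K v))"])
  fix v assume "v \<in> {v. proj K v \<in> S \<and> det (matrix (stab K (Q (proj K v)))) = 0}"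
  then have v: "proj K v \<in> S" by simp
  then have "(stab K q has_derivative stab K (Q (proj K v))) (at v)"
    by (intro has_derivative_proj_shift assms)
  then show "(stab K q has_derivative stab K (Q (proj K v)))
      (at v within {v. proj K v \<in> S \<and> det (matrix (stab K (Q (proj K v)))) = 0})"
    by (rule has_derivative_at_withinI)
qed simp

text \<open>
  A critical point over the projection of \<open>y\<close> could be moved, in the added coordinates, to a critical
  point of the completed map over \<open>y\<close> itself.
\<close>

lemma stab_regular_preimage:
  assumes y: "y \<notin> stab K q ` {v. proj K v \<in> S \<and> det (matrix (stab K (Q (proj K v)))) = 0}"
    and v: "v \<in> S" "v \<in> coord_space K" "q v = proj K y"
  shows "det (matrix (stab K (Q v))) \<noteq> 0"
proof
  assume 0: "det (matrix (stab K (Q v))) = 0"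
  let ?w = "v + (y - proj K y)"
  have w: "proj K ?w = v" by (rule proj_add_complement[OF v(2)])
  have eq: "stab K q ?w = y" unfolding stab_def w v(3) by simp
  have "?w \<in> {v. proj K v \<in> S \<and> det (matrix (stab K (Q (proj K v)))) = 0}"
    unfolding mem_Collect_eq w using v(1) 0 by (rule conjI)
  from imageI[OF this, of "stab K q"] y show False unfolding eq by (rule notE[rotated])
qed

lemma open_not_subset_negligible:
  fixes N :: "'a::euclidean_space set"
  assumes "negligible N" and "open U" and "U \<noteq> {}"
  shows "\<exists>y\<in>U. y \<notin> N"
proof (rule ccontr)
  assume "\<not> (\<exists>y\<in>U. y \<notin> N)"
  then have "U \<subseteq> N" by blast
  then have "negligible U" using assms(1) negligible_subset by blast
  then show False using open_not_negligible[OF assms(2,3)] by simp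
qed

text \<open>Sard's theorem provides a small \<open>y\<close> in the full space; the perturbation is
  its projection, which is not longer.\<close>

lemma regular_perturbation:
  fixes q :: "real^'n::finite \<Rightarrow> real^'n"
  assumes q: "\<And>v. (q has_derivative Q v) (at v)" and "0 < \<eta>"
  shows "\<exists>y\<in>coord_space K. norm y < \<eta> \<and> (\<forall>v\<in>coord_space K. q v = y \<longrightarrow> det (matrix (stab K (Q v))) \<noteq> 0)"
proof -
  let ?N = "stab K q ` {v. proj K v \<in> coord_space K \<and> det (matrix (stab K (Q (proj K v)))) = 0}"
  have "negligible ?N"
  proof (rule negligible_stab_critical)
    fix v :: "real^'n" assume v: "v \<in> coord_space K"
    show "((\<lambda>v. q (proj K v)) has_derivative (\<lambda>u. Q v (proj K u))) (at v)"
      by (rule has_derivative_compose_proj[OF q v zero_less_one]) simp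
  qed
  then obtain y where y: "y \<in> ball 0 \<eta>" "y \<notin> ?N"
    using open_not_subset_negligible[of ?N "ball 0 \<eta>"] \<open>0 < \<eta>\<close> by auto
  show ?thesis
  proof (intro bexI[of _ "proj K y"] conjI ballI impI)
    show "norm (proj K y) < \<eta>" using norm_proj_le[of K y] y(1) by simp
    show "det (matrix (stab K (Q v))) \<noteq> 0" if "v \<in> coord_space K" "q v = proj K y" for v
      by (rule stab_regular_preimage[OF y(2) that(1) that])
  qed simp
qed

context oriented_manifold begin

lemma bdry_subset: "bdry \<subseteq> topspace M"
  using dom_subset by (auto simp: manifold_boundary_def)

lemma regular_zero_cong:
  assumes c: "c \<in> A" and V: "openin M V" "\<And>y. y \<in> V \<Longrightarrow> h y = h' y"
    and x: "x \<in> fst c" "x \<in> V" "x \<notin> bdry" and reg: "regular_zero c h x D"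
  shows "regular_zero c h' x D"
proof -
  have W: "openin M (fst c \<inter> V)" using openin_dom[OF c] V(1) by (rule openin_Int)
  obtain e where e: "0 < e" "\<And>v. dist v (snd c x) < e \<Longrightarrow> proj K v \<in> snd c ` (fst c \<inter> V)"
    and "snd c x \<in> coord_space K"
    by (rule chart_interior[OF c W Int_lower1 IntI[OF x(1,2)] x(3)]) (rule that, assumption+)
  have "(stab K (in_chart c h') has_derivative D) (at (snd c x))"
  proof (rule has_derivative_transform_within_open)
    show "(stab K (in_chart c h) has_derivative D) (at (snd c x))" using reg by (simp add: regular_zero_def)
    fix v assume "v \<in> ball (snd c x) e"
    then have "proj K v \<in> snd c ` (fst c \<inter> V)" using e(2) by (simp add: dist_commute)
    then obtain y where "y \<in> fst c" "y \<in> V" "proj K v = snd c y" by blast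
    then show "stab K (in_chart c h) v = stab K (in_chart c h') v"
      using V(2) by (simp add: stab_def in_chart_apply[OF c])
  qed (use e in auto)
  then show ?thesis using reg by (simp add: regular_zero_def)
qed

end

section \<open>Homotopies supported in a chart\<close>

lemma continuous_map_scaleR:
  fixes f :: "'a \<Rightarrow> 'b::real_normed_vector"
  assumes "continuous_map X euclidean u" and "continuous_map X euclidean f"
  shows "continuous_map X euclidean (\<lambda>x. u x *\<^sub>R f x)"
  using assms by (simp add: continuous_map_atin tendsto_scaleR)

context oriented_manifold begin

text \<open>
  The bound \<open>\<kappa>\<close> is uniform because \<open>bdry\<close> is not known to be closed, which would again need
  invariance of the boundary. The sign \<open>\<epsilon>\<close> is constant on \<open>W\<close>, whereas it may differ between the
  components of the chart domain.
\<close>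

lemma chart_step:
  assumes g: "good h s" and c: "c \<in> A" and W: "openin M W" "W \<subseteq> fst c"
    and \<epsilon>: "\<And>x. x \<in> W \<Longrightarrow> real_of_int (ori c x) = \<epsilon>"
    and k: "continuous_map M euclidean k" "\<And>x. x \<in> topspace M \<Longrightarrow> k x \<in> coord_space K"
    and C: "compactin M C" "C \<subseteq> W" and eq: "\<And>x. x \<in> topspace M \<Longrightarrow> x \<notin> C \<Longrightarrow> k x = h x"
    and \<kappa>: "0 < \<kappa>" and bd: "\<And>x t. x \<in> bdry \<Longrightarrow> 0 \<le> t \<Longrightarrow> t \<le> 1 \<Longrightarrow> \<kappa> \<le> norm ((1 - t) *\<^sub>R h x + t *\<^sub>R k x)"
    and \<eta>: "0 < \<eta>"
  shows "\<exists>h' s'. good h' s' \<and> (\<forall>x\<in>topspace M. norm (h' x - k x) < \<eta>) \<and> sum s' (zeros h') = sum s (zeros h)"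
proof (cases "C \<union> (zeros h \<inter> W) = {}")
  \<comment> \<open>The distance to the empty set is 0 by convention and cannot serve as a cutoff
    variable, so the case of an empty \<open>C0\<close> is separate; here \<open>k\<close> agrees
    with \<open>h\<close> everywhere.\<close>
  case True
  then have "C = {}" by blast
  then have "\<forall>x\<in>topspace M. norm (h x - k x) < \<eta>" using eq \<eta> by simp
  then show ?thesis using g by blast
next
  case False
  have hcont: "continuous_map M euclidean h" and hcs: "\<And>x. x \<in> topspace M \<Longrightarrow> h x \<in> coord_space K"
    and hb: "\<And>x. x \<in> bdry \<Longrightarrow> h x \<noteq> 0"
    using g by (auto simp: good_def)
  have WM: "W \<subseteq> topspace M" using W openin_subset by blast
  define \<phi> where "\<phi> = snd c"
  define Zc where "Zc = zeros h \<inter> W"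
  \<comment> \<open>The zeros of \<open>h\<close> in \<open>W\<close> are included besides
    \<open>C\<close>. Off \<open>C0\<close> the maps \<open>h\<close> and \<open>k\<close> then
    agree on \<open>W\<close> and do not vanish.\<close>
  define C0 where "C0 = \<phi> ` (C \<union> Zc)"
  have finZ: "finite (zeros h)" by (rule finite_zeros[OF g])
  have "compactin M (C \<union> Zc)"
    by (intro compactin_Un C(1) finite_imp_compactin) (use finZ WM in \<open>auto simp: Zc_def\<close>)
  then have C0: "compact C0" "C0 \<noteq> {}"
    using compact_chart_image[OF c] C(2) W(2) False by (auto simp: C0_def \<phi>_def Zc_def)
  obtain P B T where P: "closed P" "P \<subseteq> coord_space K" and PB: "open {v. proj K v \<in> P - B}"
    and T: "open T" "\<phi> ` W = P \<inter> T" and B_bdry: "\<And>x. x \<in> W \<Longrightarrow> \<phi> x \<in> B \<Longrightarrow> x \<in> bdry"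
    by (rule chart_model[OF c W, folded \<phi>_def]) (rule that, assumption+)
  have "C0 \<subseteq> \<phi> ` W" unfolding C0_def Zc_def using C(2) by (intro image_mono) blast
  then have "C0 \<subseteq> T" and C0P: "C0 \<subseteq> P" using T(2) by blast+
  obtain e0 where e0: "0 < e0" "(\<Union>x\<in>C0. cball x e0) \<subseteq> T"
    by (rule compact_subset_open_imp_cball_epsilon_subset[OF C0(1) T(1) \<open>C0 \<subseteq> T\<close>])
  \<comment> \<open>Half of the available radius leaves room for two zones within the chart: up to
    distance \<open>e\<close> the new map is a polynomial, and between \<open>e\<close> and
    \<open>2 * e\<close> it is interpolated back to \<open>k\<close>.\<close>
  define e where "e = e0 / 2"
  have e: "0 < e" using e0(1) by (simp add: e_def)
  define \<rho> where "\<rho> v = infdist v C0" for v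
  have \<rho>cont: "continuous_on X \<rho>" for X unfolding \<rho>_def by (intro continuous_on_infdist continuous_on_id)
  have \<rho>T: "v \<in> T" if v: "\<rho> v \<le> 2 * e" for v
  proof -
    obtain x where "x \<in> C0" "infdist v C0 = dist v x"
      using infdist_attains_inf[OF compact_imp_closed[OF C0(1)] C0(2)] by blast
    then have "x \<in> C0" "v \<in> cball x e0" using v by (auto simp: \<rho>_def e_def dist_commute)
    then show ?thesis using e0(2) by blast
  qed
  have \<rho>C0: "\<rho> v = 0" if "v \<in> C0" for v using that by (simp add: \<rho>_def)
  have compl: "compact {v. \<rho> v \<le> 2 * e}"
    unfolding \<rho>_def by (rule compact_infdist_le[OF C0(2,1)]) (use e in simp)
  define \<Omega> where "\<Omega> = P \<inter> {v. \<rho> v \<le> 2 * e}"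
  have \<Omega>: "compact \<Omega>" unfolding \<Omega>_def by (rule closed_Int_compact[OF P(1) compl])
  have \<Omega>W: "\<Omega> \<subseteq> \<phi> ` W" unfolding T(2) \<Omega>_def using \<rho>T by auto
  have \<phi>WU: "\<phi> ` W \<subseteq> snd c ` fst c" using W(2) by (auto simp: \<phi>_def)
  have \<phi>P: "\<phi> x \<in> P" if "x \<in> W" for x using T(2) that by blast
  have \<phi>cs: "\<phi> x \<in> coord_space K" if "x \<in> W" for x using \<phi>P[OF that] P(2) by blast
  have inj: "x = y" if "x \<in> W" "y \<in> W" "\<phi> x = \<phi> y" for x y
    using that inj_onD[OF chart_inj[OF c]] W(2) unfolding \<phi>_def by blast
  define hh where "hh = in_chart c h"
  define kk where "kk = in_chart c k"
  have hh: "hh (\<phi> x) = h x" and kk: "kk (\<phi> x) = k x" if "x \<in> W" for x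
    using in_chart_apply[OF c] that W(2) by (auto simp: hh_def kk_def \<phi>_def)
  have hh_cont: "continuous_on \<Omega> hh" and kk_cont: "continuous_on \<Omega> kk"
    unfolding hh_def kk_def
    by (rule continuous_on_subset[OF continuous_on_in_chart[OF c hcont]], use \<Omega>W \<phi>WU in blast,
        rule continuous_on_subset[OF continuous_on_in_chart[OF c k(1)]], use \<Omega>W \<phi>WU in blast)
  define An where "An = \<Omega> \<inter> {v. e \<le> \<rho> v}"
  have "closed {v. e \<le> \<rho> v}" by (intro closed_Collect_le continuous_on_const \<rho>cont)
  then have An: "compact An" unfolding An_def by (rule compact_Int_closed[OF \<Omega>])
  have AnW: "k x = h x" "k x \<noteq> 0" if "x \<in> W" "\<phi> x \<in> An" for x
  proof -
    have n: "\<phi> x \<notin> C0" using that(2) \<rho>C0[of "\<phi> x"] e by (auto simp: An_def)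
    have "x \<notin> C" and "x \<notin> Zc" using n by (auto simp: C0_def)
    then show "k x = h x" "k x \<noteq> 0" using eq that(1) WM by (auto simp: Zc_def zeros_def)
  qed
  have An0: "\<not> (\<exists>v\<in>An. kk v = 0)"
  proof
    assume "\<exists>v\<in>An. kk v = 0"
    then obtain v where v: "v \<in> An" "kk v = 0" by blast
    then obtain x where "x \<in> W" "v = \<phi> x" using \<Omega>W by (auto simp: An_def)
    then show False using v AnW(2) kk by simp
  qed
  have "continuous_on An kk" by (rule continuous_on_subset[OF kk_cont]) (simp add: An_def)
  then obtain \<mu>1 where \<mu>1: "0 < \<mu>1" "\<forall>v\<in>An. \<mu>1 \<le> norm (kk v)"
    using brouwer_compactness_lemma[OF An _ An0] by blast
  define \<mu> where "\<mu> = min \<kappa> \<mu>1"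
  \<comment> \<open>Two errors below \<eta>' add up, that of the polynomial approximation and the
    shift by \<open>y\<close>; the sum has to stay below both \<eta> and \<mu>.\<close>
  define \<eta>' where "\<eta>' = min \<eta> \<mu> / 3"
  have \<mu>: "0 < \<mu>" "\<mu> \<le> \<kappa>" "\<mu> \<le> \<mu>1" using \<kappa> \<mu>1(1) by (auto simp: \<mu>_def)
  have \<eta>': "0 < \<eta>'" "2 * \<eta>' < \<eta>" "2 * \<eta>' < \<mu>" using \<eta> \<mu>(1) by (auto simp: \<eta>'_def min_def)
  obtain q0 where q0: "polynomial_function q0" "\<forall>v\<in>\<Omega>. norm (kk v - q0 v) < \<eta>'"
    using Stone_Weierstrass_polynomial_function[OF \<Omega> kk_cont \<eta>'(1)] by blast
  define q where "q v = proj K (q0 v)" for v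
  define Q where "Q v u = proj K (frechet_derivative q0 (at v) u)" for v u
  have Q: "(q has_derivative Q v) (at v)" for v
  proof -
    have "(q0 has_derivative frechet_derivative q0 (at v)) (at v)"
      using differentiable_at_polynomial_function[OF q0(1)] frechet_derivative_works by blast
    then show ?thesis unfolding q_def Q_def by (rule bounded_linear.has_derivative[OF bounded_linear_proj])
  qed
  obtain y where y: "y \<in> coord_space K" "norm y < \<eta>'"
    "\<forall>v\<in>coord_space K. q v = y \<longrightarrow> det (matrix (stab K (Q v))) \<noteq> 0"
    using regular_perturbation[of q Q \<eta>' K] Q \<eta>'(1) by blast
  define p where "p v = q v - y" for v
  have pcont: "continuous_on X p" for X
    unfolding p_def by (intro continuous_on_diff continuous_on_const continuous_on_of_has_derivative[OF Q])
  have pcs: "p v \<in> coord_space K" for v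
    unfolding p_def q_def by (intro subspace_diff[OF subspace_coord_space] y(1) proj_in_coord_space)
  have p_close: "norm (p (\<phi> x) - k x) < 2 * \<eta>'" if x: "x \<in> W" "\<phi> x \<in> \<Omega>" for x
  proof -
    have "k x = proj K (k x)" using proj_id[OF k(2)] x(1) WM by auto
    then have "q (\<phi> x) - k x = proj K (q0 (\<phi> x) - k x)" by (simp add: q_def linear_diff[OF linear_proj])
    then have "norm (q (\<phi> x) - k x) \<le> norm (q0 (\<phi> x) - k x)" using norm_proj_le by metis
    also have "\<dots> < \<eta>'" using q0(2) x kk[OF x(1)] by (metis norm_minus_commute)
    finally have "norm (q (\<phi> x) - k x) < \<eta>'" .
    moreover have eq: "p (\<phi> x) - k x = (q (\<phi> x) - k x) - y" by (simp add: p_def)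
    ultimately show ?thesis unfolding eq using norm_triangle_ineq4[of "q (\<phi> x) - k x" y] y(2) by linarith
  qed
  define cut where "cut v = max 0 (min 1 (2 - \<rho> v / e))" for v
  have cutcont: "continuous_on X cut" for X unfolding cut_def by (intro continuous_intros \<rho>cont) (use e in simp)
  have cut01: "0 \<le> cut v" "cut v \<le> 1" for v by (simp_all add: cut_def)
  have cut0: "cut v = 0" if "2 * e \<le> \<rho> v" for v using that e by (simp add: cut_def field_simps)
  have cut1: "cut v = 1" if "\<rho> v \<le> e" for v using that e by (simp add: cut_def field_simps)
  define h' where "h' x = (if x \<in> W then k x + cut (\<phi> x) *\<^sub>R (p (\<phi> x) - k x) else k x)" for x
  define \<Phi> where "\<Phi> = {x \<in> fst c. snd c x \<in> \<Omega>}"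
  have \<Phi>cl: "closedin M \<Phi>"
    unfolding \<Phi>_def by (rule compactin_chart_preimage(2)[OF c \<Omega>]) (use \<Omega>W \<phi>WU in blast)
  have \<Phi>W: "x \<in> \<Phi> \<longleftrightarrow> x \<in> W \<and> \<phi> x \<in> \<Omega>" for x
  proof
    assume x: "x \<in> \<Phi>"
    then obtain y where "y \<in> W" "\<phi> x = \<phi> y" using \<Omega>W by (auto simp: \<Phi>_def \<phi>_def)
    then have "x = y" using inj_onD[OF chart_inj[OF c], of x y] x W(2) by (auto simp: \<Phi>_def \<phi>_def)
    then show "x \<in> W \<and> \<phi> x \<in> \<Omega>" using x \<open>y \<in> W\<close> by (auto simp: \<Phi>_def \<phi>_def)
  qed (use W(2) in \<open>auto simp: \<Phi>_def \<phi>_def\<close>)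
  have C\<Phi>: "C \<subseteq> \<Phi>"
  proof
    fix x assume x: "x \<in> C"
    then have "\<phi> x \<in> C0" by (simp add: C0_def)
    then show "x \<in> \<Phi>" using x C(2) \<rho>C0 e C0P by (auto simp: \<Phi>W \<Omega>_def)
  qed
  have off: "h' x = k x" "k x = h x" if "x \<in> topspace M" "x \<notin> \<Phi>" for x
  proof -
    show "k x = h x" using eq that C\<Phi> by blast
    show "h' x = k x"
    proof (cases "x \<in> W")
      case True
      then have "\<not> \<rho> (\<phi> x) \<le> 2 * e" using that(2) \<phi>P[OF True] by (auto simp: \<Phi>W \<Omega>_def)
      then have "cut (\<phi> x) = 0" by (intro cut0) simp
      then show ?thesis by (simp add: h'_def)
    qed (simp add: h'_def)
  qed
  have close: "norm (h' x - k x) < 2 * \<eta>'" if "x \<in> topspace M" for x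
  proof (cases "x \<in> \<Phi>")
    case True
    then have x: "x \<in> W" "\<phi> x \<in> \<Omega>" by (auto simp: \<Phi>W)
    have "norm (h' x - k x) = cut (\<phi> x) * norm (p (\<phi> x) - k x)" using x cut01 by (simp add: h'_def)
    also have "\<dots> \<le> 1 * norm (p (\<phi> x) - k x)" by (rule mult_right_mono[OF cut01(2)]) simp
    also have "\<dots> < 2 * \<eta>'" using p_close[OF x] by simp
    finally show ?thesis .
  next
    case False
    then show ?thesis using off[OF that] \<eta>' by simp
  qed
  have h'cs: "h' x \<in> coord_space K" if "x \<in> topspace M" for x
    unfolding h'_def using k(2)[OF that] pcs
    by (auto intro!: subspace_add[OF subspace_coord_space] subspace_scale[OF subspace_coord_space]
        subspace_diff[OF subspace_coord_space])
  have h'cont: "continuous_map M euclidean h'"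
  proof (rule pasting_lemma[where I = "{True, False}" and T = "\<lambda>b. if b then W else topspace M - \<Phi>"
        and f = "\<lambda>b. if b then (\<lambda>x. k x + cut (\<phi> x) *\<^sub>R (p (\<phi> x) - k x)) else k"])
    show "openin M (if b then W else topspace M - \<Phi>)" for b using W(1) \<Phi>cl by auto
    have "continuous_map (subtopology M W) euclidean \<phi>"
      unfolding \<phi>_def by (rule continuous_map_from_subtopology_mono[OF continuous_map_chart[OF c] W(2)])
    then have "continuous_map (subtopology M W) euclidean (\<lambda>x. cut (\<phi> x))"
      "continuous_map (subtopology M W) euclidean (\<lambda>x. p (\<phi> x))"
      using continuous_map_compose[of _ euclidean \<phi> euclidean cut]
        continuous_map_compose[of _ euclidean \<phi> euclidean p] cutcont pcont by (simp_all add: o_def)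
    then show "continuous_map (subtopology M (if b then W else topspace M - \<Phi>)) euclidean
        (if b then (\<lambda>x. k x + cut (\<phi> x) *\<^sub>R (p (\<phi> x) - k x)) else k)" for b
      using continuous_map_from_subtopology[OF k(1)]
      by (auto intro!: continuous_map_add continuous_map_scaleR continuous_map_diff)
    show "\<exists>j. j \<in> {True, False} \<and> x \<in> (if j then W else topspace M - \<Phi>) \<and>
        h' x = (if j then (\<lambda>x. k x + cut (\<phi> x) *\<^sub>R (p (\<phi> x) - k x)) else k) x" if "x \<in> topspace M" for x
      using that by (cases "x \<in> W") (auto simp: h'_def \<Phi>W intro: exI[of _ True] exI[of _ False])
    show "(if i then (\<lambda>x. k x + cut (\<phi> x) *\<^sub>R (p (\<phi> x) - k x)) else k) x =
        (if j then (\<lambda>x. k x + cut (\<phi> x) *\<^sub>R (p (\<phi> x) - k x)) else k) x"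
      if "x \<in> topspace M \<inter> (if i then W else topspace M - \<Phi>) \<inter> (if j then W else topspace M - \<Phi>)" for i j x
      using that off[of x] by (auto simp: h'_def split: if_splits)
  qed
  have h'bd: "(1 - t) *\<^sub>R h x + t *\<^sub>R h' x \<noteq> 0" if x: "x \<in> bdry" and t: "0 \<le> t" "t \<le> 1" for x t
  proof
    assume 0: "(1 - t) *\<^sub>R h x + t *\<^sub>R h' x = 0"
    have "(1 - t) *\<^sub>R h x + t *\<^sub>R k x = ((1 - t) *\<^sub>R h x + t *\<^sub>R h' x) - t *\<^sub>R (h' x - k x)"
      by (simp add: algebra_simps)
    then have "norm ((1 - t) *\<^sub>R h x + t *\<^sub>R k x) = t * norm (h' x - k x)" using t by (simp add: 0)
    also have "\<dots> \<le> 1 * norm (h' x - k x)" by (rule mult_right_mono[OF t(2)]) simp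
    also have "\<dots> < \<kappa>" using close[of x] x bdry_subset \<eta>'(3) \<mu>(2) by auto
    finally show False using bd[OF x t] by simp
  qed
  \<comment> \<open>Zeros of the new map in \<open>W\<close> lie where the cutoff is 1. There the
    map is locally the polynomial \<open>p\<close>, to which the choice of \<open>y\<close> as a
    regular value applies.\<close>
  have zero_W: "\<phi> x \<in> \<Omega> \<and> \<rho> (\<phi> x) < e \<and> p (\<phi> x) = 0" if x: "x \<in> W" "h' x = 0" for x
  proof -
    have xM: "x \<in> topspace M" using x(1) WM by blast
    have in\<Phi>: "x \<in> \<Phi>"
    proof (rule ccontr)
      assume n: "x \<notin> \<Phi>"
      then have "h x = 0" using off[OF xM] x(2) by simp
      then have "\<phi> x \<in> C0" using x(1) xM by (simp add: C0_def Zc_def zeros_def)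
      then show False using n x(1) \<rho>C0 e C0P by (auto simp: \<Phi>W \<Omega>_def)
    qed
    have "\<rho> (\<phi> x) < e"
    proof (rule ccontr)
      assume "\<not> \<rho> (\<phi> x) < e"
      then have "\<phi> x \<in> An" using in\<Phi> by (simp add: An_def \<Phi>W)
      then have "\<mu> \<le> norm (k x)" using \<mu>1(2) \<mu>(3) kk[OF x(1)] by fastforce
      then show False using close[OF xM] x(2) \<eta>'(3) by simp
    qed
    moreover from this have "cut (\<phi> x) = 1" by (intro cut1) simp
    ultimately show ?thesis using in\<Phi> x by (simp add: h'_def \<Phi>W)
  qed
  \<comment> \<open>Width 1 in the added coordinates is arbitrary and serves to make
    \<open>D\<close> bounded: completed maps vanish only on the coordinate space itself. Removing
    \<open>B\<close> makes \<open>D\<close> open; its points are boundary points, at which the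
    homotopy has no zeros.\<close>
  define D where "D = {v. proj K v \<in> P - B} \<inter> {v. \<rho> (proj K v) < 2 * e} \<inter> {v. norm (v - proj K v) < 1}"
  have op1: "open {v. \<rho> (proj K v) < r}" for r
    by (intro open_Collect_less continuous_on_const continuous_on_compose2[OF \<rho>cont[of UNIV]] continuous_intros) auto
  have D_open: "open D"
    unfolding D_def by (intro open_Int PB op1 open_Collect_less continuous_intros)
  have regW: "regular_zero c h' x (stab K (Q (\<phi> x)))" if x: "x \<in> W" "h' x = 0" for x
  proof -
    note z = zero_W[OF x]
    have xb: "x \<notin> bdry" using h'bd[of x 1] x(2) by auto
    have cs: "\<phi> x \<in> coord_space K" by (rule \<phi>cs[OF x(1)])
    have pj: "proj K (\<phi> x) = \<phi> x" by (rule proj_id[OF cs])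
    have "((\<lambda>v. p (proj K v)) has_derivative (\<lambda>u. Q (\<phi> x) (proj K u))) (at (\<phi> x))"
    proof (rule has_derivative_compose_proj[OF _ cs zero_less_one])
      show "(p has_derivative Q (\<phi> x)) (at (\<phi> x) within UNIV)"
        unfolding p_def using has_derivative_diff[OF Q[of "\<phi> x"] has_derivative_const[of y]] by simp
    qed simp
    then have "(stab K p has_derivative stab K (Q (\<phi> x))) (at (\<phi> x))" by (rule has_derivative_stab)
    then have "(stab K (in_chart c h') has_derivative stab K (Q (\<phi> x))) (at (\<phi> x))"
    proof (rule has_derivative_transform_within_open)
      show "open ({v. proj K v \<in> P - B} \<inter> {v. \<rho> (proj K v) < e})" by (intro open_Int PB op1)
      show "\<phi> x \<in> {v. proj K v \<in> P - B} \<inter> {v. \<rho> (proj K v) < e}"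
        using z B_bdry[OF x(1)] xb by (auto simp: pj \<Omega>_def)
      fix v assume v: "v \<in> {v. proj K v \<in> P - B} \<inter> {v. \<rho> (proj K v) < e}"
      then have "proj K v \<in> \<Omega>" using e by (auto simp: \<Omega>_def)
      then obtain w where w: "w \<in> W" "proj K v = \<phi> w" using \<Omega>W by blast
      then have "cut (\<phi> w) = 1" using v by (intro cut1) auto
      then have "h' w = p (\<phi> w)" using w(1) by (simp add: h'_def)
      moreover have "in_chart c h' (\<phi> w) = h' w" using in_chart_apply[OF c] w(1) W(2) by (auto simp: \<phi>_def)
      ultimately show "stab K p v = stab K (in_chart c h') v" by (simp add: stab_def w(2))
    qed
    moreover have "det (matrix (stab K (Q (\<phi> x)))) \<noteq> 0"
      using y(3) cs z by (simp add: p_def)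
    ultimately show ?thesis by (simp add: regular_zero_def \<phi>_def)
  qed
  define s' where "s' x = (if x \<in> W then \<epsilon> * sgn (det (matrix (stab K (Q (\<phi> x))))) else s x)" for x
  have g': "good h' s'"
    unfolding good_def
  proof (intro conjI ballI impI)
    show "h' ` topspace M \<subseteq> coord_space K" using h'cs by blast
    show "h' x \<noteq> 0" if "x \<in> bdry" for x using h'bd[OF that, of 1] by simp
    fix x assume x: "x \<in> topspace M" "h' x = 0"
    show "\<exists>c\<in>A. x \<in> fst c \<and> (\<exists>D. regular_zero c h' x D \<and> s' x = ori c x * sgn (det (matrix D)))"
    proof (cases "x \<in> W")
      case True
      then show ?thesis using regW[OF True x(2)] \<epsilon>[OF True] c W(2) by (auto simp: s'_def)
    next
      case False
      then have n: "x \<notin> \<Phi>" by (simp add: \<Phi>W)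
      then have hx: "h x = 0" using off[OF x(1)] x(2) by simp
      then obtain c1 D1 where c1: "c1 \<in> A" "x \<in> fst c1" "regular_zero c1 h x D1" "s x = ori c1 x * sgn (det (matrix D1))"
        using g x(1) unfolding good_def by blast
      have "regular_zero c1 h' x D1"
      proof (rule regular_zero_cong[OF c1(1) _ _ c1(2) _ _ c1(3)])
        show "openin M (topspace M - \<Phi>)" using \<Phi>cl by blast
        show "h y = h' y" if "y \<in> topspace M - \<Phi>" for y using off[of y] that by simp
        show "x \<in> topspace M - \<Phi>" using x(1) n by blast
        show "x \<notin> bdry" using hx hb by blast
      qed
      then show ?thesis using c1 False by (auto simp: s'_def)
    qed
  qed (rule h'cont)
  have finZ': "finite (zeros h')" by (rule finite_zeros[OF g'])
  have clD: "closure D \<subseteq> {v. proj K v \<in> \<Omega>} \<inter> {v. norm (v - proj K v) \<le> 1}"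
  proof (rule closure_minimal)
    show "D \<subseteq> {v. proj K v \<in> \<Omega>} \<inter> {v. norm (v - proj K v) \<le> 1}" by (auto simp: D_def \<Omega>_def)
    have "closed (proj K -` \<Omega>)"
      by (rule closed_vimage[OF compact_imp_closed[OF \<Omega>] linear_continuous_on[OF bounded_linear_proj]])
    moreover have "closed {v. norm (v - proj K v) \<le> 1}" by (intro closed_Collect_le continuous_intros)
    ultimately show "closed ({v. proj K v \<in> \<Omega>} \<inter> {v. norm (v - proj K v) \<le> 1})"
      by (simp add: vimage_def closed_Int)
  qed
  have D_bdd: "bounded D"
  proof -
    obtain r where r: "\<forall>v\<in>\<Omega>. norm v \<le> r" using compact_imp_bounded[OF \<Omega>] by (auto simp: bounded_iff)
    have "norm v \<le> r + 1" if "v \<in> D" for v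
    proof -
      have "proj K v \<in> \<Omega>" "norm (v - proj K v) \<le> 1" using that clD closure_subset by blast+
      then show ?thesis using r norm_triangle_ineq[of "proj K v" "v - proj K v"] by fastforce
    qed
    then show ?thesis by (auto simp: bounded_iff)
  qed
  define hh' where "hh' = in_chart c h'"
  have hh': "hh' (\<phi> x) = h' x" if "x \<in> W" for x
    using in_chart_apply[OF c] that W(2) by (auto simp: hh'_def \<phi>_def)
  have hh'_cont: "continuous_on \<Omega> hh'"
    unfolding hh'_def by (rule continuous_on_subset[OF continuous_on_in_chart[OF c h'cont]]) (use \<Omega>W \<phi>WU in blast)
  have stab_cont: "continuous_on (closure D) (stab K F)" if "continuous_on \<Omega> F" for F
    unfolding stab_def
    by (intro continuous_intros continuous_on_compose2[OF that]) (use clD in auto)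
  have stab0: "\<exists>x\<in>W. v = \<phi> x \<and> (1 - t) *\<^sub>R h x + t *\<^sub>R h' x = 0"
    if v: "v \<in> closure D" and z: "(1 - t) *\<^sub>R stab K hh v + t *\<^sub>R stab K hh' v = 0" for v t
  proof -
    obtain x where x: "x \<in> W" "proj K v = \<phi> x" using v clD \<Omega>W by blast
    have z': "stab K (\<lambda>w. (1 - t) *\<^sub>R hh w + t *\<^sub>R hh' w) v = 0" using z by (simp add: stab_convex_comb)
    have "(1 - t) *\<^sub>R hh (proj K v) + t *\<^sub>R hh' (proj K v) \<in> coord_space K"
      unfolding x(2) hh[OF x(1)] hh'[OF x(1)] using hcs h'cs x(1) WM
      by (intro subspace_add[OF subspace_coord_space] subspace_scale[OF subspace_coord_space]) auto
    from stab_eq_0D[of K "\<lambda>w. (1 - t) *\<^sub>R hh w + t *\<^sub>R hh' w" v, OF z' this] show ?thesis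
      using x hh[OF x(1)] hh'[OF x(1)] by auto
  qed
  have zeroD0: "{v \<in> D. stab K hh v = 0} = \<phi> ` Zc"
  proof (intro equalityI subsetI)
    fix v assume v: "v \<in> {v \<in> D. stab K hh v = 0}"
    then have "v \<in> closure D" using closure_subset by blast
    then obtain x where "x \<in> W" "v = \<phi> x" "h x = 0" using stab0[of v 0] v by auto
    then show "v \<in> \<phi> ` Zc" using WM by (auto simp: Zc_def zeros_def)
  next
    fix v assume "v \<in> \<phi> ` Zc"
    then obtain x where x: "x \<in> W" "h x = 0" "v = \<phi> x" by (auto simp: Zc_def zeros_def)
    have "x \<notin> bdry" using hb x by blast
    then have "\<phi> x \<notin> B" using B_bdry x by blast
    moreover have "\<phi> x \<in> C0" using \<open>v \<in> \<phi> ` Zc\<close> x by (auto simp: C0_def)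
    then have "\<rho> (\<phi> x) = 0" by (rule \<rho>C0)
    ultimately show "v \<in> {v \<in> D. stab K hh v = 0}"
      using x e by (simp add: D_def proj_id[OF \<phi>cs] \<phi>P stab_on_coord_space[OF \<phi>cs] hh)
  qed
  define Zc' where "Zc' = zeros h' \<inter> W"
  have zeroD1: "{v \<in> D. stab K hh' v = 0} = \<phi> ` Zc'"
  proof (intro equalityI subsetI)
    fix v assume v: "v \<in> {v \<in> D. stab K hh' v = 0}"
    then have "v \<in> closure D" using closure_subset by blast
    then obtain x where "x \<in> W" "v = \<phi> x" "h' x = 0" using stab0[of v 1] v by auto
    then show "v \<in> \<phi> ` Zc'" using WM by (auto simp: Zc'_def zeros_def)
  next
    fix v assume "v \<in> \<phi> ` Zc'"
    then obtain x where x: "x \<in> W" "h' x = 0" "v = \<phi> x" by (auto simp: Zc'_def zeros_def)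
    have "x \<notin> bdry" using h'bd[of x 1] x by auto
    then have "\<phi> x \<notin> B" using B_bdry x by blast
    moreover have "\<rho> (\<phi> x) < 2 * e" using zero_W[OF x(1,2)] e by simp
    ultimately show "v \<in> {v \<in> D. stab K hh' v = 0}"
      using x by (simp add: D_def proj_id[OF \<phi>cs] \<phi>P stab_on_coord_space[OF \<phi>cs] hh')
  qed
  have "\<forall>x\<in>Zc. \<exists>D0. regular_zero c h x D0 \<and> s x = ori c x * sgn (det (matrix D0))"
  proof
    fix x assume x: "x \<in> Zc"
    show "\<exists>D0. regular_zero c h x D0 \<and> s x = ori c x * sgn (det (matrix D0))"
      by (rule good_regular[OF g c, of x]) (use x W(2) in \<open>auto simp: Zc_def zeros_def\<close>)
  qed
  from bchoice[OF this] obtain D0 where D0: "\<forall>x\<in>Zc. regular_zero c h x (D0 x) \<and> s x = ori c x * sgn (det (matrix (D0 x)))"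
    ..
  define \<psi> where "\<psi> v = (SOME x. x \<in> W \<and> \<phi> x = v)" for v
  have \<psi>: "\<psi> (\<phi> x) = x" if "x \<in> W" for x
    unfolding \<psi>_def by (rule some_equality) (use that inj in auto)
  have injW: "inj_on \<phi> X" if "X \<subseteq> W" for X using inj that by (intro inj_onI) blast
  have count: "(\<Sum>z | z \<in> D \<and> stab K hh z = 0. sgn (det (matrix (D0 (\<psi> z)))))
     = (\<Sum>z | z \<in> D \<and> stab K hh' z = 0. sgn (det (matrix (stab K (Q z)))))"
  proof (rule zero_count_homotopy[OF D_open D_bdd stab_cont[OF hh_cont] stab_cont[OF hh'_cont]])
    show "finite {x \<in> D. stab K hh x = 0}" unfolding zeroD0 Zc_def using finZ by blast
    show "finite {x \<in> D. stab K hh' x = 0}" unfolding zeroD1 Zc'_def using finZ' by blast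
    show "(stab K hh has_derivative D0 (\<psi> z)) (at z)" "det (matrix (D0 (\<psi> z))) \<noteq> 0"
      if "z \<in> D" "stab K hh z = 0" for z
    proof -
      have "z \<in> \<phi> ` Zc" unfolding zeroD0[symmetric] using that by simp
      then obtain x where x: "z = \<phi> x" "x \<in> Zc" by (rule imageE)
      have \<psi>z: "\<psi> z = x" unfolding x(1) by (rule \<psi>) (use x(2) in \<open>simp add: Zc_def\<close>)
      have "regular_zero c h x (D0 x)" using D0 x(2) by blast
      then show "(stab K hh has_derivative D0 (\<psi> z)) (at z)" "det (matrix (D0 (\<psi> z))) \<noteq> 0"
        unfolding \<psi>z unfolding regular_zero_def hh_def x(1) \<phi>_def by (rule conjunct1, rule conjunct2)
    qed
    show "(stab K hh' has_derivative stab K (Q z)) (at z)" "det (matrix (stab K (Q z))) \<noteq> 0"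
      if "z \<in> D" "stab K hh' z = 0" for z
    proof -
      have "z \<in> \<phi> ` Zc'" unfolding zeroD1[symmetric] using that by simp
      then obtain x where x: "z = \<phi> x" "x \<in> Zc'" by (rule imageE)
      have "regular_zero c h' x (stab K (Q (\<phi> x)))"
        by (rule regW) (use x(2) in \<open>simp_all add: Zc'_def zeros_def\<close>)
      then show "(stab K hh' has_derivative stab K (Q z)) (at z)" "det (matrix (stab K (Q z))) \<noteq> 0"
        unfolding regular_zero_def hh'_def x(1) \<phi>_def by (rule conjunct1, rule conjunct2)
    qed
    \<comment> \<open>A zero on the frontier has vanishing added coordinates and lies off
      \<open>B\<close>, so it can have left \<open>D\<close> only by being at distance at least
      \<open>2 * e\<close> from \<open>C0\<close>. There the cutoff is 0, and the homotopy is
      constantly the nonzero value of \<open>h\<close>.\<close>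
    fix v and t :: real assume v: "v \<in> frontier D" and t: "0 \<le> t" "t \<le> 1"
    show "(1 - t) *\<^sub>R stab K hh v + t *\<^sub>R stab K hh' v \<noteq> 0"
    proof
      assume 0: "(1 - t) *\<^sub>R stab K hh v + t *\<^sub>R stab K hh' v = 0"
      have vc: "v \<in> closure D" "v \<notin> D" using v D_open by (auto simp: frontier_def interior_open)
      obtain x where x: "x \<in> W" "v = \<phi> x" and z: "(1 - t) *\<^sub>R h x + t *\<^sub>R h' x = 0"
        using stab0[OF vc(1) 0] by blast
      have pv: "proj K v = v" unfolding x(2) by (rule proj_id[OF \<phi>cs[OF x(1)]])
      have "x \<notin> bdry" using h'bd[OF _ t, of x] z by argo
      then have "v \<notin> B" using B_bdry[OF x(1)] x(2) by argo
      then have "\<not> \<rho> v < 2 * e" using vc(2) \<phi>P[OF x(1)] by (simp add: D_def pv x(2)[symmetric])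
      moreover have v\<Omega>: "v \<in> \<Omega>" using clD vc(1) pv by auto
      ultimately have "v \<in> An" and "cut v = 0" using e cut0[of v] by (auto simp: An_def)
      then have "h' x = k x" "k x = h x" "k x \<noteq> 0" using AnW[OF x(1)] x by (auto simp: h'_def)
      then have "(1 - t) *\<^sub>R h x + t *\<^sub>R h' x = h x" by (simp add: algebra_simps)
      then show False using z \<open>k x = h x\<close> \<open>k x \<noteq> 0\<close> by simp
    qed
  qed
  have "sum s Zc = \<epsilon> * (\<Sum>z | z \<in> D \<and> stab K hh z = 0. sgn (det (matrix (D0 (\<psi> z)))))"
  proof -
    have "(\<Sum>z | z \<in> D \<and> stab K hh z = 0. sgn (det (matrix (D0 (\<psi> z))))) = (\<Sum>x\<in>Zc. sgn (det (matrix (D0 x))))"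
      unfolding zeroD0 by (subst sum.reindex[OF injW]) (auto simp: Zc_def \<psi> intro!: sum.cong)
    moreover have "sum s Zc = (\<Sum>x\<in>Zc. \<epsilon> * sgn (det (matrix (D0 x))))"
      by (rule sum.cong[OF refl]) (use D0 \<epsilon> in \<open>auto simp: Zc_def\<close>)
    ultimately show ?thesis by (simp add: sum_distrib_left)
  qed
  moreover have "sum s' Zc' = \<epsilon> * (\<Sum>z | z \<in> D \<and> stab K hh' z = 0. sgn (det (matrix (stab K (Q z)))))"
  proof -
    have "(\<Sum>z | z \<in> D \<and> stab K hh' z = 0. sgn (det (matrix (stab K (Q z))))) = (\<Sum>x\<in>Zc'. sgn (det (matrix (stab K (Q (\<phi> x))))))"
      unfolding zeroD1 by (subst sum.reindex[OF injW]) (auto simp: Zc'_def)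
    moreover have "sum s' Zc' = (\<Sum>x\<in>Zc'. \<epsilon> * sgn (det (matrix (stab K (Q (\<phi> x))))))"
      by (rule sum.cong[OF refl]) (auto simp: Zc'_def s'_def)
    ultimately show ?thesis by (simp add: sum_distrib_left)
  qed
  ultimately have W_eq: "sum s' Zc' = sum s Zc" using count by simp
  have "h' x = h x" if "x \<in> topspace M" "x \<notin> W" for x
    using off[OF that(1)] that(2) by (simp add: \<Phi>W)
  then have "zeros h' - W = zeros h - W" by (auto simp: zeros_def)
  moreover have "sum s' (zeros h' - W) = sum s (zeros h' - W)"
    by (rule sum.cong[OF refl]) (simp add: s'_def)
  ultimately have "sum s' (zeros h' - W) = sum s (zeros h - W)" by simp
  moreover have "sum s' (zeros h') = sum s' Zc' + sum s' (zeros h' - W)"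
    unfolding Zc'_def by (rule sum.Int_Diff[OF finZ'])
  moreover have "sum s (zeros h) = sum s Zc + sum s (zeros h - W)"
    unfolding Zc_def by (rule sum.Int_Diff[OF finZ])
  ultimately have "sum s' (zeros h') = sum s (zeros h)" using W_eq by simp
  moreover have "norm (h' x - k x) < \<eta>" if "x \<in> topspace M" for x
    using close[OF that] \<eta>'(2) by simp
  ultimately show ?thesis using g' by blast
qed

section \<open>Homotopies on the manifold\<close>

text \<open>When \<tau> has reached 1 everywhere, a good map with the original signed count
  approximates \<open>h1\<close> more closely than the minimum of its norm, and so has no zeros at
  all.\<close>

lemma nonvanishing_homotopy_zero_sum:
  assumes g: "good h0 s0" and h1: "continuous_map M euclidean h1" "\<And>x. x \<in> topspace M \<Longrightarrow> h1 x \<in> coord_space K"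
    and nz: "\<And>x. x \<in> topspace M \<Longrightarrow> h1 x \<noteq> 0"
    and \<mu>: "0 < \<mu>" and bd: "\<And>x t. x \<in> bdry \<Longrightarrow> 0 \<le> t \<Longrightarrow> t \<le> 1 \<Longrightarrow> \<mu> \<le> norm ((1 - t) *\<^sub>R h0 x + t *\<^sub>R h1 x)"
  shows "sum s0 (zeros h0) = 0"
proof -
  have h0: "continuous_map M euclidean h0" "\<And>x. x \<in> topspace M \<Longrightarrow> h0 x \<in> coord_space K"
    using g by (auto simp: good_def)
  define H where "H \<tau> x = (1 - \<tau> x) *\<^sub>R h0 x + \<tau> x *\<^sub>R h1 x" for \<tau> :: "'a \<Rightarrow> real" and x
  have Hcont: "continuous_map M euclidean (H \<tau>)" if "continuous_map M euclideanreal \<tau>" for \<tau>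
    unfolding H_def
    by (intro continuous_map_add continuous_map_scaleR continuous_map_diff h0 h1 that) simp
  have Hcs: "H \<tau> x \<in> coord_space K" if "x \<in> topspace M" for \<tau> x
    unfolding H_def
    by (intro subspace_add[OF subspace_coord_space] subspace_scale[OF subspace_coord_space] h0 h1 that)
  \<comment> \<open>The map \<open>H \<tau>\<close> itself may have degenerate zeros. So reaching it
    means approximating it, to every precision, by good maps with the original count.\<close>
  define reach where "reach \<tau> \<longleftrightarrow> continuous_map M euclideanreal \<tau> \<and> (\<forall>x\<in>topspace M. 0 \<le> \<tau> x \<and> \<tau> x \<le> 1) \<and>
     (\<forall>\<eta>>0. \<exists>h s. good h s \<and> (\<forall>x\<in>topspace M. norm (h x - H \<tau> x) < \<eta>) \<and> sum s (zeros h) = sum s0 (zeros h0))" for \<tau>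
  have reach_max: "reach (\<lambda>x. max (\<tau> x) (u x))"
    if \<tau>: "reach \<tau>" and u: "continuous_map M euclideanreal u" "\<And>x. x \<in> topspace M \<Longrightarrow> 0 \<le> u x \<and> u x \<le> 1"
      and c: "c \<in> A" and W: "openin M W" "W \<subseteq> fst c" and \<epsilon>: "\<And>x. x \<in> W \<Longrightarrow> real_of_int (ori c x) = \<epsilon>"
      and C: "compactin M C" "C \<subseteq> W" and u0: "\<And>x. x \<in> topspace M \<Longrightarrow> x \<notin> C \<Longrightarrow> u x = 0"
    for \<tau> u c W \<epsilon> C
  proof -
    define \<sigma> where "\<sigma> x = max (\<tau> x) (u x)" for x
    have \<tau>01: "0 \<le> \<tau> x" "\<tau> x \<le> 1" if "x \<in> topspace M" for x using \<tau> that by (auto simp: reach_def)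
    have \<tau>c: "continuous_map M euclideanreal \<tau>" using \<tau> by (simp add: reach_def)
    have \<sigma>c: "continuous_map M euclideanreal \<sigma>"
      unfolding \<sigma>_def by (intro continuous_map_real_max \<tau>c u(1))
    have \<sigma>01: "0 \<le> \<sigma> x" "\<sigma> x \<le> 1" if "x \<in> topspace M" for x
      using \<tau>01[OF that] u(2)[OF that] by (auto simp: \<sigma>_def)
    have "\<exists>h s. good h s \<and> (\<forall>x\<in>topspace M. norm (h x - H \<sigma> x) < \<eta>) \<and> sum s (zeros h) = sum s0 (zeros h0)"
      if \<eta>: "0 < \<eta>" for \<eta>
    proof -
      have "0 < min (\<eta> / 2) (\<mu> / 2)" using \<eta> \<mu> by simp
      then obtain h s where h: "good h s" "sum s (zeros h) = sum s0 (zeros h0)"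
        and close: "\<And>x. x \<in> topspace M \<Longrightarrow> norm (h x - H \<tau> x) < min (\<eta> / 2) (\<mu> / 2)"
        using \<tau> unfolding reach_def by blast
      have hc: "continuous_map M euclidean h" "\<And>x. x \<in> topspace M \<Longrightarrow> h x \<in> coord_space K"
        using h(1) by (auto simp: good_def)
      \<comment> \<open>The increment is added to the approximating map \<open>h\<close> rather than
        aiming at \<open>H \<sigma>\<close> itself. Thus \<open>k\<close> equals \<open>h\<close>
        exactly outside \<open>C\<close>, while the error of \<open>h\<close> is carried along
        unchanged.\<close>
      define k where "k x = h x + (H \<sigma> x - H \<tau> x)" for x
      have "\<exists>h' s'. good h' s' \<and> (\<forall>x\<in>topspace M. norm (h' x - k x) < \<eta> / 2) \<and> sum s' (zeros h') = sum s (zeros h)"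
      proof (rule chart_step[OF h(1) c W \<epsilon> _ _ C, where \<kappa> = "\<mu> / 2"])
        show "continuous_map M euclidean k"
          unfolding k_def by (intro continuous_map_add continuous_map_diff Hcont hc \<sigma>c \<tau>c)
        show "k x \<in> coord_space K" if "x \<in> topspace M" for x
          unfolding k_def by (intro subspace_add[OF subspace_coord_space] subspace_diff[OF subspace_coord_space] Hcs hc that)
        show "k x = h x" if "x \<in> topspace M" "x \<notin> C" for x
          using u0[OF that] \<tau>01[OF that(1)] by (simp add: k_def H_def \<sigma>_def)
        show "\<mu> / 2 \<le> norm ((1 - t) *\<^sub>R h x + t *\<^sub>R k x)" if x: "x \<in> bdry" and t: "0 \<le> t" "t \<le> 1" for x t
        proof -
          have xM: "x \<in> topspace M" using x bdry_subset by blast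
          \<comment> \<open>The stage from \<open>h\<close> to \<open>k\<close> passes through the
            point with parameter \<open>r\<close> of the original segment, shifted by the error
            \<open>h x - H \<tau> x\<close>. That error is below half of \<mu>, which leaves the
            other half as the bound for the stage.\<close>
          define r where "r = (1 - t) * \<tau> x + t * \<sigma> x"
          have "0 \<le> r" unfolding r_def using t \<tau>01[OF xM] \<sigma>01[OF xM] by simp
          moreover have "r \<le> (1 - t) * 1 + t * 1"
            unfolding r_def using t \<tau>01[OF xM] \<sigma>01[OF xM] by (intro add_mono mult_left_mono) auto
          ultimately have "\<mu> \<le> norm ((1 - r) *\<^sub>R h0 x + r *\<^sub>R h1 x)" using bd[OF x] by simp
          moreover have "(1 - t) *\<^sub>R h x + t *\<^sub>R k x = ((1 - r) *\<^sub>R h0 x + r *\<^sub>R h1 x) + (h x - H \<tau> x)"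
            by (simp add: k_def H_def r_def algebra_simps)
          ultimately show ?thesis
            using close[OF xM] norm_diff_ineq[of "(1 - r) *\<^sub>R h0 x + r *\<^sub>R h1 x" "h x - H \<tau> x"] by simp
        qed
      qed (use \<mu> \<eta> in auto)
      then obtain h' s' where h': "good h' s'" "\<And>x. x \<in> topspace M \<Longrightarrow> norm (h' x - k x) < \<eta> / 2"
        "sum s' (zeros h') = sum s (zeros h)" by blast
      have "norm (h' x - H \<sigma> x) < \<eta>" if "x \<in> topspace M" for x
      proof -
        have eq: "h' x - H \<sigma> x = (h' x - k x) + (h x - H \<tau> x)" by (simp add: k_def)
        show ?thesis
          unfolding eq using h'(2)[OF that] close[OF that] norm_triangle_ineq[of "h' x - k x" "h x - H \<tau> x"]
          unfolding min_less_iff_conj by linarith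
      qed
      then show ?thesis using h' h(2) by auto
    qed
    then show ?thesis using \<sigma>c \<sigma>01 unfolding reach_def \<sigma>_def by blast
  qed
  have normal: "normal_space M"
    using compact_M Hausdorff_M compact_Hausdorff_or_regular_imp_normal_space by blast
  let ?U = "{V. openin M V \<and> (\<exists>u. continuous_map M euclideanreal u \<and> (\<forall>x\<in>topspace M. u x \<le> 1) \<and>
     (\<forall>x\<in>V. u x = 1) \<and> (\<forall>\<tau>. reach \<tau> \<longrightarrow> reach (\<lambda>x. max (\<tau> x) (u x))))}"
  have "topspace M \<subseteq> \<Union> ?U"
  proof
    fix x assume x: "x \<in> topspace M"
    obtain c where c: "c \<in> A" "x \<in> fst c" using charts_cover[OF x] by blast
    define W where "W = {y \<in> fst c. ori c y = ori c x}"
    have W: "openin M W" "W \<subseteq> fst c" unfolding W_def by (rule openin_ori[OF c(1)]) blast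
    have "closedin M (topspace M - W)" using W(1) by blast
    moreover have "closedin M {x}" using compactin_imp_closedin[OF Hausdorff_M] x by simp
    moreover have "disjnt (topspace M - W) {x}" using c by (simp add: W_def)
    ultimately obtain p where p: "continuous_map M (top_of_set {0..1::real}) p" "p ` (topspace M - W) \<subseteq> {0}" "p ` {x} \<subseteq> {1}"
      using Urysohn_lemma[OF normal, of "topspace M - W" "{x}" 0 1] by auto
    then have pc: "continuous_map M euclideanreal p" by (simp add: continuous_map_in_subtopology)
    \<comment> \<open>The truncation makes \<open>u\<close> equal to 1 where \<open>p\<close>
      exceeds 1/2, an open neighbourhood of \<open>x\<close>, and 0 where \<open>p\<close> is below
      1/4. Hence it vanishes outside the closed set \<open>C\<close>, which lies in
      \<open>W\<close>.\<close>
    define u where "u y = max 0 (min 1 (4 * p y - 1))" for y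
    define C where "C = {y \<in> topspace M. p y \<in> {1/4..}}"
    define V where "V = {y \<in> topspace M. p y \<in> {1/2<..}}"
    have V: "openin M V" unfolding V_def by (rule openin_continuous_map_preimage[OF pc]) simp
    have "closedin M C" unfolding C_def by (rule closedin_continuous_map_preimage[OF pc]) simp
    then have C: "compactin M C" using compact_M closedin_compact_space by blast
    have CW: "C \<subseteq> W" using p(2) by (force simp: C_def)
    have u: "continuous_map M euclideanreal u"
      unfolding u_def by (intro continuous_map_real_max continuous_map_real_min continuous_map_diff
          continuous_map_real_mult_left pc) simp_all
    have "reach (\<lambda>x. max (\<tau> x) (u x))" if "reach \<tau>" for \<tau>
    proof (rule reach_max[OF that u _ c(1) W _ C CW])
      show "u y = 0" if "y \<in> topspace M" "y \<notin> C" for y using that by (simp add: u_def C_def)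
      show "real_of_int (ori c y) = real_of_int (ori c x)" if "y \<in> W" for y using that by (simp add: W_def)
    qed (simp add: u_def)
    moreover have "x \<in> V" using x p(3) by (simp add: V_def)
    moreover have "\<forall>y\<in>V. u y = 1" by (simp add: V_def u_def)
    moreover have "\<forall>y\<in>topspace M. u y \<le> 1" by (simp add: u_def)
    ultimately show "x \<in> \<Union> ?U" using V u by blast
  qed
  moreover have "compactin M (topspace M)" using compact_M by (simp add: compact_space_def)
  ultimately obtain F where F: "finite F" "F \<subseteq> ?U" "topspace M \<subseteq> \<Union> F"
    using compactinD[of M "topspace M" ?U] by blast
  have "\<exists>\<tau>. reach \<tau> \<and> (\<forall>x\<in>topspace M \<inter> \<Union> F. \<tau> x = 1)"
    using F(1,2)
  proof (induction F)
    case empty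
    have "reach (\<lambda>x. 0)" unfolding reach_def H_def using g by (auto intro!: exI[of _ h0] exI[of _ s0])
    then show ?case by blast
  next
    case (insert V F)
    then obtain \<tau> where \<tau>: "reach \<tau>" "\<forall>x\<in>topspace M \<inter> \<Union> F. \<tau> x = 1" by auto
    obtain u where u: "\<forall>x\<in>topspace M. u x \<le> 1" "\<forall>x\<in>V. u x = 1" "reach (\<lambda>x. max (\<tau> x) (u x))"
      using insert.prems \<tau>(1) by blast
    have le: "\<forall>x\<in>topspace M. \<tau> x \<le> 1" using \<tau>(1) by (simp add: reach_def)
    have "\<forall>x\<in>topspace M \<inter> \<Union> (insert V F). max (\<tau> x) (u x) = 1"
    proof (intro ballI)
      fix x assume x: "x \<in> topspace M \<inter> \<Union> (insert V F)"
      show "max (\<tau> x) (u x) = 1"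
      proof (cases "x \<in> V")
        case True
        then show ?thesis using le u(2) x by (simp add: max_absorb2)
      next
        case False
        then have "\<tau> x = 1" using \<tau>(2) x by blast
        then show ?thesis using u(1) x by (simp add: max_absorb1)
      qed
    qed
    then show ?case using u(3) by blast
  qed
  then obtain \<tau> where \<tau>: "reach \<tau>" "\<And>x. x \<in> topspace M \<Longrightarrow> \<tau> x = 1" using F(3) by blast
  have "compact (h1 ` topspace M)"
    using image_compactin[OF _ h1(1), of "topspace M"] compact_M by (simp add: compact_space_def)
  moreover have "\<not> (\<exists>v\<in>h1 ` topspace M. v = 0)" using nz by blast
  ultimately obtain \<delta> where \<delta>: "0 < \<delta>" "\<forall>v\<in>h1 ` topspace M. \<delta> \<le> norm v"
    using brouwer_compactness_lemma[of "h1 ` topspace M" "\<lambda>v. v"] by (metis continuous_on_id)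
  obtain h s where h: "good h s" "\<forall>x\<in>topspace M. norm (h x - H \<tau> x) < \<delta>" "sum s (zeros h) = sum s0 (zeros h0)"
    using \<tau>(1) \<delta>(1) unfolding reach_def by blast
  have "zeros h = {}"
  proof -
    have "h x \<noteq> 0" if x: "x \<in> topspace M" for x
    proof
      assume "h x = 0"
      then have "norm (h1 x) < \<delta>" using h(2) x \<tau>(2)[OF x] by (auto simp: H_def)
      then show False using \<delta>(2) x by auto
    qed
    then show ?thesis by (auto simp: zeros_def)
  qed
  then show ?thesis using h(3) by simp
qed

end

section \<open>Maps into a convex set\<close>

lemma direction_spaceI: "x \<in> affine hull S \<Longrightarrow> y \<in> affine hull S \<Longrightarrow> x - y \<in> direction_space S"
  by (auto simp: direction_space_def)

lemma affine_hull_add_direction: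
  assumes "y \<in> affine hull S" and "w \<in> direction_space S"
  shows "y + w \<in> affine hull S"
proof -
  obtain p q where "p \<in> affine hull S" "q \<in> affine hull S" "w = p - q"
    using assms(2) by (auto simp: direction_space_def)
  then show ?thesis using mem_affine_3_minus[OF affine_affine_hull assms(1), of p q 1] by simp
qed

locale smooth_map_to_convex = oriented_manifold K M A ori
  for K :: "'n::finite set" and M :: "'a topology" and A :: "('a, 'n) chart set"
    and ori :: "('a, 'n) chart \<Rightarrow> 'a \<Rightarrow> int" +
  fixes \<Delta> :: "'b::euclidean_space set" and b :: "'n \<Rightarrow> 'b" and f :: "'a \<Rightarrow> 'b"
  assumes convex: "convex \<Delta>" and compact: "compact \<Delta>" and nonempty: "\<Delta> \<noteq> {}"
    and frame: "affine_frame K \<Delta> b"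
    and image: "\<And>x. x \<in> topspace M \<Longrightarrow> f x \<in> \<Delta>" and smooth: "smooth_map A f"
    and boundary: "\<And>x. x \<in> bdry \<Longrightarrow> f x \<in> rel_frontier \<Delta>"
begin

abbreviation dir :: "'b set" where "dir \<equiv> direction_space \<Delta>"

lemma inj_b: "inj_on b K" and indep_b: "independent (b ` K)" and span_b: "span (b ` K) = dir"
  using frame by (auto simp: affine_frame_def)

text \<open>Defined on the whole space in order to be a bounded linear map there; only its values on
  \<open>dir\<close>, where it inverts \<open>combine\<close>, are determined.\<close>

definition coords :: "'b \<Rightarrow> real^'n"
  where "coords = (SOME L. linear L \<and> (\<forall>i\<in>K. L (b i) = axis i 1))"

definition combine :: "real^'n \<Rightarrow> 'b"
  where "combine v = (\<Sum>i\<in>K. v $ i *\<^sub>R b i)"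

lemma coords_props: "linear coords \<and> (\<forall>i\<in>K. coords (b i) = axis i 1)"
proof -
  obtain L :: "'b \<Rightarrow> real^'n" where L: "linear L" "\<forall>w\<in>b ` K. L w = axis (inv_into K b w) 1"
    using linear_independent_extend[OF indep_b, of "\<lambda>w. axis (inv_into K b w) 1"] by (elim exE conjE)
  have "L (b i) = axis i 1" if "i \<in> K" for i
    using bspec[OF L(2) imageI[OF that]] unfolding inv_into_f_f[OF inj_b that] .
  with L(1) have "\<exists>L :: 'b \<Rightarrow> real^'n. linear L \<and> (\<forall>i\<in>K. L (b i) = axis i 1)" by (intro exI conjI ballI)
  from someI_ex[OF this] show ?thesis unfolding coords_def .
qed

lemma linear_coords: "linear coords" and coords_b: "i \<in> K \<Longrightarrow> coords (b i) = axis i 1"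
  using coords_props by auto

lemma bounded_linear_coords: "bounded_linear coords"
  by (rule linear_conv_bounded_linear[THEN iffD1, OF linear_coords])

lemma linear_combine: "linear combine"
  by (rule linearI) (simp_all add: combine_def scaleR_add_left sum.distrib scaleR_sum_right)

lemma combine_dir: "combine v \<in> dir"
  unfolding combine_def span_b[symmetric] by (intro span_sum span_scale span_base) auto

lemma coords_combine: "coords (combine v) = proj K v"
proof -
  have "coords (combine v) = (\<Sum>i\<in>K. v $ i *\<^sub>R axis i 1)"
    unfolding combine_def linear_sum[OF linear_coords] linear_scale[OF linear_coords]
    by (rule sum.cong) (simp_all add: coords_b)
  moreover have "(\<Sum>i\<in>K. v $ i *\<^sub>R axis i 1) $ j = proj K v $ j" for j
  proof -
    have "(\<Sum>i\<in>K. v $ i *\<^sub>R axis i 1) $ j = (\<Sum>i\<in>K. if i = j then v $ i else 0)"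
      unfolding sum_component by (rule sum.cong) (auto simp: axis_def)
    then show ?thesis by (simp add: proj_component)
  qed
  ultimately show ?thesis by (simp add: vec_eq_iff)
qed

lemma combine_axis: "i \<in> K \<Longrightarrow> combine (axis i 1) = b i"
proof -
  assume "i \<in> K"
  have "combine (axis i 1) = (\<Sum>j\<in>K. if j = i then b j else 0)"
    unfolding combine_def by (rule sum.cong) (auto simp: axis_def)
  then show ?thesis using \<open>i \<in> K\<close> by simp
qed

lemma combine_coords:
  assumes "w \<in> dir"
  shows "combine (coords w) = w"
proof -
  have "(\<lambda>w. combine (coords w)) w = (\<lambda>w. w) w"
  proof (rule linear_eq_on[of "\<lambda>w. combine (coords w)" "\<lambda>w. w" w "b ` K"])
    show "linear (\<lambda>w. combine (coords w))"
      using linear_compose[OF linear_coords linear_combine] by (simp add: o_def)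
    show "linear (\<lambda>w :: 'b. w)" by (rule linear_ident)
    show "w \<in> span (b ` K)" unfolding span_b by (rule assms)
    show "combine (coords v) = v" if v: "v \<in> b ` K" for v
    proof -
      obtain i where i: "v = b i" "i \<in> K" using v by (rule imageE)
      show ?thesis unfolding i(1) coords_b[OF i(2)] by (rule combine_axis[OF i(2)])
    qed
  qed
  then show ?thesis .
qed

lemma coords_dir:
  assumes "w \<in> dir"
  shows "coords w \<in> coord_space K"
  using coords_combine[of "coords w"] unfolding combine_coords[OF assms] proj_eq_iff[symmetric] by (rule sym)

lemma coords_eq_0_iff:
  assumes "w \<in> dir"
  shows "coords w = 0 \<longleftrightarrow> w = 0"
proof
  assume "coords w = 0"
  then have "combine (coords w) = combine 0" by (rule arg_cong)
  then show "w = 0" unfolding combine_coords[OF assms] linear_0[OF linear_combine] .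
qed (simp add: linear_0[OF linear_coords])

lemma subset_hull: "x \<in> \<Delta> \<Longrightarrow> x \<in> affine hull \<Delta>"
  by (rule hull_inc)

lemma chart_derivative_properties:
  assumes c: "c \<in> A" and x: "x \<in> fst c" "x \<notin> bdry"
  shows "((\<lambda>w. in_chart c f (proj K w)) has_derivative (\<lambda>u. chart_derivative c f x (proj K u))) (at (snd c x))"
    and "linear (chart_derivative c f x)"
    and "u \<in> coord_space K \<Longrightarrow> chart_derivative c f x u \<in> dir"
proof -
  let ?G = "chart_derivative c f x" and ?S = "snd c ` fst c"
  have sm: "smooth_on ?S (in_chart c f)" using smooth c by (simp add: smooth_map_def)
  have "\<exists>G. (in_chart c f has_derivative G) (at (snd c x) within ?S)"
    by (rule smooth_on_has_derivative[OF sm]) (use x(1) in blast)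
  then have "in_chart c f differentiable (at (snd c x) within ?S)" by (simp add: differentiable_def)
  then have G: "(in_chart c f has_derivative ?G) (at (snd c x) within ?S)"
    unfolding chart_derivative_def frechet_derivative_works .
  show lin: "linear ?G" using G has_derivative_linear by blast
  obtain e where e: "0 < e" "\<And>v. dist v (snd c x) < e \<Longrightarrow> proj K v \<in> ?S" and cs: "snd c x \<in> coord_space K"
    by (rule chart_interior[OF c openin_dom[OF c] order_refl x]) (rule that, assumption+)
  have S: "v \<in> ?S" if "v \<in> coord_space K" "dist v (snd c x) < e" for v
    using e(2)[OF that(2)] unfolding proj_id[OF that(1)] .
  show Gp: "((\<lambda>w. in_chart c f (proj K w)) has_derivative (\<lambda>u. ?G (proj K u))) (at (snd c x))"
    by (rule has_derivative_compose_proj[OF G cs e(1) S])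
  show "?G u \<in> dir" if u: "u \<in> coord_space K"
  proof -
    \<comment> \<open>This linear map vanishes on \<open>dir\<close>, and differences of values of
      \<open>f\<close> lie in \<open>dir\<close>. So its composition with \<open>f\<close> is
      locally constant, and the derivative of \<open>f\<close> is fixed by \<open>combine\<close>
      after \<open>coords\<close>.\<close>
    let ?R = "\<lambda>w. combine (coords w) - w"
    have R: "bounded_linear ?R"
      by (intro bounded_linear_sub bounded_linear_compose[OF _ bounded_linear_coords] bounded_linear_ident
          linear_conv_bounded_linear[THEN iffD1, OF linear_combine])
    have "((\<lambda>w. ?R (in_chart c f (proj K w))) has_derivative (\<lambda>u. ?R (?G (proj K u)))) (at (snd c x))"
      by (rule bounded_linear.has_derivative[OF R Gp])
    moreover have "((\<lambda>w. ?R (in_chart c f (proj K w))) has_derivative (\<lambda>u. 0)) (at (snd c x))"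
    proof (rule has_derivative_transform_within_open[OF has_derivative_const[of "?R (f x)"]])
      fix v assume "v \<in> ball (snd c x) e"
      then obtain y where y: "y \<in> fst c" "proj K v = snd c y" using e(2)[of v] by (auto simp: dist_commute)
      have "f y - f x \<in> dir" using image dom_subset[OF c] x(1) y(1) by (intro direction_spaceI subset_hull) auto
      then have "?R (f y - f x) = 0" by (simp add: combine_coords)
      then have "?R (f y) = ?R (f x)" using linear_diff[OF bounded_linear.linear[OF R], of "f y" "f x"] by simp
      then show "?R (f x) = ?R (in_chart c f (proj K v))" by (simp add: y(2) in_chart_apply[OF c y(1)])
    qed (use e in auto)
    ultimately have "(\<lambda>u. ?R (?G (proj K u))) = (\<lambda>u. 0)" by (rule has_derivative_unique)
    from fun_cong[OF this, of u] have "combine (coords (?G u)) = ?G u" by (simp add: proj_id[OF u])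
    then show ?thesis using combine_dir[of "coords (?G u)"] by (rule subst)
  qed
qed

section \<open>The derivative of \<open>f\<close> in coordinates, and regular values\<close>

definition coord_deriv :: "('a, 'n) chart \<Rightarrow> 'a \<Rightarrow> real^'n \<Rightarrow> real^'n"
  where "coord_deriv c x = (\<lambda>u. coords (chart_derivative c f x u))"

lemma has_derivative_coords_chart:
  assumes "c \<in> A" and "x \<in> fst c" "x \<notin> bdry"
  shows "((\<lambda>w. coords (in_chart c f (proj K w) - y)) has_derivative (\<lambda>u. coord_deriv c x (proj K u))) (at (snd c x))"
  unfolding coord_deriv_def
  using bounded_linear.has_derivative[OF bounded_linear_coords
      has_derivative_diff[OF chart_derivative_properties(1)[OF assms] has_derivative_const[of y]]]
  by simp

lemma regular_zero_iff:
  assumes c: "c \<in> A" and x: "x \<in> fst c" "x \<notin> bdry"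
  shows "regular_zero c (\<lambda>x. coords (f x - y)) x D \<longleftrightarrow>
    D = stab K (coord_deriv c x) \<and> det (matrix (stab K (coord_deriv c x))) \<noteq> 0"
proof -
  have eq: "in_chart c (\<lambda>x. coords (f x - y)) = (\<lambda>w. coords (in_chart c f w - y))"
    by (simp add: in_chart_def fun_eq_iff)
  have "(stab K (in_chart c (\<lambda>x. coords (f x - y))) has_derivative stab K (coord_deriv c x)) (at (snd c x))"
    unfolding eq by (rule has_derivative_stab[OF has_derivative_coords_chart[OF assms]])
  then have "(stab K (in_chart c (\<lambda>x. coords (f x - y))) has_derivative D) (at (snd c x)) \<longleftrightarrow> D = stab K (coord_deriv c x)"
    by (auto dest: has_derivative_unique)
  then show ?thesis unfolding regular_zero_def by blast
qed

text \<open>Links the surjectivity in \<open>regular_value\<close> with the determinants used for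
  counting. Added coordinates can be prescribed freely, so completion keeps surjectivity, and for
  endomorphisms this is injectivity.\<close>

lemma stab_coord_deriv_inj_iff:
  assumes c: "c \<in> A" and x: "x \<in> fst c" "x \<notin> bdry"
  shows "det (matrix (stab K (coord_deriv c x))) \<noteq> 0 \<longleftrightarrow> chart_derivative c f x ` coord_space K = dir"
proof -
  let ?G = "chart_derivative c f x" and ?F = "stab K (coord_deriv c x)"
  note G = chart_derivative_properties[OF assms]
  have linF: "linear ?F"
    using has_derivative_linear[OF has_derivative_stab[OF has_derivative_coords_chart[OF assms]]] .
  have cs: "coord_deriv c x (proj K v) \<in> coord_space K" for v
    unfolding coord_deriv_def by (intro coords_dir G(3)) simp
  show ?thesis
  proof
    assume "det (matrix ?F) \<noteq> 0"
    then have "inj ?F" using det_nz_iff_inj[OF linF] by blast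
    then have surj: "surj ?F" by (rule linear_injective_imp_surjective[OF linF]) (rule refl)
    have "w \<in> ?G ` coord_space K" if w: "w \<in> dir" for w
    proof -
      obtain v where v: "coords w = ?F v" using surj by (rule surjE)
      have "coords (?G (proj K v)) = proj K (?F v)"
        using proj_stab[of "coord_deriv c x" K v, OF cs] by (simp add: coord_deriv_def)
      also have "\<dots> = coords w" unfolding v[symmetric] by (rule proj_id[OF coords_dir[OF w]])
      finally have "combine (coords (?G (proj K v))) = combine (coords w)" by (rule arg_cong)
      then have "?G (proj K v) = w"
        unfolding combine_coords[OF w] combine_coords[OF G(3)[OF proj_in_coord_space]] .
      then show ?thesis by (intro image_eqI[of _ _ "proj K v"]) simp_all
    qed
    then show "?G ` coord_space K = dir" using G(3) by blast
  next
    assume im: "?G ` coord_space K = dir"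
    have "\<exists>v. z = ?F v" for z
    proof -
      obtain u where u: "u \<in> coord_space K" "combine z = ?G u"
        using combine_dir[of z] im by blast
      let ?v = "u + (z - proj K z)"
      have pv: "proj K ?v = u" by (rule proj_add_complement[OF u(1)])
      have "coord_deriv c x u = proj K z" unfolding coord_deriv_def u(2)[symmetric] by (rule coords_combine)
      then have "z = ?F ?v" unfolding stab_def pv by simp
      then show ?thesis by (rule exI)
    qed
    then have "surj ?F" unfolding surj_def by blast
    then have "inj ?F" by (rule linear_surjective_imp_injective[OF linF]) (rule refl)
    then show "det (matrix ?F) \<noteq> 0" using det_nz_iff_inj[OF linF] by blast
  qed
qed

lemma continuous_f: "continuous_map M euclidean f"
proof (rule pasting_lemma[where I = A and T = fst and f = "\<lambda>_. f"])
  fix c assume c: "c \<in> A"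
  show "openin M (fst c)" by (rule openin_dom[OF c])
  let ?S = "snd c ` fst c"
  have sm: "smooth_on ?S (in_chart c f)" using smooth c by (simp add: smooth_map_def)
  have "continuous_on ?S (in_chart c f)"
    unfolding continuous_on_eq_continuous_within
    using smooth_on_has_derivative[OF sm] has_derivative_continuous by blast
  then have "continuous_map (top_of_set ?S) euclidean (in_chart c f)" by simp
  from continuous_map_compose[OF homeomorphic_imp_continuous_map[OF chart_homeo[OF c]] this]
  show "continuous_map (subtopology M (fst c)) euclidean f"
    by (rule continuous_map_eq) (simp add: in_chart_apply[OF c])
next
  show "\<exists>c. c \<in> A \<and> x \<in> fst c \<and> f x = f x" if "x \<in> topspace M" for x
    using charts_cover[OF that] by blast
qed simp

lemma rel_interior_not_bdry: "y \<in> rel_interior \<Delta> \<Longrightarrow> f x = y \<Longrightarrow> x \<notin> bdry"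
  using boundary by (auto simp: rel_frontier_def)

text \<open>Sard's theorem is applied in finitely many charts that cover the manifold, since the
  atlas may be uncountable. A preimage of a point of the relative interior is off
  \<open>bdry\<close>, so that boundary points can be left out of the critical sets.\<close>

lemma regular_value_exists: "\<exists>y. y \<in> rel_interior \<Delta> \<and> regular_value K A \<Delta> f y"
proof -
  obtain y1 where y1: "y1 \<in> rel_interior \<Delta>"
    using rel_interior_eq_empty[OF convex] nonempty by blast
  have y1h: "y1 \<in> affine hull \<Delta>" using y1 rel_interior_subset subset_hull by blast
  have "compactin M (topspace M)" using compact_M by (simp add: compact_space_def)
  moreover have "topspace M \<subseteq> \<Union> (fst ` A)" using charts_cover by blast
  ultimately obtain F where F: "finite F" "F \<subseteq> fst ` A" "topspace M \<subseteq> \<Union> F"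
    using compactinD[of M "topspace M" "fst ` A"] openin_dom by blast
  then obtain A' where A': "A' \<subseteq> A" "finite A'" "F = fst ` A'"
    using finite_subset_image[OF F(1,2)] by blast
  define q where "q c v = coords (in_chart c f v - y1)" for c :: "('a, 'n) chart" and v
  define Q where "Q c v = coord_deriv c (inv_into (fst c) (snd c) v)" for c v
  define S where "S c = snd c ` (fst c - bdry)" for c :: "('a, 'n) chart"
  define N where "N c = stab K (q c) ` {v. proj K v \<in> S c \<and> det (matrix (stab K (Q c (proj K v)))) = 0}" for c
  have Qx: "Q c (snd c x) = coord_deriv c x" if "c \<in> A" "x \<in> fst c" for c x
    using chart_inj[OF that(1)] that(2) by (simp add: Q_def)
  have "negligible (N c)" if c: "c \<in> A" for c
    unfolding N_def
  proof (rule negligible_stab_critical)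
    fix v assume "v \<in> S c"
    then obtain x where x: "x \<in> fst c" "x \<notin> bdry" "v = snd c x" by (auto simp: S_def)
    show "((\<lambda>v. q c (proj K v)) has_derivative (\<lambda>u. Q c v (proj K u))) (at v)"
      unfolding q_def x(3) Qx[OF c x(1)] by (rule has_derivative_coords_chart[OF c x(1,2)])
  qed
  then have N: "negligible (\<Union>c\<in>A'. N c)" using A' by (intro negligible_Union) auto
  obtain T where T: "open T" "rel_interior \<Delta> = affine hull \<Delta> \<inter> T"
    using openin_rel_interior[of \<Delta>] unfolding openin_open by blast
  have hull: "y1 + combine v \<in> affine hull \<Delta>" for v
    by (rule affine_hull_add_direction[OF y1h combine_dir])
  \<comment> \<open>Values are parametrized by the full space \<open>real ^ 'n\<close>, where
    negligibility is meaningful for every dimension of \<Delta>; \<open>combine\<close> ignores the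
    added coordinates of \<open>Y\<close>.\<close>
  let ?O = "(\<lambda>Y. y1 + combine Y) -` T"
  have "continuous_on UNIV (\<lambda>Y. y1 + combine Y)"
    by (intro continuous_intros linear_continuous_on linear_conv_bounded_linear[THEN iffD1, OF linear_combine])
  then have "open ?O" by (rule open_vimage[OF T(1)])
  moreover have "0 \<in> ?O" using y1 T(2) by (simp add: linear_0[OF linear_combine])
  then have "?O \<noteq> {}" by blast
  ultimately obtain Y where Y: "Y \<in> ?O" "Y \<notin> (\<Union>c\<in>A'. N c)"
    using open_not_subset_negligible[OF N, of ?O] by blast
  define y where "y = y1 + combine Y"
  have y: "y \<in> rel_interior \<Delta>" using Y(1) T(2) hull by (simp add: y_def)
  \<comment> \<open>Regularity is required in every chart of the atlas; it is established in a chart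
    of the finite subcover and transported by \<open>chart_change\<close>.\<close>
  have "chart_derivative c f x ` coord_space K = dir" if c: "c \<in> A" and x: "x \<in> fst c" "f x = y" for c x
  proof -
    have xb: "x \<notin> bdry" by (rule rel_interior_not_bdry[OF y x(2)])
    have "x \<in> topspace M" using dom_subset[OF c] x(1) by blast
    then obtain c1 where c1: "c1 \<in> A'" "x \<in> fst c1" using F(3) A'(3) by blast
    then have c1A: "c1 \<in> A" using A'(1) by blast
    have "det (matrix (stab K (Q c1 (snd c1 x)))) \<noteq> 0"
    proof (rule stab_regular_preimage)
      show "Y \<notin> stab K (q c1) ` {v. proj K v \<in> S c1 \<and> det (matrix (stab K (Q c1 (proj K v)))) = 0}"
        using Y(2) c1(1) unfolding N_def by blast
      show "snd c1 x \<in> S c1" using c1(2) xb by (simp add: S_def)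
      show "snd c1 x \<in> coord_space K" by (rule chart_coord_space[OF c1A c1(2)])
      show "q c1 (snd c1 x) = proj K Y"
        by (simp add: q_def in_chart_apply[OF c1A c1(2)] x(2) y_def coords_combine)
    qed
    then have "regular_zero c1 (\<lambda>x. coords (f x - y)) x (stab K (coord_deriv c1 x))"
      unfolding regular_zero_iff[OF c1A c1(2) xb] Qx[OF c1A c1(2)] by blast
    from chart_change[OF c c1A x(1) c1(2) xb this]
    have "det (matrix (stab K (coord_deriv c x))) \<noteq> 0"
      unfolding regular_zero_iff[OF c x(1) xb] by blast
    then show ?thesis unfolding stab_coord_deriv_inj_iff[OF c x(1) xb] .
  qed
  then show ?thesis using y unfolding regular_value_def by blast
qed

lemma map_degree_eq_0:
  assumes g: "continuous_map M (top_of_set \<Delta>) g" and ne: "\<And>x. x \<in> topspace M \<Longrightarrow> f x \<noteq> g x"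
  shows "map_degree K M A ori \<Delta> b f = 0"
proof -
  \<comment> \<open>The same choice as in \<open>map_degree\<close>, so that the degree unfolds to
    the count at this \<open>y\<close>; likewise the chart \<open>c\<close> below is the one chosen
    in \<open>local_sign\<close>.\<close>
  define y where "y = (SOME y. y \<in> rel_interior \<Delta> \<and> regular_value K A \<Delta> f y)"
  have y: "y \<in> rel_interior \<Delta>" and reg: "regular_value K A \<Delta> f y"
    using someI_ex[OF regular_value_exists] by (auto simp: y_def)
  have gc: "continuous_map M euclidean g" and g\<Delta>: "\<And>x. x \<in> topspace M \<Longrightarrow> g x \<in> \<Delta>"
    using g by (auto simp: continuous_map_in_subtopology)
  have y\<Delta>: "y \<in> \<Delta>" using y rel_interior_subset by blast
  define h0 where "h0 x = coords (f x - y)" for x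
  define h1 where "h1 x = coords (f x - g x)" for x
  define s where "s x = real_of_int (local_sign K A ori b f x)" for x
  have d0: "f x - y \<in> dir" and d1: "f x - g x \<in> dir" if "x \<in> topspace M" for x
    using image[OF that] g\<Delta>[OF that] y\<Delta> by (auto intro!: direction_spaceI subset_hull)
  have coords_cont: "continuous_map M euclidean (\<lambda>x. coords (w x))" if "continuous_map M euclidean w" for w
    using continuous_map_compose[OF that, of euclidean coords] linear_continuous_on[OF bounded_linear_coords]
    by (simp add: o_def)
  have h0_0: "h0 x = 0 \<longleftrightarrow> f x = y" if "x \<in> topspace M" for x
    using coords_eq_0_iff[OF d0[OF that]] by (simp add: h0_def)
  have good: "good h0 s"
    unfolding good_def
  proof (intro conjI ballI impI)
    show "continuous_map M euclidean h0"
      unfolding h0_def by (intro coords_cont continuous_map_diff continuous_f) simp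
    show "h0 ` topspace M \<subseteq> coord_space K" using coords_dir[OF d0] by (auto simp: h0_def)
    show "h0 x \<noteq> 0" if "x \<in> bdry" for x
      using h0_0 that bdry_subset rel_interior_not_bdry[OF y] by blast
    fix x assume x: "x \<in> topspace M" "h0 x = 0"
    then have fx: "f x = y" using h0_0 by simp
    have xb: "x \<notin> bdry" by (rule rel_interior_not_bdry[OF y fx])
    define c where "c = (SOME c. c \<in> A \<and> x \<in> fst c)"
    have "\<exists>c. c \<in> A \<and> x \<in> fst c" using charts_cover[OF x(1)] by blast
    from someI_ex[OF this] have c: "c \<in> A" "x \<in> fst c" by (auto simp: c_def)
    have im: "chart_derivative c f x ` coord_space K = dir"
      using reg c fx unfolding regular_value_def by blast
    have "regular_zero c h0 x (stab K (coord_deriv c x))"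
      unfolding h0_def regular_zero_iff[OF c xb] stab_coord_deriv_inj_iff[OF c xb] using im by blast
    moreover have "det_wrt K b (chart_derivative c f x) = det (matrix (stab K (coord_deriv c x)))"
      unfolding coord_deriv_def
    proof (rule det_wrt_eq[OF inj_b indep_b linear_coords coords_b chart_derivative_properties(2)[OF c xb]])
      fix j assume "j \<in> K"
      then have "axis j 1 \<in> coord_space K" by (auto simp: coord_space_def axis_def)
      then show "chart_derivative c f x (axis j 1) \<in> span (b ` K)"
        unfolding span_b by (rule chart_derivative_properties(3)[OF c xb])
    qed
    then have "s x = ori c x * sgn (det (matrix (stab K (coord_deriv c x))))"
      unfolding s_def local_sign_def c_def[symmetric] Let_def using det_sign_eq_sgn[of K b] by simp
    ultimately show "\<exists>c\<in>A. x \<in> fst c \<and> (\<exists>D. regular_zero c h0 x D \<and> s x = ori c x * sgn (det (matrix D)))"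
      using c by blast
  qed
  have "compact ((\<lambda>x. f x - g x) ` topspace M)"
    using image_compactin[of M "topspace M" euclidean "\<lambda>x. f x - g x"] compact_M continuous_map_diff[OF continuous_f gc]
    by (simp add: compact_space_def)
  moreover have "\<not> (\<exists>v\<in>(\<lambda>x. f x - g x) ` topspace M. v = 0)" using ne by auto
  ultimately obtain \<delta> where \<delta>: "0 < \<delta>" "\<forall>v\<in>(\<lambda>x. f x - g x) ` topspace M. \<delta> \<le> norm v"
    using brouwer_compactness_lemma[of "(\<lambda>x. f x - g x) ` topspace M" "\<lambda>v. v"] continuous_on_id by blast
  \<comment> \<open>Contains all triples of \<open>f x\<close>, \<open>g x\<close> and a parameter
    for boundary points \<open>x\<close>, and is compact by itself. The bound \<delta> records that
    \<open>f\<close> and \<open>g\<close> stay apart, which excludes a zero at the parameter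
    1.\<close>
  let ?X = "(rel_frontier \<Delta> \<times> \<Delta> \<times> {0..1::real}) \<inter> {z. \<delta> \<le> norm (fst z - fst (snd z))}"
  let ?E = "\<lambda>z. coords (fst z - ((1 - snd (snd z)) *\<^sub>R y + snd (snd z) *\<^sub>R fst (snd z)))"
  have "compact ?X"
    by (intro compact_Int_closed compact_Times compact_Icc compact compact_rel_frontier_bounded
        compact_imp_bounded closed_Collect_le continuous_intros)
  moreover have "continuous_on ?X ?E"
    by (intro continuous_on_compose2[OF linear_continuous_on[OF bounded_linear_coords, of UNIV]] continuous_intros) auto
  moreover have "\<not> (\<exists>z\<in>?X. ?E z = 0)"
  proof
    assume "\<exists>z\<in>?X. ?E z = 0"
    then obtain p r t where p: "p \<in> rel_frontier \<Delta>" and r: "r \<in> \<Delta>" and t: "0 \<le> t" "t \<le> 1"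
      and pr: "\<delta> \<le> norm (p - r)" and 0: "coords (p - ((1 - t) *\<^sub>R y + t *\<^sub>R r)) = 0" by auto
    have p\<Delta>: "p \<in> \<Delta>" using p compact_imp_closed[OF compact] by (simp add: rel_frontier_def)
    have "(1 - t) *\<^sub>R y + t *\<^sub>R r \<in> \<Delta>" by (rule convexD_alt[OF convex y\<Delta> r t])
    then have "p - ((1 - t) *\<^sub>R y + t *\<^sub>R r) \<in> dir" using p\<Delta> by (intro direction_spaceI subset_hull)
    then have eq: "p = (1 - t) *\<^sub>R y + t *\<^sub>R r" using 0 coords_eq_0_iff by auto
    show False
    proof (cases "t = 1")
      case True
      then show False using eq pr \<delta>(1) by simp
    next
      case False
      have "r - (1 - t) *\<^sub>R (r - y) \<in> rel_interior \<Delta>"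
        by (rule rel_interior_closure_convex_shrink[OF convex y]) (use r closure_subset t False in auto)
      then have "p \<in> rel_interior \<Delta>" unfolding eq by (simp add: algebra_simps)
      then show False using p by (simp add: rel_frontier_def)
    qed
  qed
  ultimately obtain \<mu> where \<mu>: "0 < \<mu>" "\<forall>z\<in>?X. \<mu> \<le> norm (?E z)"
    by (rule brouwer_compactness_lemma)
  have "sum s (zeros h0) = 0"
  proof (rule nonvanishing_homotopy_zero_sum[OF good _ _ _ \<mu>(1)])
    show "continuous_map M euclidean h1"
      unfolding h1_def by (intro coords_cont continuous_map_diff continuous_f gc)
    show "h1 x \<in> coord_space K" if "x \<in> topspace M" for x using coords_dir[OF d1[OF that]] by (simp add: h1_def)
    show "h1 x \<noteq> 0" if "x \<in> topspace M" for x
      using coords_eq_0_iff[OF d1[OF that]] ne[OF that] by (simp add: h1_def)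
    show "\<mu> \<le> norm ((1 - t) *\<^sub>R h0 x + t *\<^sub>R h1 x)" if x: "x \<in> bdry" and t: "0 \<le> t" "t \<le> 1" for x t
    proof -
      have xM: "x \<in> topspace M" using x bdry_subset by blast
      have "(f x, g x, t) \<in> ?X" using boundary[OF x] g\<Delta>[OF xM] t \<delta>(2) xM by auto
      then have "\<mu> \<le> norm (?E (f x, g x, t))" using \<mu>(2) by blast
      moreover have "?E (f x, g x, t) = (1 - t) *\<^sub>R h0 x + t *\<^sub>R h1 x"
      proof -
        have "f x - ((1 - t) *\<^sub>R y + t *\<^sub>R g x) = (1 - t) *\<^sub>R (f x - y) + t *\<^sub>R (f x - g x)"
          by (simp add: algebra_simps)
        then show ?thesis
          by (simp add: h0_def h1_def linear_add[OF linear_coords] linear_scale[OF linear_coords])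
      qed
      ultimately show ?thesis by simp
    qed
  qed
  moreover have "zeros h0 = {x \<in> topspace M. f x = y}" using h0_0 by (auto simp: zeros_def)
  ultimately have "real_of_int (\<Sum>x | x \<in> topspace M \<and> f x = y. local_sign K A ori b f x) = 0"
    by (simp add: s_def)
  then have "(\<Sum>x | x \<in> topspace M \<and> f x = y. local_sign K A ori b f x) = 0"
    by (simp only: of_int_eq_0_iff)
  then show ?thesis by (simp add: map_degree_def Let_def y_def[symmetric])
qed

end

theorem theorem4p4:
  fixes d :: nat
    and K :: "'n::finite set"
    and \<Delta> :: "'b::euclidean_space set"
    and b :: "'n \<Rightarrow> 'b"
    and M :: "'a topology"
    and A :: "('a, 'n) chart set"
    and ori :: "('a, 'n) chart \<Rightarrow> 'a \<Rightarrow> int"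
    and f g :: "'a \<Rightarrow> 'b"
  assumes "card K = d"
    and "convex \<Delta>" and "compact \<Delta>" and "aff_dim \<Delta> = int d" and "affine_frame K \<Delta> b"
    and "compact_space M" and "smooth_manifold K M A" and "orientation K M A ori"
    and "continuous_map M (top_of_set \<Delta>) g"
    and "f ` topspace M \<subseteq> \<Delta>" and "smooth_map A f"
    and "manifold_boundary K M A \<subseteq> {x \<in> topspace M. f x \<in> rel_frontier \<Delta>}"
    and "map_degree K M A ori \<Delta> b f \<noteq> 0"
  shows "\<exists>x\<in>topspace M. f x = g x"
proof (rule ccontr)
  assume none: "\<not> (\<exists>x\<in>topspace M. f x = g x)"
  \<comment> \<open>The empty set has \<open>aff_dim\<close> equal to -1, which is not of the form
    \<open>int d\<close>.\<close>
  have "\<Delta> \<noteq> {}" using assms(4) by auto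
  then interpret smooth_map_to_convex K M A ori \<Delta> b f
    by unfold_locales (use assms in auto)
  from map_degree_eq_0[OF assms(9)] none assms(13) show False by blast
qed

end
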